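(* Let $0<T<\infty$, let $r\ge 16$ be an integer, and let $u_0\in H^r$ be real-valued and $2\pi$-periodic. Let $u$ be the solution of the periodic Kawahara equation $u_t+uu_x+u_{xxx}-u_{xxxxx}=0$ with $u(\cdot,0)=u_0$. Then there exist constants $C_1>0$ and $C>0$, independent of $N$ and $\Delta t$, such that the following holds. Let $N,M$ be positive integers, $\Delta t=T/M$, $t_m=m\Delta t$, and suppose $N\Delta t\le C_1$. Let $U^0,\dots,U^M\in S_N$ be real-valued with $U^0=P_Nu_0$ and satisfy $$(U^{m+1}-U^m,\phi)+\Delta t\,\bigl(U^{m+1/2}U^{m+1/2}_x+U^{m+1/2}_{xxx}-U^{m+1/2}_{xxxxx},\phi\bigr)=0\quad\text{for all }\phi\in S_N,\ 0\le m\le M-1,$$ where $U^{m+1/2}=\frac12(U^m+U^{m+1})$. Then $$\max_{0\le m\le M}\|u(\cdot,t_m)-U^m\|\le C\left(\frac1{N^r}+\Delta t^2\right).$$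
   Context: All functions are $2\pi$-periodic in $x$; function spaces are on $[-\pi,\pi]$. $(f,g)=\int_{-\pi}^{\pi} f\,\overline{g}\,dx$ is the $L^2$ inner product and $\|\cdot\|$ its norm. With $\hat f(k)=\frac1{2\pi}\int_{-\pi}^{\pi}e^{-ikx}f(x)\,dx$, the periodic Sobolev space $H^r$ has norm $\|f\|_r=\left(\sum_{k\in\mathbb Z}(1+k^2)^r|\hat f(k)|^2\right)^{1/2}$. $S_N=\mathrm{span}\{e^{ikx}: k\in\mathbb Z,\ -N\le k\le N\}$ and $P_N$ is the $L^2$-orthogonal projection onto $S_N$. The solution $u$ of the Kawahara equation with data $u_0\in H^r$, $r\ge 5$, is the (known to exist) unique real-valued, $2\pi$-periodic solution in $C([0,\infty);H^r)\cap C^1([0,\infty);H^{r-5})$. Constants may depend on $T$, $r$ and $u_0$. *)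

theory Defs
  imports "HOL-Analysis.Analysis"
begin

text \<open>
  Elements of \<open>L\<^sup>2\<close> and \<open>H\<^sup>r\<close> are represented by arbitrary \<open>2\<pi>\<close>-periodic functions on the
  real line, not by a distinguished (continuous) representative. Hence derivatives of such
  elements are weak derivatives, and equations between them hold almost everywhere.
\<close>

abbreviation per_measure :: "real measure"
  where "per_measure \<equiv> lebesgue_on {-pi..pi}"

definition periodic :: "(real \<Rightarrow> complex) \<Rightarrow> bool"
  where "periodic f \<longleftrightarrow> (\<forall>x. f (x + 2 * pi) = f x)"

definition real_valued :: "(real \<Rightarrow> complex) \<Rightarrow> bool"
  where "real_valued f \<longleftrightarrow> (\<forall>x. f x \<in> \<real>)"

definition L2_per :: "(real \<Rightarrow> complex) set"
  where "L2_per = {f. periodic f \<and> f \<in> borel_measurable per_measure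
                      \<and> integrable per_measure (\<lambda>x. (cmod (f x))\<^sup>2)}"

definition l2_inner :: "(real \<Rightarrow> complex) \<Rightarrow> (real \<Rightarrow> complex) \<Rightarrow> complex"
  where "l2_inner f g = (LINT x|per_measure. f x * cnj (g x))"

definition l2_norm :: "(real \<Rightarrow> complex) \<Rightarrow> real"
  where "l2_norm f = sqrt (Re (l2_inner f f))"

definition fourier_coeff :: "(real \<Rightarrow> complex) \<Rightarrow> int \<Rightarrow> complex"
  where "fourier_coeff f k = (LINT x|per_measure. cis (- (of_int k * x)) * f x) / (2 * of_real pi)"

definition sobolev_space :: "nat \<Rightarrow> (real \<Rightarrow> complex) set"
  where "sobolev_space r = {f \<in> L2_per.
           (\<lambda>k::int. (1 + (of_int k)\<^sup>2) ^ r * (cmod (fourier_coeff f k))\<^sup>2) summable_on UNIV}"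

definition sobolev_norm :: "nat \<Rightarrow> (real \<Rightarrow> complex) \<Rightarrow> real"
  where "sobolev_norm r f =
           sqrt (\<Sum>\<^sub>\<infinity>k::int. (1 + (of_int k)\<^sup>2) ^ r * (cmod (fourier_coeff f k))\<^sup>2)"

definition trig_space :: "nat \<Rightarrow> (real \<Rightarrow> complex) set"
  where "trig_space N =
           {f. \<exists>c :: int \<Rightarrow> complex. f = (\<lambda>x. \<Sum>k\<in>{- int N..int N}. c k * cis (of_int k * x))}"

definition l2_proj :: "nat \<Rightarrow> (real \<Rightarrow> complex) \<Rightarrow> real \<Rightarrow> complex"
  where "l2_proj N f =
           (THE p. p \<in> trig_space N \<and> (\<forall>\<phi>\<in>trig_space N. l2_inner (\<lambda>x. f x - p x) \<phi> = 0))"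

definition Dx :: "(real \<Rightarrow> complex) \<Rightarrow> real \<Rightarrow> complex"
  where "Dx f = (\<lambda>x. vector_derivative f (at x))"

definition test_function :: "(real \<Rightarrow> complex) \<Rightarrow> bool"
  where "test_function \<phi> \<longleftrightarrow> periodic \<phi> \<and> (\<forall>n x. (Dx ^^ n) \<phi> differentiable (at x))"

definition weak_deriv :: "nat \<Rightarrow> (real \<Rightarrow> complex) \<Rightarrow> (real \<Rightarrow> complex) \<Rightarrow> bool"
  where "weak_deriv j f g \<longleftrightarrow> g \<in> L2_per \<and>
           (\<forall>\<phi>. test_function \<phi> \<longrightarrow>
              (LINT x|per_measure. f x * (Dx ^^ j) \<phi> x)
                = (-1) ^ j * (LINT x|per_measure. g x * \<phi> x))"

text \<open>Membership in \<open>C([0,\<infinity>); H\<^sup>r)\<close>.\<close>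

definition C0_sobolev :: "nat \<Rightarrow> (real \<Rightarrow> real \<Rightarrow> complex) \<Rightarrow> bool"
  where "C0_sobolev r u \<longleftrightarrow>
           (\<forall>t\<ge>0. u t \<in> sobolev_space r \<and>
              ((\<lambda>s. sobolev_norm r (\<lambda>x. u s x - u t x)) \<longlongrightarrow> 0) (at t within {0..}))"

text \<open>\<open>v\<close> is the time derivative of \<open>u\<close> in \<open>C\<^sup>1([0,\<infinity>); H\<^sup>r)\<close>, one-sided at \<open>t = 0\<close>.\<close>

definition C1_sobolev_deriv ::
    "nat \<Rightarrow> (real \<Rightarrow> real \<Rightarrow> complex) \<Rightarrow> (real \<Rightarrow> real \<Rightarrow> complex) \<Rightarrow> bool"
  where "C1_sobolev_deriv r u v \<longleftrightarrow>
           C0_sobolev r u \<and> C0_sobolev r v \<and>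
           (\<forall>t\<ge>0. ((\<lambda>s. sobolev_norm r (\<lambda>x. (u s x - u t x) / of_real (s - t) - v t x)) \<longlongrightarrow> 0)
                    (at t within {0..}))"

text \<open>
  The real-valued solution with data \<open>u0\<close> in
  \<open>C([0,\<infinity>); H\<^sup>r) \<inter> C\<^sup>1([0,\<infinity>); H\<^bsup>r-5\<^esup>)\<close>, written as \<open>u t x\<close>. The definition is meant
  for \<open>r \<ge> 5\<close>, where the subtraction below is not truncated.
\<close>

definition kawahara_solution ::
    "nat \<Rightarrow> (real \<Rightarrow> complex) \<Rightarrow> (real \<Rightarrow> real \<Rightarrow> complex) \<Rightarrow> bool"
  where "kawahara_solution r u0 u \<longleftrightarrow>
           (\<forall>t\<ge>0. real_valued (u t)) \<and>
           (AE x in per_measure. u 0 x = u0 x) \<and>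
           C0_sobolev r u \<and>
           (\<exists>ut. C1_sobolev_deriv (r - 5) u ut \<and>
              (\<forall>t\<ge>0. \<exists>ux uxxx uxxxxx.
                 weak_deriv 1 (u t) ux \<and> weak_deriv 3 (u t) uxxx \<and> weak_deriv 5 (u t) uxxxxx \<and>
                 (AE x in per_measure. ut t x + u t x * ux x + uxxx x - uxxxxx x = 0)))"

text \<open>
  Solutions \<open>U\<^sup>0, \<dots>, U\<^sup>M\<close> of the Crank--Nicolson Fourier--Galerkin scheme. They are
  trigonometric polynomials, so classical derivatives are used.
\<close>

definition galerkin_cn_solution ::
    "nat \<Rightarrow> nat \<Rightarrow> real \<Rightarrow> (real \<Rightarrow> complex) \<Rightarrow> (nat \<Rightarrow> real \<Rightarrow> complex) \<Rightarrow> bool"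
  where "galerkin_cn_solution N M dt u0 U \<longleftrightarrow>
           (\<forall>m\<le>M. U m \<in> trig_space N \<and> real_valued (U m)) \<and>
           U 0 = l2_proj N u0 \<and>
           (\<forall>m<M. \<forall>\<phi>\<in>trig_space N.
              (let V = (\<lambda>x. (U m x + U (m + 1) x) / 2) in
                 l2_inner (\<lambda>x. U (m + 1) x - U m x) \<phi>
                 + of_real dt * l2_inner (\<lambda>x. V x * Dx V x + (Dx ^^ 3) V x - (Dx ^^ 5) V x) \<phi> = 0))"

end

(*
  Write a_k(t) for the Fourier coefficients of u and omega k = k^3 + k^5. The equation becomes
  a_k' = i omega_k a_k - (i k / 2) (a * a)_k. Comparing the scheme with the truncation of a to
  |k| <= N loses one power of N, because the interaction of high with low modes leaves a
  consistency error of size N^(1-r). This term is removed by a normal form: add to the truncation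
  the corrector with coefficients
      sum over |l| > N >= |k - l| of k / (omega_l - omega_k) a_l a_(k-l).
  The phase gap is at least of order N^4, so the corrector is of size N^(-r-3). In the
  Crank--Nicolson scheme a discrete Leibniz rule replaces the time derivative; the defect of
  averaging a product is one quarter of the product of the increments, which is of second order
  in dt and small in N. The corrected truncation thus satisfies the scheme up to
  O(dt (N^(-r) + dt^2)), and the L2 energy estimate with a discrete Gronwall argument concludes.

  To pass to the Fourier side one needs that an integrable function with vanishing Fourier
  coefficients is zero almost everywhere: by Stone--Weierstrass on the circle it is orthogonal to
  all continuous periodic functions, and by Lusin the conjugate phase of f is a bounded pointwise
  limit of such functions.
*)

theory Submission
  imports Defs
begin

subsection \<open>Sequences indexed by the integers and convolution\<close>

text \<open>Coefficient bounds are weighted sup bounds with explicit constants, so that uniformity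
  in \<open>N\<close>, \<open>dt\<close> and \<open>t\<close> can be read off and products rest on
  one elementary inequality. The lost power sits in the high-low interaction: the high part has size
  N^(-r), but the derivative contributes a factor |k| up to N. The high-high interaction is
  quadratic in the small part and harmless. The corrector amounts to integration by parts in time:
  when the equation is inserted for its high factor, the phase difference reproduces exactly the bad
  term, and everything else keeps the factor 1/gap. It is real-valued and supported in the band, so
  the scheme can be compared directly with the corrected truncation in the energy identity. There
  the dispersive term is imaginary and the self-interaction of the error cancels; hence neither a
  bound on the numerical solution nor a bootstrap enters. The restriction on N dt acts through dt <=
  N dt: it makes the implicit term in the Gronwall step absorbable.\<close>

definition wt :: "int \<Rightarrow> real"
  where "wt k = 1 + \<bar>real_of_int k\<bar>"

text \<open>\<open>infsum\<close> yields 0 on families that are not summable, so additivity in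
  either argument asks for absolute summability.\<close>

definition conv :: "(int \<Rightarrow> complex) \<Rightarrow> (int \<Rightarrow> complex) \<Rightarrow> int \<Rightarrow> complex"
  where "conv f g k = (\<Sum>\<^sub>\<infinity>l. f l * g (k - l))"

text \<open>A weighted sup norm rather than a sum of squares: a multiplier of order \<open>j\<close>
  lowers the order by \<open>j\<close>, and convolution preserves it from order 2 on, with constants
  in which neither \<open>N\<close> nor \<open>t\<close> occurs. Carrying \<open>C\<close>
  explicitly makes this uniformity visible.\<close>

definition decays :: "nat \<Rightarrow> real \<Rightarrow> (int \<Rightarrow> complex) \<Rightarrow> bool"
  where "decays s C f \<longleftrightarrow> (\<forall>k. norm (f k) \<le> C / wt k ^ s)"

definition wtsum :: real
  where "wtsum = (\<Sum>\<^sub>\<infinity>k. 1 / wt k ^ 2)"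

abbreviation abs_summable :: "(int \<Rightarrow> complex) \<Rightarrow> bool"
  where "abs_summable b \<equiv> (\<lambda>l. norm (b l)) summable_on UNIV"

lemma wt_ge_1 [simp]: "1 \<le> wt k"
  by (simp add: wt_def)

lemma wt_pos [simp]: "0 < wt k"
  by (simp add: wt_def add_pos_nonneg)

lemma wt_nonneg [simp]: "0 \<le> wt k"
  by (simp add: wt_def)

lemma wt_nonzero [simp]: "wt k \<noteq> 0"
  using wt_pos[of k] by linarith

lemma wt_triangle: "wt k \<le> wt l + wt (k - l)"
  by (simp add: wt_def)

lemma wt_power_mono: "m \<le> n \<Longrightarrow> wt k ^ m \<le> wt k ^ n"
  by (rule power_increasing) auto

lemma summable_wt: "(\<lambda>k. 1 / wt k ^ 2) summable_on UNIV"
proof -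
  have "summable (\<lambda>n. 1 / (real n + 1) ^ 2)"
    using inverse_squares_sums by (auto simp: sums_iff add.commute)
  then have n: "(\<lambda>n. 1 / (1 + real n) ^ 2) summable_on (UNIV :: nat set)"
    by (intro norm_summable_imp_summable_on) (simp add: add.commute)
  have 1: "(\<lambda>k. 1 / wt k ^ 2) summable_on (range int)"
    by (subst summable_on_reindex) (use n in \<open>auto simp: o_def wt_def\<close>)
  have 2: "(\<lambda>k. 1 / wt k ^ 2) summable_on (range (\<lambda>n. - int n))"
    by (subst summable_on_reindex) (use n in \<open>auto simp: o_def wt_def inj_on_def\<close>)
  have "UNIV = range int \<union> range (\<lambda>n. - int n)"
    by (auto simp: image_iff) (metis int_cases2)
  then show ?thesis using summable_on_union[OF 1 2] by simp
qed

lemma wtsum_nonneg: "0 \<le> wtsum"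
  by (simp add: wtsum_def infsum_nonneg)

lemma sum_wt_le: "finite F \<Longrightarrow> (\<Sum>k\<in>F. 1 / wt k ^ 2) \<le> wtsum"
  unfolding wtsum_def by (rule finite_sum_le_infsum[OF summable_wt]) auto

lemma decaysD: "decays s C f \<Longrightarrow> norm (f k) \<le> C / wt k ^ s"
  by (simp add: decays_def)

lemma decays_nonneg: "decays s C f \<Longrightarrow> 0 \<le> C"
  using decaysD[of s C f 0] norm_ge_zero[of "f 0"] by (simp add: wt_def del: norm_ge_zero)

lemma decays_mono:
  assumes "decays s C f" "s' \<le> s" "C \<le> C'"
  shows "decays s' C' f"
  unfolding decays_def
proof
  fix k
  have "norm (f k) \<le> C / wt k ^ s" by (rule decaysD[OF assms(1)])
  also have "\<dots> \<le> C' / wt k ^ s'"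
    using assms decays_nonneg[OF assms(1)] by (intro frac_le wt_power_mono) auto
  finally show "norm (f k) \<le> C' / wt k ^ s'" .
qed

lemma decays_add:
  assumes "decays s C f" "decays s C' g"
  shows "decays s (C + C') (\<lambda>k. f k + g k)"
  unfolding decays_def
  using norm_triangle_mono[OF decaysD[OF assms(1)] decaysD[OF assms(2)]] by (simp add: add_divide_distrib)

lemma decays_const_mult:
  assumes "decays s C f"
  shows "decays s (norm c * C) (\<lambda>k. c * f k)"
  unfolding decays_def using decaysD[OF assms] by (auto simp: norm_mult intro: mult_left_mono simp flip: times_divide_eq_right)

lemma decays_multiplier:
  assumes "decays (s + j) C f" "\<And>k. norm (m k) \<le> A * wt k ^ j"
  shows "decays s (A * C) (\<lambda>k. m k * f k)"
  unfolding decays_def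
proof
  fix k
  have "norm (m k * f k) \<le> (A * wt k ^ j) * (C / wt k ^ (s + j))"
    unfolding norm_mult using order_trans[OF norm_ge_zero assms(2)] by (intro mult_mono assms decaysD[OF assms(1)]) auto
  also have "\<dots> = A * C / wt k ^ s"
    by (simp add: power_add)
  finally show "norm (m k * f k) \<le> A * C / wt k ^ s" .
qed

lemma abs_summable_comparison:
  assumes "M summable_on UNIV" "\<And>k. norm (f k) \<le> M k"
  shows "abs_summable f"
  by (rule summable_on_comparison_test[OF assms(1)]) (use assms(2) in auto)

lemma decays_abs_summable:
  assumes "decays s C f" "2 \<le> s"
  shows "abs_summable f"
proof (rule abs_summable_comparison)
  show "(\<lambda>k. C * (1 / wt k ^ 2)) summable_on UNIV"
    by (intro summable_on_cmult_right summable_wt)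
  show "norm (f k) \<le> C * (1 / wt k ^ 2)" for k
    using decaysD[OF decays_mono[OF assms order_refl]] by simp
qed

lemma decays_norm_sum_le:
  assumes "decays s C f" "2 \<le> s"
  shows "(\<Sum>\<^sub>\<infinity>k. norm (f k)) \<le> C * wtsum"
proof -
  have "(\<Sum>\<^sub>\<infinity>k. norm (f k)) \<le> (\<Sum>\<^sub>\<infinity>k. C * (1 / wt k ^ 2))"
    using decaysD[OF decays_mono[OF assms order_refl]]
    by (intro infsum_mono decays_abs_summable[OF assms] summable_on_cmult_right summable_wt) auto
  also have "\<dots> = C * wtsum"
    unfolding wtsum_def by (rule infsum_cmult_right) (rule summable_wt)
  finally show ?thesis .
qed

lemma abs_summable_bounded:
  assumes "abs_summable f"
  shows "norm (f k) \<le> (\<Sum>\<^sub>\<infinity>l. norm (f l))"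
  using finite_sum_le_infsum[OF assms, of "{k}"] by simp

lemma abs_summable_add: "abs_summable f \<Longrightarrow> abs_summable g \<Longrightarrow> abs_summable (\<lambda>k. f k + g k)"
  by (rule abs_summable_comparison[where M="\<lambda>k. norm (f k) + norm (g k)"]) (auto intro: norm_triangle_ineq summable_on_add)

lemma abs_summable_cmult: "abs_summable f \<Longrightarrow> abs_summable (\<lambda>k. c * f k)"
  by (simp add: norm_mult summable_on_cmult_right)

lemma abs_summable_diff: "abs_summable f \<Longrightarrow> abs_summable g \<Longrightarrow> abs_summable (\<lambda>k. f k - g k)"
  by (rule abs_summable_comparison[where M="\<lambda>k. norm (f k) + norm (g k)"]) (auto intro: norm_triangle_ineq4 summable_on_add)

lemma abs_summable_finite_support: "finite {k. f k \<noteq> 0} \<Longrightarrow> abs_summable f"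
  by (rule finite_nonzero_values_imp_summable_on) simp

lemma abs_summable_mult_bounded:
  assumes "abs_summable f" "\<And>l. norm (g l) \<le> B"
  shows "abs_summable (\<lambda>l. f l * g l)"
  by (rule abs_summable_comparison[OF summable_on_cmult_right[OF assms(1), of B]])
     (use assms(2) in \<open>simp add: norm_mult mult.commute[of B] mult_left_mono\<close>)

lemma conv_abs_summable:
  assumes "abs_summable f" "abs_summable g"
  shows "abs_summable (\<lambda>l. f l * g (k - l))"
  by (rule abs_summable_mult_bounded[OF assms(1) abs_summable_bounded[OF assms(2)]])

lemma conv_summable:
  assumes "abs_summable f" "abs_summable g"
  shows "(\<lambda>l. f l * g (k - l)) summable_on UNIV"
  by (rule abs_summable_summable[OF conv_abs_summable[OF assms]])

lemma conv_commute: "conv f g = conv g f"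
proof
  fix k
  show "conv f g k = conv g f k"
    unfolding conv_def by (rule infsum_reindex_bij_witness[of _ "\<lambda>l. k - l" "\<lambda>l. k - l"]) auto
qed

lemma conv_add_left:
  assumes "abs_summable f" "abs_summable f'" "abs_summable g"
  shows "conv (\<lambda>k. f k + f' k) g k = conv f g k + conv f' g k"
  unfolding conv_def distrib_right by (intro infsum_add conv_summable assms)

lemma conv_cmult_left: "conv (\<lambda>k. c * f k) g k = c * conv f g k"
  unfolding conv_def mult.assoc by (rule infsum_cmult_right')

lemma conv_add_right:
  assumes "abs_summable f" "abs_summable f'" "abs_summable g"
  shows "conv g (\<lambda>k. f k + f' k) k = conv g f k + conv g f' k"
  by (subst (1 2 3) conv_commute) (rule conv_add_left[OF assms])

lemma conv_cmult_right: "conv g (\<lambda>k. c * f k) k = c * conv g f k"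
  by (subst (1 2) conv_commute) (rule conv_cmult_left)

text \<open>The l1-sup case of Young's inequality, for factors that are uniformly small in
  \<open>N\<close> without further decay in the index.\<close>

lemma norm_conv_le:
  assumes f: "abs_summable f" and g: "\<And>l. norm (g l) \<le> B"
  shows "norm (conv f g k) \<le> (\<Sum>\<^sub>\<infinity>l. norm (f l)) * B"
proof -
  have s: "abs_summable (\<lambda>l. f l * g (k - l))"
    by (rule abs_summable_mult_bounded[OF f g])
  have "norm (conv f g k) \<le> (\<Sum>\<^sub>\<infinity>l. norm (f l * g (k - l)))"
    unfolding conv_def by (rule norm_infsum_bound[OF s])
  also have "\<dots> \<le> (\<Sum>\<^sub>\<infinity>l. norm (f l) * B)"
    by (intro infsum_mono s summable_on_cmult_left f) (auto simp: norm_mult intro: mult_left_mono g)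
  also have "\<dots> = (\<Sum>\<^sub>\<infinity>l. norm (f l)) * B"
    by (rule infsum_cmult_left) (rule f)
  finally show ?thesis .
qed

text \<open>By \<open>wt_triangle\<close> one of the two indices carries at least half of the weight
  of \<open>k\<close>. Its \<open>s\<close> powers pay for those of \<open>k\<close>, and two powers
  of the other index remain for summation.\<close>

lemma wt_split:
  assumes "2 \<le> s"
  shows "1 / wt l ^ s * (1 / wt (k - l) ^ s) \<le> 2 ^ s / wt k ^ s * (1 / wt l ^ 2 + 1 / wt (k - l) ^ 2)"
proof -
  have aux: "1 / wt p ^ s * (1 / wt q ^ s) \<le> 2 ^ s / wt k ^ s * (1 / wt q ^ 2)" if "wt k \<le> 2 * wt p" for p q
  proof (rule mult_mono)
    have "wt k ^ s \<le> (2 * wt p) ^ s" using that by (intro power_mono) auto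
    then show "1 / wt p ^ s \<le> 2 ^ s / wt k ^ s"
      by (simp add: divide_le_eq le_divide_eq power_mult_distrib)
    show "1 / wt q ^ s \<le> 1 / wt q ^ 2"
      using assms by (intro frac_le wt_power_mono) auto
  qed auto
  have nn: "0 \<le> 2 ^ s / wt k ^ s * (1 / wt l ^ 2)" "0 \<le> 2 ^ s / wt k ^ s * (1 / wt (k - l) ^ 2)"
    by auto
  show ?thesis
  proof (cases "wt k \<le> 2 * wt l")
    case True
    from aux[OF this, of "k - l"] show ?thesis using nn unfolding distrib_left by linarith
  next
    case False
    then have "wt k \<le> 2 * wt (k - l)" using wt_triangle[of k l] by linarith
    from aux[OF this, of l] show ?thesis
      using nn unfolding distrib_left mult.commute[of "1 / wt l ^ s"] by linarith
  qed
qed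

text \<open>The algebra property of the weighted sup norm. In the constant, 2^s is the halving in
  \<open>wt_split\<close>, and the further 2 counts its two sums, each equal to
  \<open>wtsum\<close>.\<close>

lemma decays_conv:
  assumes f: "decays s A f" and g: "decays s B g" and s: "2 \<le> s"
  shows "decays s (2 ^ (s + 1) * wtsum * A * B) (conv f g)"
  unfolding decays_def
proof
  fix k
  have sm': "(\<lambda>l. 1 / wt (k - l) ^ 2) summable_on UNIV"
    using summable_on_reindex_bij_witness[of UNIV "\<lambda>l. k - l" "\<lambda>l. k - l" UNIV "\<lambda>l. 1 / wt l ^ 2" "\<lambda>l. 1 / wt (k - l) ^ 2"] summable_wt
    by auto
  then have sm: "(\<lambda>l. 1 / wt l ^ 2 + 1 / wt (k - l) ^ 2) summable_on UNIV"
    by (intro summable_on_add summable_wt)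
  have re: "(\<Sum>\<^sub>\<infinity>l. 1 / wt (k - l) ^ 2) = wtsum"
    unfolding wtsum_def by (rule infsum_reindex_bij_witness[of _ "\<lambda>l. k - l" "\<lambda>l. k - l"]) auto
  have AB: "0 \<le> A" "0 \<le> B" using f g by (auto intro: decays_nonneg)
  have fs: "abs_summable f" "abs_summable g" using f g s by (auto intro: decays_abs_summable)
  have "norm (conv f g k) \<le> (\<Sum>\<^sub>\<infinity>l. norm (f l * g (k - l)))"
    unfolding conv_def by (rule norm_infsum_bound[OF conv_abs_summable[OF fs]])
  also have "\<dots> \<le> (\<Sum>\<^sub>\<infinity>l. (A * B * 2 ^ s / wt k ^ s) * (1 / wt l ^ 2 + 1 / wt (k - l) ^ 2))"
  proof (intro infsum_mono conv_abs_summable fs summable_on_cmult_right sm)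
    fix l
    have "norm (f l * g (k - l)) \<le> (A / wt l ^ s) * (B / wt (k - l) ^ s)"
      unfolding norm_mult using AB by (intro mult_mono decaysD f g) auto
    also have "\<dots> = A * B * (1 / wt l ^ s * (1 / wt (k - l) ^ s))" by simp
    also have "\<dots> \<le> A * B * (2 ^ s / wt k ^ s * (1 / wt l ^ 2 + 1 / wt (k - l) ^ 2))"
      using AB by (intro mult_left_mono wt_split s) auto
    finally show "norm (f l * g (k - l)) \<le> (A * B * 2 ^ s / wt k ^ s) * (1 / wt l ^ 2 + 1 / wt (k - l) ^ 2)"
      by (simp only: times_divide_eq_right mult.assoc times_divide_eq_left)
  qed
  also have "\<dots> = (A * B * 2 ^ s / wt k ^ s) * (wtsum + wtsum)"
    by (subst infsum_cmult_right[OF sm], subst infsum_add[OF summable_wt sm']) (simp add: re flip: wtsum_def)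
  also have "\<dots> = 2 ^ (s + 1) * wtsum * A * B / wt k ^ s" by simp
  finally show "norm (conv f g k) \<le> 2 ^ (s + 1) * wtsum * A * B / wt k ^ s" .
qed

lemma infsum_finite_support:
  assumes "finite F" "\<And>l. l \<notin> F \<Longrightarrow> f l = 0"
  shows "infsum f UNIV = sum f F"
  using infsum_cong_neutral[of UNIV F f f] assms by simp

lemma conv_finite_support:
  assumes "finite F" "\<And>l. l \<notin> F \<Longrightarrow> f l = 0"
  shows "conv f g k = (\<Sum>l\<in>F. f l * g (k - l))"
  unfolding conv_def by (rule infsum_finite_support) (use assms in auto)

section \<open>Calculus in time for families of coefficients\<close>

lemma norm_increment_le:
  fixes f :: "real \<Rightarrow> complex"
  assumes "convex S" "\<And>t. t \<in> S \<Longrightarrow> (f has_vector_derivative f' t) (at t within S)"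
    and "\<And>t. t \<in> S \<Longrightarrow> norm (f' t) \<le> B" "s \<in> S" "t \<in> S"
  shows "norm (f s - f t) \<le> B * \<bar>s - t\<bar>"
proof -
  have "norm (f s - f t) \<le> B * norm (s - t)"
  proof (rule differentiable_bound[OF assms(1) _ _ assms(4,5)])
    show "(f has_derivative (\<lambda>x. x *\<^sub>R f' t)) (at t within S)" if "t \<in> S" for t
      using assms(2)[OF that] by (simp add: has_vector_derivative_def)
    show "onorm (\<lambda>x. x *\<^sub>R f' t) \<le> B" if "t \<in> S" for t
      using assms(3)[OF that] by (intro onorm_le) (simp add: mult.commute[of B] mult_left_mono)
  qed
  then show ?thesis by simp
qed

text \<open>\<open>C1_sobolev_deriv\<close> supplies difference quotients, and termwise
  differentiation below also works with them; the vector derivative is the form to which the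
  calculus rules apply.\<close>

lemma has_vector_derivative_quotient:
  fixes f :: "real \<Rightarrow> complex"
  shows "(f has_vector_derivative D) (at t within S) \<longleftrightarrow>
     ((\<lambda>s. (f s - f t) / of_real (s - t)) \<longlongrightarrow> D) (at t within S)"
proof -
  have eq: "norm ((1 / norm (s - t)) *\<^sub>R (f s - (f t + (s - t) *\<^sub>R D))) = norm ((f s - f t) / of_real (s - t) - D)"
    if "s \<noteq> t" for s
  proof -
    have "(f s - f t) / of_real (s - t) - D = (f s - (f t + (s - t) *\<^sub>R D)) / of_real (s - t)"
      using that by (simp add: divide_diff_eq_iff scaleR_conv_of_real diff_diff_eq mult.commute)
    then show ?thesis by (simp only: norm_divide norm_scaleR norm_of_real) simp
  qed
  have "(f has_vector_derivative D) (at t within S) \<longleftrightarrow>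
      ((\<lambda>s. norm ((1 / norm (s - t)) *\<^sub>R (f s - (f t + (s - t) *\<^sub>R D)))) \<longlongrightarrow> 0) (at t within S)"
    unfolding has_vector_derivative_def has_derivative_within tendsto_norm_zero_iff
    by (simp add: bounded_linear_scaleR_left)
  also have "\<dots> \<longleftrightarrow> ((\<lambda>s. norm ((f s - f t) / of_real (s - t) - D)) \<longlongrightarrow> 0) (at t within S)"
    by (rule tendsto_cong, unfold eventually_at_filter, intro always_eventually allI impI eq)
  also have "\<dots> \<longleftrightarrow> ((\<lambda>s. (f s - f t) / of_real (s - t)) \<longlongrightarrow> D) (at t within S)"
    unfolding tendsto_norm_zero_iff by (rule LIM_zero_iff)
  finally show ?thesis .
qed

text \<open>By the mean value inequality the difference quotients inherit the majorant
  \<open>M\<close> of the derivatives, uniformly in \<open>s\<close>. The Weierstrass test then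
  makes the finite partial sums converge uniformly, so the limits over index sets and over
  \<open>s\<close> may be exchanged.\<close>

lemma has_vector_derivative_infsum:
  fixes f f' :: "'i \<Rightarrow> real \<Rightarrow> complex"
  assumes S: "convex S" "t \<in> S"
    and d: "\<And>l s. s \<in> S \<Longrightarrow> (f l has_vector_derivative f' l s) (at s within S)"
    and M: "\<And>l s. s \<in> S \<Longrightarrow> norm (f' l s) \<le> M l" "M summable_on UNIV"
    and f: "\<And>s. s \<in> S \<Longrightarrow> (\<lambda>l. f l s) summable_on UNIV"
  shows "((\<lambda>s. \<Sum>\<^sub>\<infinity>l. f l s) has_vector_derivative (\<Sum>\<^sub>\<infinity>l. f' l t)) (at t within S)"
  unfolding has_vector_derivative_quotient
proof -
  let ?q = "\<lambda>l s. (f l s - f l t) / of_real (s - t)"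
  let ?F = "finite_subsets_at_top (UNIV :: 'i set)"
  have q: "norm (?q l s) \<le> M l" if s: "s \<in> S" "s \<noteq> t" for l s
  proof -
    have "norm (f l s - f l t) \<le> M l * \<bar>s - t\<bar>"
      by (rule norm_increment_le[where f="f l" and f'="f' l", OF S(1) _ _ s(1) S(2)]) (rule d M(1); assumption)+
    then show ?thesis using s(2) by (simp only: norm_divide norm_of_real real_norm_def) (simp add: pos_divide_le_eq)
  qed
  have f': "(\<lambda>l. f' l t) summable_on UNIV"
    by (rule abs_summable_summable, rule summable_on_comparison_test[OF M(2)]) (simp_all add: M(1) S(2))
  \<comment> \<open>Deleting \<open>t\<close> from the set changes nothing in the punctured filter
    and keeps the quotients in the range s \<noteq> t of the bound \<open>q\<close>.\<close>
  have lim: "((\<lambda>s. \<Sum>\<^sub>\<infinity>l. ?q l s) \<longlongrightarrow> (\<Sum>\<^sub>\<infinity>l. f' l t)) (at t within S - {t})"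
  proof (rule swap_uniform_limit)
    show "\<forall>\<^sub>F F in ?F. ((\<lambda>s. \<Sum>l\<in>F. ?q l s) \<longlongrightarrow> (\<Sum>l\<in>F. f' l t)) (at t within S - {t})"
      using d[OF S(2)] unfolding has_vector_derivative_quotient
      by (intro always_eventually allI tendsto_sum) (rule tendsto_within_subset[OF _ Diff_subset])
    show "((\<lambda>F. \<Sum>l\<in>F. f' l t) \<longlongrightarrow> (\<Sum>\<^sub>\<infinity>l. f' l t)) ?F"
      by (rule infsum_tendsto[OF f'])
    show "uniform_limit (S - {t}) (\<lambda>F s. \<Sum>l\<in>F. ?q l s) (\<lambda>s. \<Sum>\<^sub>\<infinity>l. ?q l s) ?F"
      by (rule Weierstrass_m_test_general[where M=M, OF q M(2)]) simp_all
  qed simp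
  have eq: "(\<Sum>\<^sub>\<infinity>l. ?q l s) = ((\<Sum>\<^sub>\<infinity>l. f l s) - (\<Sum>\<^sub>\<infinity>l. f l t)) / of_real (s - t)" if "s \<in> S" for s
  proof -
    have "((\<lambda>l. f l s - f l t) has_sum ((\<Sum>\<^sub>\<infinity>l. f l s) - (\<Sum>\<^sub>\<infinity>l. f l t))) UNIV"
      using has_sum_add[OF has_sum_infsum[OF f[OF that]] has_sum_uminusI[OF has_sum_infsum[OF f[OF S(2)]]]]
      by (simp only: add_uminus_conv_diff)
    from infsumI[OF has_sum_divide_const[OF this]] show ?thesis .
  qed
  have "((\<lambda>s. ((\<Sum>\<^sub>\<infinity>l. f l s) - (\<Sum>\<^sub>\<infinity>l. f l t)) / of_real (s - t)) \<longlongrightarrow> (\<Sum>\<^sub>\<infinity>l. f' l t)) (at t within S - {t})"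
  proof (rule Lim_transform_eventually[OF lim])
    show "\<forall>\<^sub>F s in at t within S - {t}. (\<Sum>\<^sub>\<infinity>l. ?q l s) = ((\<Sum>\<^sub>\<infinity>l. f l s) - (\<Sum>\<^sub>\<infinity>l. f l t)) / of_real (s - t)"
      unfolding eventually_at_filter by (intro always_eventually allI impI eq) blast
  qed
  then show "((\<lambda>s. ((\<Sum>\<^sub>\<infinity>l. f l s) - (\<Sum>\<^sub>\<infinity>l. f l t)) / of_real (s - t)) \<longlongrightarrow> (\<Sum>\<^sub>\<infinity>l. f' l t)) (at t within S)"
    by (simp only: at_within_def Diff_idemp)
qed

text \<open>Two powers of decay suffice: in each product one factor gives the summable majorant and
  the other is merely bounded.\<close>

lemma conv_has_vector_derivative:
  assumes S: "convex S" "t \<in> S"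
    and d: "\<And>l s. s \<in> S \<Longrightarrow> ((\<lambda>s. f s l) has_vector_derivative f' s l) (at s within S)"
           "\<And>l s. s \<in> S \<Longrightarrow> ((\<lambda>s. g s l) has_vector_derivative g' s l) (at s within S)"
    and f: "\<And>s. s \<in> S \<Longrightarrow> decays 2 A (f s)" "\<And>s. s \<in> S \<Longrightarrow> decays 2 A' (f' s)"
    and g: "\<And>s. s \<in> S \<Longrightarrow> decays 2 B (g s)" "\<And>s. s \<in> S \<Longrightarrow> decays 2 B' (g' s)"
  shows "((\<lambda>s. conv (f s) (g s) k) has_vector_derivative (conv (f' t) (g t) k + conv (f t) (g' t) k)) (at t within S)"
proof -
  have su: "abs_summable (f s)" "abs_summable (g s)" "abs_summable (f' s)" "abs_summable (g' s)" if "s \<in> S" for s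
    using f g that by (blast intro: decays_abs_summable order_refl)+
  have nn: "0 \<le> A" "0 \<le> A'" "0 \<le> B" "0 \<le> B'" using f[OF S(2)] g[OF S(2)] by (blast intro: decays_nonneg)+
  have bd: "norm (a l) \<le> C / wt l ^ 2" "norm (a l) \<le> C" if "decays 2 C a" for C a l
  proof -
    show "norm (a l) \<le> C / wt l ^ 2" by (rule decaysD[OF that])
    also have "\<dots> \<le> C / 1" using decays_nonneg[OF that] by (intro divide_left_mono) auto
    finally show "norm (a l) \<le> C" by simp
  qed
  have "((\<lambda>s. \<Sum>\<^sub>\<infinity>l. f s l * g s (k - l)) has_vector_derivative (\<Sum>\<^sub>\<infinity>l. f t l * g' t (k - l) + f' t l * g t (k - l))) (at t within S)"
  proof (rule has_vector_derivative_infsum[OF S, where M="\<lambda>l. (A * B' + A' * B) * (1 / wt l ^ 2)"])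
    show "((\<lambda>s. f s l * g s (k - l)) has_vector_derivative f s l * g' s (k - l) + f' s l * g s (k - l)) (at s within S)"
      if "s \<in> S" for l s
      by (intro has_vector_derivative_mult d that)
    show "norm (f s l * g' s (k - l) + f' s l * g s (k - l)) \<le> (A * B' + A' * B) * (1 / wt l ^ 2)" if "s \<in> S" for l s
    proof -
      have "norm (f s l * g' s (k - l)) \<le> (A / wt l ^ 2) * B'"
        unfolding norm_mult by (intro mult_mono bd(1)[OF f(1)[OF that]] bd(2)[OF g(2)[OF that]]) (use nn in auto)
      moreover have "norm (f' s l * g s (k - l)) \<le> (A' / wt l ^ 2) * B"
        unfolding norm_mult by (intro mult_mono bd(1)[OF f(2)[OF that]] bd(2)[OF g(1)[OF that]]) (use nn in auto)
      ultimately show ?thesis by (intro order_trans[OF norm_triangle_ineq]) (simp add: distrib_right add_divide_distrib)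
    qed
    show "(\<lambda>l. (A * B' + A' * B) * (1 / wt l ^ 2)) summable_on UNIV"
      by (intro summable_on_cmult_right summable_wt)
    show "(\<lambda>l. f s l * g s (k - l)) summable_on UNIV" if "s \<in> S" for s
      by (intro conv_summable su that)
  qed
  moreover have "(\<Sum>\<^sub>\<infinity>l. f t l * g' t (k - l) + f' t l * g t (k - l)) = conv (f' t) (g t) k + conv (f t) (g' t) k"
    unfolding conv_def by (subst infsum_add) (auto intro!: conv_summable su S)
  ultimately show ?thesis by (simp add: conv_def)
qed

text \<open>For complex values there is no Rolle argument with intermediate points. Instead the
  error is a function \<phi> of the right endpoint: \<phi> and its derivative vanish at the left
  endpoint, and its second derivative is -(s - t) f3 / 2. Two applications of the mean value
  inequality give h^3, without the sharp factor 1/12.\<close>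

lemma trapezoid_error:
  fixes f :: "real \<Rightarrow> complex"
  assumes h: "0 \<le> h" and S: "{t..t + h} \<subseteq> S"
    and d1: "\<And>s. s \<in> S \<Longrightarrow> (f has_vector_derivative f1 s) (at s within S)"
    and d2: "\<And>s. s \<in> S \<Longrightarrow> (f1 has_vector_derivative f2 s) (at s within S)"
    and d3: "\<And>s. s \<in> S \<Longrightarrow> (f2 has_vector_derivative f3 s) (at s within S)"
    and B: "\<And>s. s \<in> S \<Longrightarrow> norm (f3 s) \<le> B"
  shows "norm (f (t + h) - f t - of_real h * ((f1 t + f1 (t + h)) / 2)) \<le> B * h ^ 3"
proof -
  let ?I = "{t..t + h}"
  have "t \<in> S" using S h by auto
  then have B0: "0 \<le> B" using order_trans[OF norm_ge_zero B] by blast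
  note d1' = has_vector_derivative_within_subset[OF d1 S]
  note d2' = has_vector_derivative_within_subset[OF d2 S]
  note d3' = has_vector_derivative_within_subset[OF d3 S]
  define \<phi> where "\<phi> s = f s - f t - of_real (s - t) * ((f1 t + f1 s) / 2)" for s
  define \<phi>1 where "\<phi>1 s = (f1 s - f1 t) / 2 - of_real (s - t) * (f2 s / 2)" for s
  have lin: "((\<lambda>s. complex_of_real (s - t)) has_vector_derivative 1) (at s within ?I)" for s
    using has_vector_derivative_of_real[of "\<lambda>s. s - t" 1 "at s within ?I"] 
    by (simp add: DERIV_const[THEN DERIV_diff[OF DERIV_ident], simplified])
  have p1: "(\<phi> has_vector_derivative \<phi>1 s) (at s within ?I)" if "s \<in> ?I" for s
  proof (rule has_vector_derivative_eq_rhs)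
    note s = subsetD[OF S that]
    show "(\<phi> has_vector_derivative (f1 s - 0 - (of_real (s - t) * ((0 + f2 s) / 2) + 1 * ((f1 t + f1 s) / 2)))) (at s within ?I)"
      unfolding \<phi>_def
      by (intro has_vector_derivative_diff has_vector_derivative_mult has_vector_derivative_divide has_vector_derivative_add
           has_vector_derivative_const lin d1'[OF s] d2'[OF s])
    show "f1 s - 0 - (of_real (s - t) * ((0 + f2 s) / 2) + 1 * ((f1 t + f1 s) / 2)) = \<phi>1 s"
      by (simp add: \<phi>1_def add_divide_distrib diff_divide_distrib) 
  qed
  have p2: "(\<phi>1 has_vector_derivative (- of_real (s - t) * (f3 s / 2))) (at s within ?I)" if "s \<in> ?I" for s
  proof (rule has_vector_derivative_eq_rhs)
    note s = subsetD[OF S that]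
    show "(\<phi>1 has_vector_derivative ((f2 s - 0) / 2 - (of_real (s - t) * (f3 s / 2) + 1 * (f2 s / 2)))) (at s within ?I)"
      unfolding \<phi>1_def
      by (intro has_vector_derivative_diff has_vector_derivative_mult has_vector_derivative_divide has_vector_derivative_add
           has_vector_derivative_const lin d2'[OF s] d3'[OF s])
    show "(f2 s - 0) / 2 - (of_real (s - t) * (f3 s / 2) + 1 * (f2 s / 2)) = - of_real (s - t) * (f3 s / 2)"
      by (simp del: of_real_diff)
  qed
  have b1: "norm (\<phi>1 s) \<le> B * h\<^sup>2" if "s \<in> ?I" for s
  proof -
    have "norm (\<phi>1 s - \<phi>1 t) \<le> (B * h) * \<bar>s - t\<bar>"
    proof (rule norm_increment_le[OF _ p2])
      show "norm (- of_real (s - t) * (f3 s / 2)) \<le> B * h" if "s \<in> ?I" for s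
      proof -
        have "norm (- of_real (s - t) * (f3 s / 2)) = (s - t) * (norm (f3 s) / 2)"
          using that by (simp add: norm_mult norm_divide del: of_real_diff)
        also have "\<dots> \<le> h * B"
          using that h B[of s] S B0 by (intro mult_mono) auto
        finally show ?thesis by (simp add: mult.commute)
      qed
    qed (use that h in auto)
    also have "\<dots> \<le> (B * h) * h" using that B0 h by (intro mult_left_mono) auto
    finally show ?thesis by (simp add: \<phi>1_def power2_eq_square)
  qed
  have "norm (\<phi> (t + h) - \<phi> t) \<le> (B * h\<^sup>2) * \<bar>t + h - t\<bar>"
    by (rule norm_increment_le[OF _ p1 b1]) (use h in auto)
  then show ?thesis using h by (simp add: \<phi>_def power2_eq_square power3_eq_cube)
qed

subsection \<open>Energy estimate for the Crank--Nicolson step\<close>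

abbreviation band :: "nat \<Rightarrow> int set"
  where "band N \<equiv> {- int N..int N}"

definition omega :: "int \<Rightarrow> real"
  where "omega k = real_of_int k ^ 3 + real_of_int k ^ 5"

definition band_norm :: "nat \<Rightarrow> (int \<Rightarrow> complex) \<Rightarrow> real"
  where "band_norm N f = L2_set (\<lambda>k. norm (f k)) (band N)"

definition low :: "nat \<Rightarrow> (int \<Rightarrow> complex) \<Rightarrow> int \<Rightarrow> complex"
  where "low N f k = (if k \<in> band N then f k else 0)"

text \<open>Inverts the phase mismatch of the interaction that sends mode \<open>l\<close> to mode
  \<open>k\<close>. It is evaluated for \<open>k\<close> inside and \<open>l\<close> outside the
  band, where \<open>omega_neq\<close> keeps the denominator nonzero.\<close>

definition gap_coeff :: "int \<Rightarrow> int \<Rightarrow> real"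
  where "gap_coeff k l = of_int k / (omega l - omega k)"

text \<open>If \<open>k\<close> and \<open>k - l\<close> lie in the band then |l| <= 2N, so the
  finite range contains every interaction of a high \<open>l\<close> with a low
  \<open>k - l\<close>, and no convergence question arises. The two slots are separate because
  averages, increments and defects are inserted in them independently.\<close>

definition corr :: "nat \<Rightarrow> (int \<Rightarrow> complex) \<Rightarrow> (int \<Rightarrow> complex) \<Rightarrow> int \<Rightarrow> complex"
  where "corr N p q k = (if k \<in> band N then
     (\<Sum>l\<in>band (2 * N) - band N. of_real (gap_coeff k l) * p l * low N q (k - l)) else 0)"

text \<open>The implicit term is absorbed on the left. For c <= 1/2 one has (1 + c) / (1 - c) <= 1 +
  4c and 1 / (1 - c) <= 2; these give the 4 in the exponent and the 2 in front of
  \<open>e\<close>.\<close>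

lemma discrete_gronwall:
  fixes X :: "nat \<Rightarrow> real"
  assumes step: "\<And>m. m < M \<Longrightarrow> X (Suc m) - X m \<le> c * (X m + X (Suc m)) + e"
    and c: "0 \<le> c" "c \<le> 1 / 2" and e: "0 \<le> e" and X: "\<And>m. 0 \<le> X m"
  shows "m \<le> M \<Longrightarrow> X m \<le> exp (4 * c * real m) * (X 0 + 2 * real m * e)"
proof (induction m)
  case 0
  then show ?case by simp
next
  case (Suc m)
  have st: "(1 - c) * X (Suc m) \<le> (1 + c) * X m + e"
    using step[of m] Suc.prems by (simp add: algebra_simps)
  have "(1 - c) * ((1 + 4 * c) * X m + 2 * e) - ((1 + c) * X m + e) = (2 * c * (1 - 2 * c)) * X m + (1 - 2 * c) * e"
    by (simp add: algebra_simps)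
  also have "\<dots> \<ge> 0" using c e X by (intro add_nonneg_nonneg mult_nonneg_nonneg) auto
  finally have "(1 - c) * X (Suc m) \<le> (1 - c) * ((1 + 4 * c) * X m + 2 * e)" using st by linarith
  then have "X (Suc m) \<le> (1 + 4 * c) * X m + 2 * e" using c by (simp add: mult_le_cancel_left)
  also have "\<dots> \<le> exp (4 * c) * X m + exp (4 * c * real (Suc m)) * (2 * e)"
  proof (intro add_mono mult_right_mono X)
    show "1 + 4 * c \<le> exp (4 * c)" by (rule exp_ge_add_one_self)
    show "2 * e \<le> exp (4 * c * real (Suc m)) * (2 * e)"
      using mult_right_mono[of 1 "exp (4 * c * real (Suc m))" "2 * e"] c e by simp
  qed
  also have "\<dots> \<le> exp (4 * c) * (exp (4 * c * real m) * (X 0 + 2 * real m * e)) + exp (4 * c * real (Suc m)) * (2 * e)"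
    using Suc by (intro add_right_mono mult_left_mono) auto
  also have "\<dots> = exp (4 * c * real (Suc m)) * (X 0 + 2 * real (Suc m) * e)"
    by (simp add: algebra_simps flip: exp_add)
  finally show ?case .
qed

lemma band_norm_triangle: "band_norm N (\<lambda>k. f k + g k) \<le> band_norm N f + band_norm N g"
  unfolding band_norm_def
  by (rule order_trans[OF L2_set_mono L2_set_triangle_ineq]) (auto intro: norm_triangle_ineq)

lemma band_norm_nonneg [simp]: "0 \<le> band_norm N f"
  by (simp add: band_norm_def)

lemma band_norm_cmult: "band_norm N (\<lambda>k. c * f k) = norm c * band_norm N f"
  by (simp add: band_norm_def norm_mult L2_set_right_distrib)

lemma band_norm_power2: "(band_norm N f)\<^sup>2 = (\<Sum>k\<in>band N. (norm (f k))\<^sup>2)"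
  by (simp add: band_norm_def L2_set_def sum_nonneg)

text \<open>One power of \<open>wt\<close> makes a bound square summable with a constant free of
  \<open>N\<close>. This is why the residual is estimated mode by mode with a factor 1 / wt k
  instead of uniformly.\<close>

lemma band_norm_le_of_decay:
  assumes "0 \<le> E" "\<And>k. k \<in> band N \<Longrightarrow> norm (f k) \<le> E / wt k"
  shows "band_norm N f \<le> E * sqrt wtsum"
proof -
  have "band_norm N f \<le> L2_set (\<lambda>k. E * (1 / wt k)) (band N)"
    unfolding band_norm_def by (rule L2_set_mono) (use assms in auto)
  also have "\<dots> = E * L2_set (\<lambda>k. 1 / wt k) (band N)"
    using assms(1) by (rule L2_set_right_distrib[symmetric])
  also have "\<dots> \<le> E * sqrt wtsum"
    unfolding L2_set_def using sum_wt_le[of "band N"] assms(1)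
    by (intro mult_left_mono) (auto simp: power_divide)
  finally show ?thesis .
qed

text \<open>Counting modes costs 2N + 1, which is affordable for the corrector because it has three
  powers of \<open>N\<close> to spare.\<close>

lemma band_norm_le_const:
  assumes "\<And>k. k \<in> band N \<Longrightarrow> norm (f k) \<le> E"
  shows "band_norm N f \<le> (2 * real N + 1) * E"
proof -
  have "band_norm N f \<le> (\<Sum>k\<in>band N. norm (f k))"
    unfolding band_norm_def by (rule L2_set_le_sum) auto
  also have "\<dots> \<le> (\<Sum>k\<in>band N. E)" by (rule sum_mono) (rule assms)
  also have "\<dots> = (2 * real N + 1) * E" by simp
  finally show ?thesis .
qed

lemma band_norm_Cauchy_Schwarz: "norm (\<Sum>k\<in>band N. f k * g k) \<le> band_norm N f * band_norm N g"
proof -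
  have "norm (\<Sum>k\<in>band N. f k * g k) \<le> (\<Sum>k\<in>band N. \<bar>norm (f k)\<bar> * \<bar>norm (g k)\<bar>)"
    by (rule order_trans[OF norm_sum]) (simp add: norm_mult)
  also have "\<dots> \<le> band_norm N f * band_norm N g"
    unfolding band_norm_def by (rule L2_set_mult_ineq)
  finally show ?thesis .
qed

text \<open>The substitution \<open>k \<mapsto> l - k\<close> exchanges the two factors \<open>\<theta>\<close> and moves the derivative
  onto \<open>y\<close>; this is integration by parts on the Fourier side.\<close>

lemma trilinear_derivative:
  assumes y: "\<And>k. k \<notin> band N \<Longrightarrow> y k = 0" and \<theta>: "\<And>k. k \<notin> band N \<Longrightarrow> \<theta> k = 0"
  shows "(\<Sum>k\<in>band N. of_int k * conv y \<theta> k * \<theta> (- k))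
     = (\<Sum>l\<in>band N. of_int l / 2 * y l * (\<Sum>k\<in>band N. \<theta> (k - l) * \<theta> (- k)))"
proof -
  have inner: "(\<Sum>k\<in>band N. of_int k * (\<theta> (k - l) * \<theta> (- k))) = of_int l / 2 * (\<Sum>k\<in>band N. \<theta> (k - l) * \<theta> (- k))" for l
  proof -
    \<comment> \<open>Only indices with both \<open>k\<close> and \<open>k - l\<close> in the band
      contribute. This smaller set, unlike the band itself, is invariant under the
      substitution.\<close>
    let ?A = "{k \<in> band N. k - l \<in> band N}"
    have red: "(\<Sum>k\<in>band N. c k * (\<theta> (k - l) * \<theta> (- k))) = (\<Sum>k\<in>?A. c k * (\<theta> (k - l) * \<theta> (- k)))" for c
      by (rule sum.mono_neutral_right) (use \<theta> in auto)
    have "(\<Sum>k\<in>?A. of_int k * (\<theta> (k - l) * \<theta> (- k))) = (\<Sum>k\<in>?A. of_int (l - k) * (\<theta> (k - l) * \<theta> (- k)))"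
      by (rule sum.reindex_bij_witness[of _ "\<lambda>k. l - k" "\<lambda>k. l - k"]) (auto simp: mult.commute)
    also have "\<dots> = of_int l * (\<Sum>k\<in>?A. 1 * (\<theta> (k - l) * \<theta> (- k))) - (\<Sum>k\<in>?A. of_int k * (\<theta> (k - l) * \<theta> (- k)))"
      by (simp only: of_int_diff left_diff_distrib sum_subtractf sum_distrib_left mult_1_left)
    finally have "2 * (\<Sum>k\<in>?A. of_int k * (\<theta> (k - l) * \<theta> (- k))) = of_int l * (\<Sum>k\<in>?A. 1 * (\<theta> (k - l) * \<theta> (- k)))"
      by (simp only: mult_2 eq_diff_eq)
    then have "(\<Sum>k\<in>?A. of_int k * (\<theta> (k - l) * \<theta> (- k))) = of_int l / 2 * (\<Sum>k\<in>?A. 1 * (\<theta> (k - l) * \<theta> (- k)))"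
      by (simp add: eq_divide_eq mult.commute)
    then show ?thesis unfolding red[of of_int, symmetric] red[of "\<lambda>_. 1", symmetric] by simp
  qed
  have "(\<Sum>k\<in>band N. of_int k * conv y \<theta> k * \<theta> (- k))
      = (\<Sum>k\<in>band N. \<Sum>l\<in>band N. of_int k * (y l * \<theta> (k - l)) * \<theta> (- k))"
  proof -
    have "conv y \<theta> k = (\<Sum>l\<in>band N. y l * \<theta> (k - l))" for k
      by (rule conv_finite_support) (use y in auto)
    then show ?thesis by (simp add: sum_distrib_left sum_distrib_right)
  qed
  also have "\<dots> = (\<Sum>l\<in>band N. \<Sum>k\<in>band N. of_int k * (y l * \<theta> (k - l)) * \<theta> (- k))"
    by (rule sum.swap)
  also have "\<dots> = (\<Sum>l\<in>band N. y l * (\<Sum>k\<in>band N. of_int k * (\<theta> (k - l) * \<theta> (- k))))"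
    by (simp add: sum_distrib_left mult.assoc mult.left_commute)
  also have "\<dots> = (\<Sum>l\<in>band N. of_int l / 2 * y l * (\<Sum>k\<in>band N. \<theta> (k - l) * \<theta> (- k)))"
    unfolding inner by (simp add: mult.assoc mult.left_commute)
  finally show ?thesis .
qed

text \<open>With y = \<theta> the inner sum in \<open>trilinear_derivative\<close> is itself a
  convolution, at -l. Reflecting \<open>l\<close> turns the identity into X = -X/2. This is the
  vanishing of the integral of \<theta>^2 \<theta>_x, and it is exact for band-limited
  \<theta>.\<close>

lemma trilinear_derivative_self:
  assumes \<theta>: "\<And>k. k \<notin> band N \<Longrightarrow> \<theta> k = 0"
  shows "(\<Sum>k\<in>band N. of_int k * conv \<theta> \<theta> k * \<theta> (- k)) = 0"
proof -
  let ?X = "\<Sum>k\<in>band N. of_int k * conv \<theta> \<theta> k * \<theta> (- k)"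
  have c: "(\<Sum>k\<in>band N. \<theta> (k - l) * \<theta> (- k)) = conv \<theta> \<theta> (- l)" for l
  proof -
    have "(\<Sum>k\<in>band N. \<theta> (k - l) * \<theta> (- k)) = (\<Sum>k\<in>band N. \<theta> k * \<theta> (- l - k))"
      by (rule sum.reindex_bij_witness[of _ uminus uminus]) (auto simp: mult.commute)
    then show ?thesis by (subst conv_finite_support[where F="band N"]) (use \<theta> in auto)
  qed
  have "?X = (\<Sum>l\<in>band N. of_int l / 2 * \<theta> l * conv \<theta> \<theta> (- l))"
    using trilinear_derivative[of N \<theta> \<theta>] \<theta> c by simp
  also have "\<dots> = (\<Sum>k\<in>band N. of_int (- k) / 2 * \<theta> (- k) * conv \<theta> \<theta> k)"
    by (rule sum.reindex_bij_witness[of _ uminus uminus]) auto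
  also have "\<dots> = (\<Sum>k\<in>band N. (- 1 / 2) * (of_int k * conv \<theta> \<theta> k * \<theta> (- k)))"
    by (rule sum.cong) simp_all
  also have "\<dots> = (- 1 / 2) * ?X"
    by (simp only: sum_distrib_left)
  finally have "(3 / 2) * ?X = 0" by (simp add: field_simps)
  then show ?thesis by simp
qed

text \<open>Once the derivative sits on \<open>y\<close>, Cauchy-Schwarz costs no power of
  \<open>N\<close>: a shift or reflection of \<theta> does not increase its norm, and
  \<open>y\<close> enters through the l1 norm of its derivative.\<close>

lemma trilinear_bound:
  assumes y: "\<And>k. k \<notin> band N \<Longrightarrow> y k = 0" and \<theta>: "\<And>k. k \<notin> band N \<Longrightarrow> \<theta> k = 0"
    and D: "(\<Sum>l\<in>band N. \<bar>of_int l\<bar> * norm (y l)) \<le> D"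
  shows "norm (\<Sum>k\<in>band N. of_int k * conv y \<theta> k * \<theta> (- k)) \<le> D / 2 * (band_norm N \<theta>)\<^sup>2"
proof -
  have Q: "norm (\<Sum>k\<in>band N. \<theta> (k - l) * \<theta> (- k)) \<le> (band_norm N \<theta>)\<^sup>2" for l
  proof -
    have "band_norm N (\<lambda>k. \<theta> (k - l)) \<le> band_norm N \<theta>"
    proof -
      have "(\<Sum>k\<in>band N. (norm (\<theta> (k - l)))\<^sup>2) = (\<Sum>k\<in>{k \<in> band N. k - l \<in> band N}. (norm (\<theta> (k - l)))\<^sup>2)"
        by (rule sum.mono_neutral_right) (use \<theta> in auto)
      also have "\<dots> = (\<Sum>k\<in>(\<lambda>k. k - l) ` {k \<in> band N. k - l \<in> band N}. (norm (\<theta> k))\<^sup>2)"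
        by (subst sum.reindex) (auto simp: inj_on_def)
      also have "\<dots> \<le> (\<Sum>k\<in>band N. (norm (\<theta> k))\<^sup>2)"
        by (rule sum_mono2) auto
      finally show ?thesis by (simp add: band_norm_def L2_set_def)
    qed
    moreover have "band_norm N (\<lambda>k. \<theta> (- k)) = band_norm N \<theta>"
      unfolding band_norm_def L2_set_def
      by (rule arg_cong[of _ _ sqrt], rule sum.reindex_bij_witness[of _ uminus uminus]) auto
    ultimately have "band_norm N (\<lambda>k. \<theta> (k - l)) * band_norm N (\<lambda>k. \<theta> (- k)) \<le> band_norm N \<theta> * band_norm N \<theta>"
      by (intro mult_mono) auto
    with band_norm_Cauchy_Schwarz show ?thesis
      unfolding power2_eq_square by (rule order_trans)
  qed
  have "norm (\<Sum>k\<in>band N. of_int k * conv y \<theta> k * \<theta> (- k))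
      \<le> (\<Sum>l\<in>band N. (\<bar>of_int l\<bar> * norm (y l)) * ((band_norm N \<theta>)\<^sup>2 / 2))"
  proof (subst trilinear_derivative, use y in blast, use \<theta> in blast, rule order_trans[OF norm_sum sum_mono])
    fix l assume "l \<in> band N"
    have "norm (of_int l / 2 * y l * (\<Sum>k\<in>band N. \<theta> (k - l) * \<theta> (- k)))
       = (\<bar>of_int l\<bar> * norm (y l)) * (norm (\<Sum>k\<in>band N. \<theta> (k - l) * \<theta> (- k)) / 2)"
      by (simp add: norm_mult norm_divide)
    also have "\<dots> \<le> (\<bar>of_int l\<bar> * norm (y l)) * ((band_norm N \<theta>)\<^sup>2 / 2)"
      using Q[of l] by (intro mult_left_mono divide_right_mono) auto
    finally show "norm (of_int l / 2 * y l * (\<Sum>k\<in>band N. \<theta> (k - l) * \<theta> (- k)))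
      \<le> (\<bar>of_int l\<bar> * norm (y l)) * ((band_norm N \<theta>)\<^sup>2 / 2)" .
  qed
  also have "\<dots> \<le> D * ((band_norm N \<theta>)\<^sup>2 / 2)"
    unfolding sum_distrib_right[symmetric] by (intro mult_right_mono D) auto
  finally show ?thesis by simp
qed

text \<open>Pairing with the conjugate of the midpoint \<theta> removes two terms: the dispersive
  one is purely imaginary, and the self-interaction vanishes by
  \<open>trilinear_derivative_self\<close>. Transport by \<open>y\<close> and the residual are
  left.\<close>

lemma energy_step:
  fixes dt :: real
  assumes dt: "0 \<le> dt"
    and y: "\<And>k. k \<notin> band N \<Longrightarrow> y k = 0"
    and \<theta>: "\<And>k. k \<notin> band N \<Longrightarrow> \<theta>0 k = 0" "\<And>k. k \<notin> band N \<Longrightarrow> \<theta>1 k = 0"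
    and sym: "\<And>k. \<theta>0 (- k) = cnj (\<theta>0 k)" "\<And>k. \<theta>1 (- k) = cnj (\<theta>1 k)"
    and D: "(\<Sum>l\<in>band N. \<bar>of_int l\<bar> * norm (y l)) \<le> D"
    and \<theta>_def: "\<theta> = (\<lambda>k. (\<theta>0 k + \<theta>1 k) / 2)"
    and eq: "\<And>k. k \<in> band N \<Longrightarrow> \<theta>1 k - \<theta>0 k = of_real dt * (\<i> * of_real (omega k) * \<theta> k
        - \<i> * of_int k / 2 * (2 * conv y \<theta> k + conv \<theta> \<theta> k)) - R k"
  shows "band_norm N \<theta>1 - band_norm N \<theta>0
     \<le> dt * D / 4 * (band_norm N \<theta>0 + band_norm N \<theta>1) + band_norm N R"
proof -
  let ?Xa = "band_norm N \<theta>0" and ?Xb = "band_norm N \<theta>1" and ?X = "band_norm N \<theta>"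
  have \<theta>s: "\<theta> k = 0" if "k \<notin> band N" for k
    using \<theta> that by (simp add: \<theta>_def)
  have sym\<theta>: "\<theta> (- k) = cnj (\<theta> k)" for k by (simp add: \<theta>_def sym)
  have Xle: "?X \<le> (?Xa + ?Xb) / 2"
  proof -
    have "?X = 1 / 2 * band_norm N (\<lambda>k. \<theta>0 k + \<theta>1 k)"
      using band_norm_cmult[of N "1/2" "\<lambda>k. \<theta>0 k + \<theta>1 k"] by (simp add: \<theta>_def)
    also have "\<dots> \<le> 1 / 2 * (?Xa + ?Xb)" by (intro mult_left_mono band_norm_triangle) simp
    finally show ?thesis by simp
  qed
  \<comment> \<open>Testing with the midpoint makes the increment an exact difference of squares;
    this is the conservation built into Crank--Nicolson.\<close>
  have "(?Xb\<^sup>2 - ?Xa\<^sup>2) / 2 = Re (\<Sum>k\<in>band N. (\<theta>1 k - \<theta>0 k) * \<theta> (- k))"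
  proof -
    have "((norm (\<theta>1 k))\<^sup>2 - (norm (\<theta>0 k))\<^sup>2) / 2 = Re ((\<theta>1 k - \<theta>0 k) * \<theta> (- k))" for k
      unfolding cmod_power2 by (simp add: \<theta>_def sym power2_eq_square algebra_simps add_divide_distrib diff_divide_distrib)
    then show ?thesis
      by (simp only: band_norm_power2 sum_subtractf[symmetric] sum_divide_distrib Re_sum)
  qed
  also have "(\<Sum>k\<in>band N. (\<theta>1 k - \<theta>0 k) * \<theta> (- k)) =
      \<i> * (\<Sum>k\<in>band N. of_real (dt * omega k * (norm (\<theta> k))\<^sup>2))
      - \<i> * of_real dt * (\<Sum>k\<in>band N. of_int k * conv y \<theta> k * \<theta> (- k))
      - \<i> * of_real dt / 2 * (\<Sum>k\<in>band N. of_int k * conv \<theta> \<theta> k * \<theta> (- k)) - (\<Sum>k\<in>band N. R k * \<theta> (- k))"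
  proof -
    have "(\<theta>1 k - \<theta>0 k) * \<theta> (- k) = \<i> * (of_real (dt * omega k * (norm (\<theta> k))\<^sup>2))
      - \<i> * of_real dt * (of_int k * conv y \<theta> k * \<theta> (- k))
      - \<i> * of_real dt / 2 * (of_int k * conv \<theta> \<theta> k * \<theta> (- k)) - R k * \<theta> (- k)" if "k \<in> band N" for k
    proof -
      have n: "complex_of_real (dt * omega k * (norm (\<theta> k))\<^sup>2) = of_real dt * of_real (omega k) * (\<theta> k * \<theta> (- k))"
        by (simp only: of_real_mult complex_norm_square sym\<theta>)
      show ?thesis unfolding eq[OF that] n by (simp add: algebra_simps)
    qed
    then show ?thesis by (simp add: sum_subtractf sum_distrib_left)
  qed
  also have "Re \<dots> = Re (- \<i> * of_real dt * (\<Sum>k\<in>band N. of_int k * conv y \<theta> k * \<theta> (- k)) - (\<Sum>k\<in>band N. R k * \<theta> (- k)))"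
  proof -
    have "(\<Sum>k\<in>band N. of_int k * conv \<theta> \<theta> k * \<theta> (- k)) = 0"
      by (rule trilinear_derivative_self) (use \<theta>s in auto)
    moreover have "Re (\<i> * (\<Sum>k\<in>band N. of_real (dt * omega k * (norm (\<theta> k))\<^sup>2))) = 0"
      by (simp flip: of_real_sum)
    ultimately show ?thesis by (simp only: minus_complex.sel mult_zero_right zero_complex.sel diff_0_right mult_minus_left uminus_complex.sel)
  qed
  also have "\<dots> \<le> norm (- \<i> * of_real dt * (\<Sum>k\<in>band N. of_int k * conv y \<theta> k * \<theta> (- k)) - (\<Sum>k\<in>band N. R k * \<theta> (- k)))"
    by (rule complex_Re_le_cmod)
  also have "\<dots> \<le> dt * (D / 2 * ?X\<^sup>2) + band_norm N R * ?X"
  proof (rule order_trans[OF norm_triangle_ineq4 add_mono])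
    show "norm (- \<i> * of_real dt * (\<Sum>k\<in>band N. of_int k * conv y \<theta> k * \<theta> (- k))) \<le> dt * (D / 2 * ?X\<^sup>2)"
    proof -
      have "norm (\<Sum>k\<in>band N. of_int k * conv y \<theta> k * \<theta> (- k)) \<le> D / 2 * ?X\<^sup>2"
        by (rule trilinear_bound[OF _ _ D]) (use y \<theta>s in auto)
      from mult_left_mono[OF this dt] show ?thesis using dt by (simp only: norm_mult) simp
    qed
    have "norm (\<Sum>k\<in>band N. R k * \<theta> (- k)) \<le> band_norm N R * band_norm N (\<lambda>k. \<theta> (- k))"
      by (rule band_norm_Cauchy_Schwarz)
    then show "norm (\<Sum>k\<in>band N. R k * \<theta> (- k)) \<le> band_norm N R * ?X"
      by (simp add: sym\<theta> band_norm_def)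
  qed
  also have "\<dots> = (dt * D / 2 * ?X + band_norm N R) * ?X"
    by (simp add: power2_eq_square algebra_simps)
  also have "\<dots> \<le> (dt * D / 2 * ((?Xa + ?Xb) / 2) + band_norm N R) * ((?Xa + ?Xb) / 2)"
  proof (intro mult_mono add_mono mult_left_mono Xle order_refl)
    have "0 \<le> D" using D by (rule order_trans[rotated]) (auto intro!: sum_nonneg)
    then show "0 \<le> dt * D / 2" using dt by simp
    then show "0 \<le> dt * D / 2 * ((?Xa + ?Xb) / 2) + band_norm N R"
      by (intro add_nonneg_nonneg mult_nonneg_nonneg) auto
  qed auto
  finally have "(?Xb - ?Xa) * ((?Xa + ?Xb) / 2) \<le> (dt * D / 2 * ((?Xa + ?Xb) / 2) + band_norm N R) * ((?Xa + ?Xb) / 2)"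
    by (simp add: power2_eq_square algebra_simps add_divide_distrib diff_divide_distrib)
  \<comment> \<open>The estimate is divided by the mean of the two norms, so the case where both
    vanish is settled separately.\<close>
  moreover have ?thesis if "?Xa + ?Xb = 0"
  proof -
    have "?Xa = 0" "?Xb = 0" using that band_norm_nonneg[of N \<theta>0] band_norm_nonneg[of N \<theta>1] by linarith+
    then show ?thesis by simp
  qed
  moreover have "?Xa + ?Xb > 0" if "?Xa + ?Xb \<noteq> 0" 
    using that band_norm_nonneg[of N \<theta>0] band_norm_nonneg[of N \<theta>1] by linarith
  ultimately show ?thesis
    by (cases "?Xa + ?Xb = 0") (auto simp: mult_le_cancel_right)
qed

subsection \<open>Normal form corrector\<close>

lemma omega_uminus: "omega (- k) = - omega k"
  by (simp add: omega_def)

lemma norm_omega_le: "\<bar>omega k\<bar> \<le> 2 * wt k ^ 5"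
proof -
  have "\<bar>real_of_int k\<bar> ^ 3 \<le> wt k ^ 3" "\<bar>real_of_int k\<bar> ^ 5 \<le> wt k ^ 5"
    by (auto simp: wt_def intro!: power_mono)
  moreover have "wt k ^ 3 \<le> wt k ^ 5" by (rule wt_power_mono) simp
  moreover have "\<bar>omega k\<bar> \<le> \<bar>real_of_int k\<bar> ^ 3 + \<bar>real_of_int k\<bar> ^ 5"
    unfolding omega_def by (rule order_trans[OF abs_triangle_ineq]) (simp add: power_abs)
  ultimately show ?thesis by linarith
qed

lemma abs_omega: "\<bar>omega k\<bar> = \<bar>real_of_int k\<bar> ^ 3 + \<bar>real_of_int k\<bar> ^ 5"
proof (cases "0 \<le> k")
  case True
  then show ?thesis by (simp add: omega_def)
next
  case False
  then have "\<bar>real_of_int k\<bar> = real_of_int (- k)" by simp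
  moreover have "0 \<le> omega (- k)" using False by (simp add: omega_def[of "- k"] del: of_int_minus)
  ultimately show ?thesis by (simp add: omega_uminus) (simp add: omega_def)
qed

text \<open>The phases inside and outside the band are separated by at least \<open>N\<^sup>4\<close>; division by the
  gap compensates the derivative in the nonlinearity three times over.\<close>

lemma omega_gap:
  assumes "k \<in> band N" "l \<notin> band N"
  shows "\<bar>real_of_int k\<bar> * real N ^ 3 < \<bar>omega l - omega k\<bar>"
proof -
  have k: "\<bar>real_of_int k\<bar> \<le> real N" using assms(1) by auto
  have l: "real N + 1 \<le> \<bar>real_of_int l\<bar>" using assms(2) by auto
  have "\<bar>real_of_int k\<bar> ^ 3 + \<bar>real_of_int k\<bar> ^ 5 \<le> real N ^ 3 + real N ^ 5"
    using k by (intro add_mono power_mono) auto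
  moreover have "(real N + 1) ^ 3 + (real N + 1) ^ 5 \<le> \<bar>real_of_int l\<bar> ^ 3 + \<bar>real_of_int l\<bar> ^ 5"
    using l by (intro add_mono power_mono) auto
  \<comment> \<open>At the edge of the band the fifth powers alone differ by more than 5 N^4. Only
    one N^4 is claimed, and the surplus has positive coefficients.\<close>
  moreover have "real N ^ 3 + real N ^ 5 + real N ^ 4 < (real N + 1) ^ 3 + (real N + 1) ^ 5"
  proof -
    have "(real N + 1) ^ 3 + (real N + 1) ^ 5 - (real N ^ 3 + real N ^ 5 + real N ^ 4)
       = 4 * real N ^ 4 + 10 * real N ^ 3 + 13 * real N ^ 2 + 8 * real N + 2"
      by algebra
    also have "\<dots> > 0" by (simp add: add_nonneg_pos)
    finally show ?thesis by simp
  qed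
  moreover have "\<bar>omega l\<bar> - \<bar>omega k\<bar> \<le> \<bar>omega l - omega k\<bar>" by linarith
  moreover have "\<bar>real_of_int k\<bar> * real N ^ 3 \<le> real N * real N ^ 3" using k by (intro mult_right_mono) auto
  then have "\<bar>real_of_int k\<bar> * real N ^ 3 \<le> real N ^ 4" by (simp add: power4_eq_xxxx power3_eq_cube)
  ultimately show ?thesis unfolding abs_omega by linarith
qed

lemma omega_neq:
  assumes "k \<in> band N" "l \<notin> band N"
  shows "omega l \<noteq> omega k"
proof -
  have "0 \<le> \<bar>real_of_int k\<bar> * real N ^ 3" by simp
  then have "0 < \<bar>omega l - omega k\<bar>" using omega_gap[OF assms] by linarith
  then show ?thesis by simp
qed

lemma corr_coeff_bound:
  assumes "0 < N" "k \<in> band N" "l \<notin> band N"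
  shows "\<bar>gap_coeff k l\<bar> \<le> 1 / real N ^ 3"
proof -
  have "\<bar>omega l - omega k\<bar> > 0" using omega_neq[OF assms(2,3)] by simp
  then show ?thesis using less_imp_le[OF omega_gap[OF assms(2,3)]] assms(1)
    by (simp add: gap_coeff_def abs_divide divide_le_eq le_divide_eq)
qed

lemma corr_out [simp]: "k \<notin> band N \<Longrightarrow> corr N p q k = 0"
  unfolding corr_def by (rule if_not_P)

lemma low_out [simp]: "k \<notin> band N \<Longrightarrow> low N p k = 0"
  unfolding low_def by (rule if_not_P)

lemma finite_support_abs_summable:
  assumes "\<And>k. k \<notin> band N \<Longrightarrow> f k = 0"
  shows "abs_summable f"
  by (rule abs_summable_finite_support, rule finite_subset[of _ "band N"]) (use assms in blast, simp)

lemma corr_abs_summable: "abs_summable (corr N p q)"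
  by (rule finite_support_abs_summable[of N]) simp

lemma low_abs_summable: "abs_summable (low N p)"
  by (rule finite_support_abs_summable[of N]) simp

text \<open>All smallness in \<open>N\<close> comes from the high factor and from the gap; the low
  factor only bounds the sum over \<open>l\<close> uniformly in \<open>N\<close> and
  \<open>k\<close>.\<close>

lemma norm_corr_le:
  assumes N: "0 < N" and p: "\<And>l. l \<notin> band N \<Longrightarrow> norm (p l) \<le> P" and P: "0 \<le> P"
    and q: "decays 2 Q q"
  shows "norm (corr N p q k) \<le> P * Q * wtsum / real N ^ 3"
proof (cases "k \<in> band N")
  case True
  let ?J = "band (2 * N) - band N"
  have Q: "0 \<le> Q" by (rule decays_nonneg[OF q])
  have "norm (corr N p q k) \<le> (\<Sum>l\<in>?J. (P * Q / real N ^ 3) * (1 / wt (k - l) ^ 2))"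
    unfolding corr_def using True
  proof (simp only: if_True, intro order_trans[OF norm_sum sum_mono])
    fix l assume l: "l \<in> ?J"
    have lo: "norm (low N q (k - l)) \<le> Q / wt (k - l) ^ 2"
      using decaysD[OF q] Q by (simp add: low_def)
    have "norm (of_real (gap_coeff k l) * p l * low N q (k - l))
       = \<bar>gap_coeff k l\<bar> * norm (p l) * norm (low N q (k - l))"
      by (simp only: norm_mult norm_of_real)
    also have "\<dots> \<le> (1 / real N ^ 3) * P * (Q / wt (k - l) ^ 2)"
      using l P Q by (intro mult_mono corr_coeff_bound N True p lo) auto
    finally show "norm (of_real (gap_coeff k l) * p l * low N q (k - l)) \<le> (P * Q / real N ^ 3) * (1 / wt (k - l) ^ 2)"
      by simp
  qed
  also have "\<dots> = (P * Q / real N ^ 3) * (\<Sum>j\<in>(\<lambda>l. k - l) ` ?J. 1 / wt j ^ 2)"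
    by (subst sum.reindex) (auto simp: inj_on_def sum_distrib_left)
  also have "\<dots> \<le> (P * Q / real N ^ 3) * wtsum"
    using P Q by (intro mult_left_mono sum_wt_le) auto
  finally show ?thesis by simp
next
  case False
  then show ?thesis using P decays_nonneg[OF q] wtsum_nonneg by simp
qed

text \<open>Applied to endpoint values written as the average plus or minus half the increment; the
  mixed terms then form the discrete Leibniz rule.\<close>

lemma corr_bilinear:
  "corr N (\<lambda>l. p l + c * p' l) (\<lambda>l. q l + d * q' l) k
     = corr N p q k + d * corr N p q' k + c * corr N p' q k + c * d * corr N p' q' k"
proof (cases "k \<in> band N")
  case True
  have 1: "low N (\<lambda>l. q l + d * q' l) j = low N q j + d * low N q' j" for j
    by (simp add: low_def)
  show ?thesis using True unfolding corr_def 1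
    by (simp add: sum.distrib[symmetric] sum_distrib_left algebra_simps)
qed simp

text \<open>The first argument has the shape of the discrete equation solved for the increment: the
  step size times symbol and nonlinearity, plus a defect. The multiplier \<open>m\<close> stays
  inside so that \<open>corr_resonance\<close> can act on it.\<close>

lemma corr_left_linear:
  "corr N (\<lambda>l. c * (m l * p l + p' l) + p'' l) q k = c * corr N (\<lambda>l. m l * p l) q k + c * corr N p' q k + corr N p'' q k"
proof (cases "k \<in> band N")
  case True
  then show ?thesis unfolding corr_def
    by (simp add: sum.distrib[symmetric] sum_distrib_left algebra_simps)
qed simp

lemma conv_bilinear:
  assumes "abs_summable p" "abs_summable p'" "abs_summable q" "abs_summable q'"
  shows "conv (\<lambda>l. p l + c * p' l) (\<lambda>l. q l + d * q' l) k
     = conv p q k + d * conv p q' k + c * conv p' q k + c * d * conv p' q' k"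
  using assms abs_summable_cmult[OF assms(2), of c] abs_summable_cmult[OF assms(4), of d] 
     abs_summable_add[OF assms(3) abs_summable_cmult[OF assms(4), of d]]
  by (simp add: conv_add_left conv_add_right conv_cmult_left conv_cmult_right algebra_simps)

text \<open>Numerator and phase gap both change sign when \<open>k\<close> and \<open>l\<close> are
  reflected, so \<open>gap_coeff\<close> is even. This gives the reality of the corrected truncation
  that the energy estimate requires.\<close>

lemma corr_cnj:
  assumes "\<And>k. p (- k) = cnj (p k)" "\<And>k. q (- k) = cnj (q k)"
  shows "corr N p q (- k) = cnj (corr N p q k)"
proof (cases "k \<in> band N")
  case True
  have lo: "low N q (- j) = cnj (low N q j)" for j by (auto simp: low_def assms)
  have "(\<Sum>l\<in>band (2 * N) - band N. of_real (gap_coeff (- k) l) * p l * low N q (- k - l))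
      = (\<Sum>l\<in>band (2 * N) - band N. cnj (of_real (gap_coeff k l) * p l * low N q (k - l)))"
  proof (rule sum.reindex_bij_witness[of _ uminus uminus])
    fix l assume "l \<in> band (2 * N) - band N"
    have "gap_coeff k (- l) = - (of_int k / (omega l + omega k))"
      unfolding gap_coeff_def omega_uminus minus_divide_right by simp
    then have "gap_coeff (- k) l = gap_coeff k (- l)"
      by (simp add: gap_coeff_def omega_uminus)
    moreover have "cnj (low N q (k - - l)) = low N q (- k - l)"
      using lo[of "k + l"] by simp
    ultimately show "cnj (of_real (gap_coeff k (- l)) * p (- l) * low N q (k - - l))
        = of_real (gap_coeff (- k) l) * p l * low N q (- k - l)"
      using assms(1)[of l] by simp
  qed auto
  then show ?thesis using True by (simp add: corr_def)
next
  case False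
  then have "- k \<notin> band N" by auto
  with False show ?thesis by (simp del: atLeastAtMost_iff)
qed

lemma low_cnj:
  assumes "\<And>k. p (- k) = cnj (p k)"
  shows "low N p (- k) = cnj (low N p k)"
  by (auto simp: low_def assms)

text \<open>The multiplier of the corrector is chosen so that \<open>\<omega> l - \<omega> k\<close> cancels and exactly the
  interaction of high with low modes remains.\<close>

lemma corr_resonance:
  assumes k: "k \<in> band N"
  shows "corr N (\<lambda>l. of_real (omega l) * p l) q k - of_real (omega k) * corr N p q k
     = of_int k * conv (\<lambda>l. p l - low N p l) (low N q) k"
proof -
  let ?J = "band (2 * N) - band N"
  have "corr N (\<lambda>l. of_real (omega l) * p l) q k - of_real (omega k) * corr N p q k
     = (\<Sum>l\<in>?J. of_int k * (p l * low N q (k - l)))"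
  proof -
    have "of_real (gap_coeff k l) * (of_real (omega l) * p l) * low N q (k - l)
        - of_real (omega k) * (of_real (gap_coeff k l) * p l * low N q (k - l))
        = of_int k * (p l * low N q (k - l))" if "l \<in> ?J" for l
    proof -
      have ne: "omega l - omega k \<noteq> 0" using omega_neq[OF k, of l] that by auto
      have "of_real (gap_coeff k l) * (of_real (omega l) * p l) * low N q (k - l)
        - of_real (omega k) * (of_real (gap_coeff k l) * p l * low N q (k - l))
        = complex_of_real (gap_coeff k l * (omega l - omega k)) * (p l * low N q (k - l))"
        by (simp add: algebra_simps)
      also have "gap_coeff k l * (omega l - omega k) = of_int k"
        using ne by (simp add: gap_coeff_def)
      finally show ?thesis by simp
    qed
    then show ?thesis using k by (simp add: corr_def sum_distrib_left flip: sum_subtractf)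
  qed
  also have "\<dots> = of_int k * conv (\<lambda>l. p l - low N p l) (low N q) k"
  proof -
    have "conv (\<lambda>l. p l - low N p l) (low N q) k = (\<Sum>l\<in>?J. (p l - low N p l) * low N q (k - l))"
      unfolding conv_def
      by (rule infsum_finite_support) (use k in \<open>auto simp: low_def\<close>)
    also have "\<dots> = (\<Sum>l\<in>?J. p l * low N q (k - l))"
      by (rule sum.cong) (auto simp: low_def)
    finally show ?thesis by (simp add: sum_distrib_left)
  qed
  finally show ?thesis .
qed

subsection \<open>Residual of the corrected solution\<close>

text \<open>The coefficients of -u u_x in the conservation form -(u^2)_x / 2.\<close>

definition nonlin :: "(int \<Rightarrow> complex) \<Rightarrow> int \<Rightarrow> complex"
  where "nonlin a k = - (\<i> * of_int k / 2) * conv a a k"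

text \<open>The quadratic term is averaged over the endpoints, as in the trapezoidal rule, whereas
  the scheme evaluates it at the midpoint. The two convolutions differ by a quarter of the increment
  convolved with itself, which the residual accounts for separately.\<close>

definition trapezoid_defect :: "real \<Rightarrow> (int \<Rightarrow> complex) \<Rightarrow> (int \<Rightarrow> complex) \<Rightarrow> int \<Rightarrow> complex"
  where "trapezoid_defect h a0 a1 k = a1 k - a0 k - of_real h *
    (\<i> * of_real (omega k) * ((a0 k + a1 k) / 2) + (nonlin a0 k + nonlin a1 k) / 2)"

definition corrected :: "nat \<Rightarrow> (int \<Rightarrow> complex) \<Rightarrow> int \<Rightarrow> complex"
  where "corrected N a k = low N a k + corr N a a k"

lemma corrected_out: "k \<notin> band N \<Longrightarrow> corrected N a k = 0"
  by (simp add: corrected_def del: atLeastAtMost_iff)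

lemma corrected_cnj:
  "(\<And>k. a (- k) = cnj (a k)) \<Longrightarrow> corrected N a (- k) = cnj (corrected N a k)"
  by (simp add: corrected_def low_cnj corr_cnj)

text \<open>Bilinearity and \<open>corr_resonance\<close> are the whole argument. On the right
  stand, in order: the time defect; the averaging error of the quadratic term; high with high modes;
  three remainders from differencing the corrector, namely nonlinearity and defect in the high slot
  and the increment in the low slot; the averaging error of the corrector; and the corrector
  interacting with low modes and with itself. The high-low term has cancelled.\<close>

lemma residual_identity:
  fixes dt :: real
  assumes sa: "abs_summable a0" "abs_summable a1"
    and k: "k \<in> band N"
    and av_def: "av = (\<lambda>k. (a0 k + a1 k) / 2)" and da_def: "da = (\<lambda>k. a1 k - a0 k)"
    and nb_def: "nb = (\<lambda>k. (nonlin a0 k + nonlin a1 k) / 2)"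
    and e_def: "e = (\<lambda>k. a1 k - a0 k - of_real dt * (\<i> * of_real (omega k) * av k + nb k))"
    and y_def: "y = (\<lambda>k. (corrected N a0 k + corrected N a1 k) / 2)"
    and z_def: "z = (\<lambda>k. (corr N a0 a0 k + corr N a1 a1 k) / 2)"
    and \<rho>_def: "\<rho> = (\<lambda>k. av k - low N av k)"
  shows "corrected N a1 k - corrected N a0 k
      - of_real dt * (\<i> * of_real (omega k) * y k - \<i> * of_int k / 2 * conv y y k)
    = e k - of_real dt * (\<i> * of_int k / 8) * conv da da k - of_real dt * (\<i> * of_int k / 2) * conv \<rho> \<rho> k
      + of_real dt * corr N nb av k + corr N e av k + corr N av da k
      - of_real dt * (\<i> * of_real (omega k) / 4) * corr N da da k
      + of_real dt * (\<i> * of_int k) * conv (low N av) z k + of_real dt * (\<i> * of_int k / 2) * conv z z k"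
proof -
  have sav: "abs_summable av" 
    using abs_summable_cmult[OF abs_summable_add[OF sa], of "1/2"] by (simp add: av_def)
  have sda: "abs_summable da" unfolding da_def by (rule abs_summable_diff[OF sa(2,1)])
  have s\<rho>: "abs_summable \<rho>" unfolding \<rho>_def by (rule abs_summable_diff[OF sav low_abs_summable])
  have sz: "abs_summable z"
    using abs_summable_cmult[OF abs_summable_add[OF corr_abs_summable[of N a0 a0] corr_abs_summable[of N a1 a1]], of "1/2"]
    by (simp add: z_def)
  \<comment> \<open>In these variables mixed terms drop out of averages and pure terms out of
    differences.\<close>
  have a0: "a0 = (\<lambda>l. av l + (- 1 / 2) * da l)" and a1: "a1 = (\<lambda>l. av l + (1 / 2) * da l)"
    by (auto simp: av_def da_def field_simps)
  let ?c = "conv av av k" and ?d = "conv da da k" and ?x = "conv av da k" and ?x' = "conv da av k"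
  have c0: "conv a0 a0 k = ?c - ?x / 2 - ?x' / 2 + ?d / 4" and c1: "conv a1 a1 k = ?c + ?x / 2 + ?x' / 2 + ?d / 4"
    unfolding a0 a1 by (simp_all only: conv_bilinear[OF sav sda sav sda]) simp_all
  let ?C = "corr N av av k" and ?D = "corr N da da k" and ?X = "corr N av da k" and ?X' = "corr N da av k"
  have C0: "corr N a0 a0 k = ?C - ?X / 2 - ?X' / 2 + ?D / 4" and C1: "corr N a1 a1 k = ?C + ?X / 2 + ?X' / 2 + ?D / 4"
    unfolding a0 a1 by (simp_all only: corr_bilinear) simp_all
  have nbk: "nb k = - (\<i> * of_int k / 2) * (?c + ?d / 4)"
    unfolding nb_def nonlin_def c0 c1 by (simp add: field_simps)
  have "av = (\<lambda>l. low N av l + 1 * \<rho> l)" by (auto simp: \<rho>_def)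
  then have "?c = conv (\<lambda>l. low N av l + 1 * \<rho> l) (\<lambda>l. low N av l + 1 * \<rho> l) k" by simp
  then have cav: "?c = conv (low N av) (low N av) k + 2 * conv \<rho> (low N av) k + conv \<rho> \<rho> k"
    unfolding conv_bilinear[OF low_abs_summable s\<rho> low_abs_summable s\<rho>] conv_commute[of "low N av" \<rho>]
    by simp
  have "y = (\<lambda>l. low N av l + 1 * z l)"
    by (auto simp: y_def corrected_def z_def av_def low_def field_simps)
  then have cy: "conv y y k = conv (low N av) (low N av) k + 2 * conv (low N av) z k + conv z z k"
    by (simp only:) (simp only: conv_bilinear[OF low_abs_summable sz low_abs_summable sz] conv_commute[of z "low N av"], simp)
  have yk: "y k = av k + ?C + ?D / 4"
    using k unfolding y_def corrected_def C0 C1 by (simp add: low_def av_def field_simps)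
  \<comment> \<open>The equation replaces the increment in the high slot only: there it produces the
    factor \<open>omega l\<close> on which the resonance identity acts. In the low slot the
    increment is estimated as it stands.\<close>
  have lin: "?X' = of_real dt * corr N (\<lambda>l. \<i> * (of_real (omega l) * av l)) av k + of_real dt * corr N nb av k + corr N e av k"
  proof -
    have "da = (\<lambda>l. of_real dt * (\<i> * (of_real (omega l) * av l) + nb l) + e l)"
      by (auto simp: e_def da_def algebra_simps)
    then have "?X' = corr N (\<lambda>l. of_real dt * (\<i> * (of_real (omega l) * av l) + nb l) + e l) av k" by simp
    also have "\<dots> = of_real dt * corr N (\<lambda>l. \<i> * (of_real (omega l) * av l)) av k + of_real dt * corr N nb av k + corr N e av k"
      by (rule corr_left_linear[of N _ "\<lambda>_. \<i>"])
    finally show ?thesis .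
  qed
  have im: "corr N (\<lambda>l. \<i> * (of_real (omega l) * av l)) av k = \<i> * corr N (\<lambda>l. of_real (omega l) * av l) av k"
    using k by (simp add: corr_def sum_distrib_left algebra_simps)
  have res: "corr N (\<lambda>l. of_real (omega l) * av l) av k = of_real (omega k) * ?C + of_int k * conv \<rho> (low N av) k"
    using corr_resonance[OF k, of av av] by (simp add: \<rho>_def[symmetric] algebra_simps)
  have dk: "a1 k - a0 k = of_real dt * (\<i> * of_real (omega k) * av k + nb k) + e k"
    by (simp add: e_def)
  have "corrected N a1 k - corrected N a0 k = (a1 k - a0 k) + (?X + ?X')"
    using k unfolding corrected_def C0 C1 by (simp add: low_def)
  then show ?thesis
    unfolding dk lin im res yk cy nbk cav by (simp add: algebra_simps add_divide_distrib)
qed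

lemma band_wt: "0 < N \<Longrightarrow> k \<in> band N \<Longrightarrow> wt k \<le> 2 * real N"
  by (auto simp: wt_def)

lemma out_wt: "k \<notin> band N \<Longrightarrow> real N \<le> wt k"
  by (auto simp: wt_def)

lemma decays_out:
  assumes "decays s C f" "0 < N" "k \<notin> band N"
  shows "norm (f k) \<le> C / real N ^ s"
proof -
  have "norm (f k) \<le> C / wt k ^ s" by (rule decaysD[OF assms(1)])
  also have "\<dots> \<le> C / real N ^ s"
    using decays_nonneg[OF assms(1)] out_wt[OF assms(3)] assms(2) by (intro divide_left_mono power_mono) auto
  finally show ?thesis .
qed

lemma decays_average:
  assumes "decays s C f" "decays s C g"
  shows "decays s C (\<lambda>k. (f k + g k) / 2)"
  using decays_const_mult[OF decays_add[OF assms], of "1/2"] by simp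

lemma decays_nonlin:
  assumes "decays (s + 1) C a" "1 \<le> s"
  shows "decays s (2 ^ (s + 1) * wtsum * C * C) (nonlin a)"
proof -
  have "decays (s + 1) (2 ^ (s + 1 + 1) * wtsum * C * C) (conv a a)"
    by (rule decays_conv) (use assms in auto)
  moreover have "norm (- (\<i> * of_int k / 2)) \<le> 1 / 2 * wt k ^ 1" for k
    by (simp add: norm_mult norm_divide wt_def)
  ultimately have "decays s (1 / 2 * (2 ^ (s + 1 + 1) * wtsum * C * C)) (\<lambda>k. - (\<i> * of_int k / 2) * conv a a k)"
    by (rule decays_multiplier)
  then show ?thesis by (simp add: nonlin_def[abs_def] mult_ac)
qed

lemma decays_low: "decays s C f \<Longrightarrow> decays s C (low N f)"
  using decays_nonneg[of s C f] by (auto simp: decays_def low_def)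

text \<open>Inside the band 1/N <= 2 / wt k, so one spare power of \<open>N\<close> can be exchanged
  for the factor 1 / wt k that square summability calls for.\<close>

lemma one_over_power_le:
  assumes N: "0 < N" "k \<in> band N" and m: "n + 1 \<le> m" and c: "0 \<le> c"
  shows "c / real N ^ m \<le> 2 * c * (1 / real N ^ n) / wt k"
proof -
  have "real N ^ (n + 1) \<le> real N ^ m" using N m by (intro power_increasing) auto
  then have "c / real N ^ m \<le> c / real N ^ (n + 1)"
    using c N by (intro divide_left_mono) auto
  also have "\<dots> = c * (1 / real N ^ n) * (1 / real N)" by simp
  also have "\<dots> \<le> c * (1 / real N ^ n) * (2 / wt k)"
    using band_wt[OF N] N c by (intro mult_left_mono) (auto simp: field_simps)
  finally show ?thesis by (simp add: mult.commute mult.left_commute)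
qed


lemma norm_corr_self_le:
  assumes N: "0 < N" and f: "decays r B f" and r: "2 \<le> r"
  shows "norm (corr N f f l) \<le> B\<^sup>2 * wtsum / real N ^ (r + 3)"
proof -
  have "norm (corr N f f l) \<le> B / real N ^ r * B * wtsum / real N ^ 3"
    by (rule norm_corr_le[OF N decays_out[OF f N] _ decays_mono[OF f r order_refl]])
       (use decays_nonneg[OF f] in auto)
  then show ?thesis by (simp add: power_add power2_eq_square)
qed

lemma norm_triangle_nine:
  fixes t1 :: complex
  shows "norm (t1 - t2 - t3 + t4 + t5 + t6 - t7 + t8 + t9)
    \<le> norm t1 + norm t2 + norm t3 + norm t4 + norm t5 + norm t6 + norm t7 + norm t8 + norm t9"
  by (intro order_trans[OF norm_triangle_ineq] order_trans[OF norm_triangle_ineq4] add_mono order_refl)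

text \<open>One summand for each of the nine terms of \<open>residual_identity\<close>, in the order
  \<open>t1\<close> to \<open>t9\<close> of the next proof.\<close>

definition residual_const :: "nat \<Rightarrow> real \<Rightarrow> real \<Rightarrow> real \<Rightarrow> real"
  where "residual_const r B B1 B3 = B3 + 512 * wtsum * B1\<^sup>2 + B\<^sup>2 * wtsum + 2 * (2 ^ r * wtsum * B * B * B * wtsum)
     + 2 * (B3 * B * wtsum) + 2 * (B * B1 * wtsum) + 32 * (B1\<^sup>2 * wtsum) + 2 * (B ^ 3 * wtsum\<^sup>2) + 3 * (B ^ 4 * wtsum\<^sup>2)"

text \<open>The order 11 = 16 - 5 of the increments is what one time derivative leaves of r = 16; it
  offsets the symbol \<open>omega k\<close> in \<open>t7\<close>.\<close>

lemma residual_bound: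
  fixes dt :: real
  assumes N: "0 < N" and dt: "0 \<le> dt" and r: "4 \<le> r"
    and a: "decays r B a0" "decays r B a1"
    and da: "decays 11 (B1 * dt) (\<lambda>k. a1 k - a0 k)"
    and e: "decays 1 (B3 * dt ^ 3) (trapezoid_defect dt a0 a1)"
    and B: "0 \<le> B1" "0 \<le> B3"
    and y_def: "y = (\<lambda>k. (corrected N a0 k + corrected N a1 k) / 2)"
    and k: "k \<in> band N"
  shows "norm (corrected N a1 k - corrected N a0 k
      - of_real dt * (\<i> * of_real (omega k) * y k - \<i> * of_int k / 2 * conv y y k))
    \<le> residual_const r B B1 B3 * (dt * (1 / real N ^ r + dt\<^sup>2)) / wt k"
proof -
  define av where "av = (\<lambda>k. (a0 k + a1 k) / 2)"
  define d where "d = (\<lambda>k. a1 k - a0 k)"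
  define nb where "nb = (\<lambda>k. (nonlin a0 k + nonlin a1 k) / 2)"
  define e' where "e' = (\<lambda>k. a1 k - a0 k - of_real dt * (\<i> * of_real (omega k) * av k + nb k))"
  define z where "z = (\<lambda>k. (corr N a0 a0 k + corr N a1 a1 k) / 2)"
  define \<rho> where "\<rho> = (\<lambda>k. av k - low N av k)"
  let ?W = wtsum and ?n = "real N" and ?E = "1 / real N ^ r + dt\<^sup>2"
  have W: "0 \<le> ?W" by (rule wtsum_nonneg)
  have B0: "0 \<le> B" by (rule decays_nonneg[OF a(1)])
  have n: "1 \<le> ?n" using N by simp
  have kn: "\<bar>real_of_int k\<bar> \<le> ?n" using k by auto
  have kw: "\<bar>real_of_int k\<bar> \<le> wt k" by (simp add: wt_def)
  have ew1: "c / ?n ^ m \<le> 2 * c * ?E / wt k" if "0 \<le> c" "r + 1 \<le> m" for c m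
  proof -
    have "c / ?n ^ m \<le> 2 * c * (1 / ?n ^ r) / wt k" by (rule one_over_power_le[OF N k that(2,1)])
    also have "\<dots> \<le> 2 * c * ?E / wt k" using that by (intro divide_right_mono mult_left_mono) auto
    finally show ?thesis .
  qed
  have ew2: "c * dt\<^sup>2 / ?n ^ m \<le> 2 * c * ?E / wt k" if "0 \<le> c" "1 \<le> m" for c m
  proof -
    have "c * dt\<^sup>2 / ?n ^ m \<le> 2 * (c * dt\<^sup>2) * (1 / ?n ^ 0) / wt k" by (rule one_over_power_le[OF N k]) (use that in auto)
    also have "\<dots> = 2 * c * dt\<^sup>2 / wt k" by simp
    also have "\<dots> \<le> 2 * c * ?E / wt k" using that by (intro divide_right_mono mult_left_mono) auto
    finally show ?thesis .
  qed
  have a2: "decays 2 B f" if "decays r B f" for f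
    by (rule decays_mono[OF that]) (use r in auto)
  have dav: "decays r B av" unfolding av_def by (rule decays_average[OF a])
  have dd: "decays 11 (B1 * dt) d" unfolding d_def by (rule da)
  have dd2: "decays 2 (B1 * dt) d" by (rule decays_mono[OF dd]) auto
  have de: "decays 1 (B3 * dt ^ 3) e'"
    using e unfolding e'_def av_def nb_def trapezoid_defect_def[abs_def] .
  let ?c = "2 ^ r * ?W * B * B"
  have c0: "0 \<le> ?c" using W B0 by simp
  have dnb: "decays (r - 1) ?c nb"
  proof -
    have "decays (r - 1) (2 ^ (r - 1 + 1) * ?W * B * B) (nonlin f)" if "decays r B f" for f
      by (rule decays_nonlin) (use that r in auto)
    then have "decays (r - 1) ?c (nonlin a0)" "decays (r - 1) ?c (nonlin a1)" using a r by auto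
    then show ?thesis unfolding nb_def by (rule decays_average)
  qed
  have d\<rho>: "norm (\<rho> l) \<le> B / ?n ^ r" for l
  proof (cases "l \<in> band N")
    case True then show ?thesis using B0 by (simp add: \<rho>_def low_def)
  next
    case False 
    then have "\<rho> l = av l" by (simp add: \<rho>_def del: atLeastAtMost_iff)
    then show ?thesis using decays_out[OF dav N False] by simp
  qed
  \<comment> \<open>Two of the \<open>r\<close> powers are kept for the summation over
    \<open>l\<close>; the other r - 2 are converted into powers of \<open>N\<close>.\<close>
  have d\<rho>2: "decays 2 (B / ?n ^ (r - 2)) \<rho>"
    unfolding decays_def
  proof
    fix l
    show "norm (\<rho> l) \<le> B / ?n ^ (r - 2) / wt l ^ 2"
    proof (cases "l \<in> band N")
      case True then show ?thesis using B0 by (simp add: \<rho>_def low_def)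
    next
      case False 
      then have "\<rho> l = av l" by (simp add: \<rho>_def del: atLeastAtMost_iff)
      then have "norm (\<rho> l) \<le> B / wt l ^ r" using decaysD[OF dav] by simp
      also have "wt l ^ r = wt l ^ (r - 2) * wt l ^ 2"
      proof -
        have "r - 2 + 2 = r" using r by simp
        then show ?thesis by (metis power_add)
      qed
      also have "B / (wt l ^ (r - 2) * wt l ^ 2) \<le> B / (?n ^ (r - 2) * wt l ^ 2)"
        using B0 n out_wt[OF False] by (intro divide_left_mono mult_right_mono power_mono) auto
      finally show ?thesis by simp
    qed
  qed
  let ?Z = "B * B * ?W / ?n ^ (r + 3)"
  have Z0: "0 \<le> ?Z" using W B0 by simp
  have zi: "norm (corr N f f l) \<le> ?Z" if "decays r B f" for f l
    using norm_corr_self_le[OF N that] r by (simp add: power2_eq_square)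
  have dz: "norm (z l) \<le> ?Z" for l
    unfolding z_def using norm_triangle_mono[OF zi[OF a(1), of l] zi[OF a(2), of l]] by (simp add: norm_divide mult_ac)
  \<comment> \<open>A crude count of modes: the l1 norm of \<open>z\<close> only has to be bounded
    independently of \<open>N\<close>.\<close>
  have sz: "(\<Sum>\<^sub>\<infinity>l. norm (z l)) \<le> 3 * B\<^sup>2 * ?W"
  proof -
    have "(\<Sum>\<^sub>\<infinity>l. norm (z l)) = (\<Sum>l\<in>band N. norm (z l))"
      by (rule infsum_finite_support) (simp_all add: z_def del: atLeastAtMost_iff)
    also have "\<dots> \<le> (\<Sum>l\<in>band N. ?Z)" by (rule sum_mono) (rule dz)
    also have "\<dots> = (2 * ?n + 1) * ?Z" by simp
    also have "\<dots> \<le> (3 * ?n ^ (r + 3)) * ?Z"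
    proof (rule mult_right_mono[OF _ Z0])
      have "?n ^ 1 \<le> ?n ^ (r + 3)" by (rule power_increasing) (use n in auto)
      then show "2 * ?n + 1 \<le> 3 * ?n ^ (r + 3)" using n unfolding power_one_right by linarith
    qed
    also have "\<dots> = 3 * B\<^sup>2 * ?W" using n by (simp add: power2_eq_square)
    finally show ?thesis .
  qed
  have zsum: "abs_summable z"
    by (rule finite_support_abs_summable[of N]) (simp add: z_def del: atLeastAtMost_iff)

  have t1: "norm (e' k) \<le> dt * (B3 * ?E / wt k)"
  proof -
    have "norm (e' k) \<le> B3 * dt ^ 3 / wt k" using decaysD[OF de, of k] by simp
    also have "\<dots> = dt * (B3 * dt\<^sup>2 / wt k)" by (simp add: power2_eq_square power3_eq_cube)
    also have "\<dots> \<le> dt * (B3 * ?E / wt k)"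
      using dt B by (intro mult_left_mono divide_right_mono) auto
    finally show ?thesis .
  qed
  have t2: "norm (of_real dt * (\<i> * of_int k / 8) * conv d d k) \<le> dt * (512 * ?W * B1\<^sup>2 * ?E / wt k)"
  proof -
    have "norm (of_real dt * (\<i> * of_int k / 8) * conv d d k) = dt * (\<bar>real_of_int k\<bar> / 8 * norm (conv d d k))"
      using dt by (simp add: norm_mult norm_divide)
    also have "\<dots> \<le> dt * (wt k / 8 * (2 ^ (11 + 1) * ?W * (B1 * dt) * (B1 * dt) / wt k ^ 11))"
      using dt kw decaysD[OF decays_conv[OF dd dd]]
      by (intro mult_left_mono mult_mono divide_right_mono) auto
    also have "\<dots> = dt * (512 * ?W * B1\<^sup>2 * dt\<^sup>2 / wt k ^ 10)"
    proof -
      have "wt k ^ 11 = wt k * wt k ^ 10" by (simp flip: power_Suc)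
      then show ?thesis by (simp add: power2_eq_square)
    qed
    also have "\<dots> \<le> dt * (512 * ?W * B1\<^sup>2 * ?E / wt k ^ 1)"
      using dt W by (intro mult_left_mono frac_le wt_power_mono mult_nonneg_nonneg) auto
    finally show ?thesis by simp
  qed
  \<comment> \<open>One factor in l1 and one in the sup norm give N N^(2-r) N^(-r) = N^(3-2r), and
    2r - 3 >= r + 1 is the condition r >= 4.\<close>
  have t3: "norm (of_real dt * (\<i> * of_int k / 2) * conv \<rho> \<rho> k) \<le> dt * (B\<^sup>2 * ?W * ?E / wt k)"
  proof -
    have "norm (of_real dt * (\<i> * of_int k / 2) * conv \<rho> \<rho> k) = dt * (\<bar>real_of_int k\<bar> / 2 * norm (conv \<rho> \<rho> k))"
      using dt by (simp add: norm_mult norm_divide)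
    also have "\<dots> \<le> dt * (?n / 2 * ((B / ?n ^ (r - 2) * ?W) * (B / ?n ^ r)))"
    proof (intro mult_left_mono[OF _ dt] mult_mono divide_right_mono kn)
      have "norm (conv \<rho> \<rho> k) \<le> (\<Sum>\<^sub>\<infinity>l. norm (\<rho> l)) * (B / ?n ^ r)"
        by (rule norm_conv_le[OF decays_abs_summable[OF d\<rho>2 order_refl] d\<rho>])
      also have "\<dots> \<le> (B / ?n ^ (r - 2) * ?W) * (B / ?n ^ r)"
        by (intro mult_right_mono decays_norm_sum_le[OF d\<rho>2 order_refl]) (use B0 in auto)
      finally show "norm (conv \<rho> \<rho> k) \<le> (B / ?n ^ (r - 2) * ?W) * (B / ?n ^ r)" .
    qed auto
    also have "\<dots> = dt * (B\<^sup>2 * ?W / 2 / ?n ^ (2 * r - 3))"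
    proof -
      have "?n ^ (r - 2) * ?n ^ r = ?n * ?n ^ (2 * r - 3)"
      proof -
        have "r - 2 + r = Suc (2 * r - 3)" using r by simp
        then show ?thesis by (metis power_add power_Suc)
      qed
      then show ?thesis using n by (simp add: power2_eq_square divide_simps)
    qed
    also have "\<dots> \<le> dt * (2 * (B\<^sup>2 * ?W / 2) * ?E / wt k)"
      by (rule mult_left_mono[OF ew1 dt]) (use r W in auto)
    finally show ?thesis by simp
  qed
  \<comment> \<open>The nonlinearity decays one order less than the solution, and the gap returns
    three.\<close>
  have t4: "norm (of_real dt * corr N nb av k) \<le> dt * (2 * (?c * B * ?W) * ?E / wt k)"
  proof -
    have "norm (corr N nb av k) \<le> ?c / ?n ^ (r - 1) * B * ?W / ?n ^ 3"
      by (rule norm_corr_le[OF N decays_out[OF dnb N] _ a2[OF dav]]) (use c0 in auto)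
    also have "\<dots> = ?c * B * ?W / ?n ^ (r + 2)"
    proof -
      have "?n ^ (r - 1) * ?n ^ 3 = ?n ^ (r + 2)" using r by (simp flip: power_add)
      then show ?thesis by simp
    qed
    also have "\<dots> \<le> 2 * (?c * B * ?W) * ?E / wt k"
      by (rule ew1) (use c0 W B0 in auto)
    finally have "norm (corr N nb av k) \<le> 2 * (?c * B * ?W) * ?E / wt k" .
    from mult_left_mono[OF this dt] show ?thesis
      by (simp only: norm_mult norm_of_real abs_of_nonneg[OF dt])
  qed
  have t5: "norm (corr N e' av k) \<le> dt * (2 * (B3 * B * ?W) * ?E / wt k)"
  proof -
    have "norm (corr N e' av k) \<le> B3 * dt ^ 3 * B * ?W / ?n ^ 3"
    proof (rule norm_corr_le[OF N _ _ a2[OF dav]])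
      show "norm (e' l) \<le> B3 * dt ^ 3" for l
      proof -
        have "B3 * dt ^ 3 / wt l \<le> B3 * dt ^ 3 / 1" using B dt by (intro divide_left_mono) auto
        then show ?thesis using decaysD[OF de, of l] by simp
      qed
    qed (use B dt in auto)
    also have "\<dots> = dt * ((B3 * B * ?W) * dt\<^sup>2 / ?n ^ 3)" by (simp add: power2_eq_square power3_eq_cube)
    also have "\<dots> \<le> dt * (2 * (B3 * B * ?W) * ?E / wt k)"
      by (rule mult_left_mono[OF ew2 dt]) (use B W B0 in auto)
    finally show ?thesis .
  qed
  have t6: "norm (corr N av d k) \<le> dt * (2 * (B * B1 * ?W) * ?E / wt k)"
  proof -
    have "norm (corr N av d k) \<le> B / ?n ^ r * (B1 * dt) * ?W / ?n ^ 3"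
      by (rule norm_corr_le[OF N decays_out[OF dav N] _ dd2]) (use B0 in auto)
    also have "\<dots> = dt * (B * B1 * ?W / ?n ^ (r + 3))" by (simp add: power_add)
    also have "\<dots> \<le> dt * (2 * (B * B1 * ?W) * ?E / wt k)"
      by (rule mult_left_mono[OF ew1 dt]) (use B W B0 in auto)
    finally show ?thesis .
  qed
  \<comment> \<open>The symbol is of order N^5, against N^(-11) from the increment in the high slot
    and N^(-3) from the gap.\<close>
  have t7: "norm (of_real dt * (\<i> * of_real (omega k) / 4) * corr N d d k) \<le> dt * (32 * (B1\<^sup>2 * ?W) * ?E / wt k)"
  proof -
    have "\<bar>omega k\<bar> \<le> 2 * wt k ^ 5" by (rule norm_omega_le)
    also have "\<dots> \<le> 2 * (2 * ?n) ^ 5" by (intro mult_left_mono power_mono band_wt N k) auto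
    finally have om: "\<bar>omega k\<bar> / 4 \<le> 16 * ?n ^ 5" by (simp add: power_mult_distrib)
    have cd: "norm (corr N d d k) \<le> (B1 * dt) / ?n ^ 11 * (B1 * dt) * ?W / ?n ^ 3"
      by (rule norm_corr_le[OF N decays_out[OF dd N] _ dd2]) (use B dt in auto)
    have "norm (of_real dt * (\<i> * of_real (omega k) / 4) * corr N d d k) = dt * (\<bar>omega k\<bar> / 4 * norm (corr N d d k))"
      using dt by (simp add: norm_mult norm_divide)
    also have "\<dots> \<le> dt * (16 * ?n ^ 5 * ((B1 * dt) / ?n ^ 11 * (B1 * dt) * ?W / ?n ^ 3))"
      by (intro mult_left_mono[OF _ dt] mult_mono om cd) auto
    also have "\<dots> = dt * ((16 * (B1\<^sup>2 * ?W)) * dt\<^sup>2 / ?n ^ 9)"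
    proof -
      have "?n ^ 11 * ?n ^ 3 = ?n ^ 5 * ?n ^ 9" by (simp flip: power_add)
      then show ?thesis using n by (simp add: power2_eq_square divide_simps)
    qed
    also have "\<dots> \<le> dt * (2 * (16 * (B1\<^sup>2 * ?W)) * ?E / wt k)"
      by (rule mult_left_mono[OF ew2 dt]) (use W in auto)
    finally show ?thesis by simp
  qed
  \<comment> \<open>The derivative costs one power of \<open>N\<close>, but the corrector carries
    N^(-r-3).\<close>
  have t8: "norm (of_real dt * (\<i> * of_int k) * conv (low N av) z k) \<le> dt * (2 * (B ^ 3 * ?W\<^sup>2) * ?E / wt k)"
  proof -
    have "norm (of_real dt * (\<i> * of_int k) * conv (low N av) z k) = dt * (\<bar>real_of_int k\<bar> * norm (conv (low N av) z k))"
      using dt by (simp add: norm_mult)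
    also have "\<dots> \<le> dt * (?n * ((B * ?W) * ?Z))"
    proof (intro mult_left_mono[OF _ dt] mult_mono kn)
      have "norm (conv (low N av) z k) \<le> (\<Sum>\<^sub>\<infinity>l. norm (low N av l)) * ?Z"
        by (rule norm_conv_le[OF low_abs_summable dz])
      also have "\<dots> \<le> (B * ?W) * ?Z"
        by (intro mult_right_mono decays_norm_sum_le[OF decays_low[OF a2[OF dav]] order_refl] Z0)
      finally show "norm (conv (low N av) z k) \<le> (B * ?W) * ?Z" .
    qed auto
    also have "\<dots> = dt * ((B ^ 3 * ?W\<^sup>2) / ?n ^ (r + 2))"
      using n by (simp add: power2_eq_square power3_eq_cube power_add divide_simps)
    also have "\<dots> \<le> dt * (2 * (B ^ 3 * ?W\<^sup>2) * ?E / wt k)"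
      by (rule mult_left_mono[OF ew1 dt]) (use B0 in auto)
    finally show ?thesis .
  qed
  have t9: "norm (of_real dt * (\<i> * of_int k / 2) * conv z z k) \<le> dt * (3 * (B ^ 4 * ?W\<^sup>2) * ?E / wt k)"
  proof -
    have "norm (of_real dt * (\<i> * of_int k / 2) * conv z z k) = dt * (\<bar>real_of_int k\<bar> / 2 * norm (conv z z k))"
      using dt by (simp add: norm_mult norm_divide)
    also have "\<dots> \<le> dt * (?n / 2 * ((3 * B\<^sup>2 * ?W) * ?Z))"
    proof (intro mult_left_mono[OF _ dt] mult_mono divide_right_mono kn)
      have "norm (conv z z k) \<le> (\<Sum>\<^sub>\<infinity>l. norm (z l)) * ?Z"
        by (rule norm_conv_le[OF zsum dz])
      also have "\<dots> \<le> (3 * B\<^sup>2 * ?W) * ?Z"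
        by (intro mult_right_mono sz Z0)
      finally show "norm (conv z z k) \<le> (3 * B\<^sup>2 * ?W) * ?Z" .
    qed auto
    also have "\<dots> = dt * ((3 / 2 * (B ^ 4 * ?W\<^sup>2)) / ?n ^ (r + 2))"
      using n by (simp add: power2_eq_square power4_eq_xxxx power3_eq_cube power_add divide_simps)
    also have "\<dots> \<le> dt * (2 * (3 / 2 * (B ^ 4 * ?W\<^sup>2)) * ?E / wt k)"
      by (rule mult_left_mono[OF ew1 dt]) (use B0 in auto)
    finally show ?thesis by (simp add: mult_ac)
  qed
  have sa: "abs_summable a0" "abs_summable a1" using a a2 by (blast intro: decays_abs_summable order_refl)+
  have "norm (corrected N a1 k - corrected N a0 k - of_real dt * (\<i> * of_real (omega k) * y k - \<i> * of_int k / 2 * conv y y k))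
    \<le> dt * (B3 * ?E / wt k) + dt * (512 * ?W * B1\<^sup>2 * ?E / wt k) + dt * (B\<^sup>2 * ?W * ?E / wt k)
      + dt * (2 * (?c * B * ?W) * ?E / wt k) + dt * (2 * (B3 * B * ?W) * ?E / wt k) + dt * (2 * (B * B1 * ?W) * ?E / wt k)
      + dt * (32 * (B1\<^sup>2 * ?W) * ?E / wt k) + dt * (2 * (B ^ 3 * ?W\<^sup>2) * ?E / wt k) + dt * (3 * (B ^ 4 * ?W\<^sup>2) * ?E / wt k)"
    unfolding residual_identity[OF sa k av_def d_def nb_def e'_def y_def z_def \<rho>_def]
    by (rule order_trans[OF norm_triangle_nine]) (intro add_mono t1 t2 t3 t4 t5 t6 t7 t8 t9)
  also have "\<dots> = residual_const r B B1 B3 * (dt * ?E) / wt k"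
    unfolding residual_const_def distrib_right add_divide_distrib by (simp only: mult_ac times_divide_eq_left times_divide_eq_right)
  finally show ?thesis .
qed

subsection \<open>Convergence on the Fourier side\<close>

lemma band_norm_corr_le:
  assumes N: "0 < N" and f: "decays r B f" and r: "2 \<le> r"
  shows "band_norm N (corr N f f) \<le> 3 * B\<^sup>2 * wtsum / real N ^ r"
proof -
  let ?Z = "B\<^sup>2 * wtsum / real N ^ (r + 3)"
  have n: "1 \<le> real N" using N by simp
  have "band_norm N (corr N f f) \<le> (2 * real N + 1) * ?Z"
    by (rule band_norm_le_const) (rule norm_corr_self_le[OF assms])
  also have "\<dots> \<le> (3 * real N ^ 3) * ?Z"
  proof (rule mult_right_mono)
    have "real N ^ 1 \<le> real N ^ 3" by (rule power_increasing) (use n in auto)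
    then show "2 * real N + 1 \<le> 3 * real N ^ 3" using n unfolding power_one_right by linarith
  qed (use wtsum_nonneg in auto)
  also have "\<dots> = 3 * B\<^sup>2 * wtsum / real N ^ r"
    using n by (simp add: power_add)
  finally show ?thesis .
qed

text \<open>Bounds the l1 norm of the derivative of the corrected truncation independently of
  \<open>N\<close>: the first summand is the truncation, the second the corrector. It becomes the
  Gronwall rate.\<close>

definition growth_const :: "real \<Rightarrow> real"
  where "growth_const B = B * wtsum + 3 * (B\<^sup>2 * wtsum)"

lemma weighted_sum_corrected_le:
  assumes N: "0 < N" and f: "decays r B f" and r: "3 \<le> r"
  shows "(\<Sum>l\<in>band N. \<bar>of_int l\<bar> * norm (corrected N f l)) \<le> growth_const B"
proof -
  let ?Z = "B\<^sup>2 * wtsum / real N ^ (r + 3)"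
  have n: "1 \<le> real N" using N by simp
  have B: "0 \<le> B" by (rule decays_nonneg[OF f])
  have "(\<Sum>l\<in>band N. \<bar>of_int l\<bar> * norm (corrected N f l)) \<le> (\<Sum>l\<in>band N. B * (1 / wt l ^ 2) + real N * ?Z)"
  proof (rule sum_mono)
    fix l assume l: "l \<in> band N"
    have "\<bar>real_of_int l\<bar> * norm (corrected N f l) \<le> \<bar>real_of_int l\<bar> * (norm (f l) + norm (corr N f f l))"
      using l by (intro mult_left_mono) (auto simp: corrected_def low_def intro: norm_triangle_ineq)
    also have "\<dots> = \<bar>real_of_int l\<bar> * norm (f l) + \<bar>real_of_int l\<bar> * norm (corr N f f l)"
      by (rule distrib_left)
    also have "\<bar>real_of_int l\<bar> * norm (f l) \<le> wt l * (B / wt l ^ 3)"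
      by (intro mult_mono decaysD[OF decays_mono[OF f r order_refl]]) (simp_all add: wt_def)
    also have "wt l * (B / wt l ^ 3) = B * (1 / wt l ^ 2)"
      by (simp add: power3_eq_cube power2_eq_square)
    also have "\<bar>real_of_int l\<bar> * norm (corr N f f l) \<le> real N * ?Z"
      using l by (intro mult_mono norm_corr_self_le[OF N f]) (use r in auto)
    finally show "\<bar>of_int l\<bar> * norm (corrected N f l) \<le> B * (1 / wt l ^ 2) + real N * ?Z" by simp
  qed
  also have "\<dots> = B * (\<Sum>l\<in>band N. 1 / wt l ^ 2) + (2 * real N + 1) * (real N * ?Z)"
    by (simp add: sum.distrib sum_distrib_left)
  also have "\<dots> \<le> B * wtsum + (3 * real N) * (real N ^ (r + 2) * ?Z)"
    using n B wtsum_nonneg power_increasing[of 1 "r + 2" "real N"]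
    by (intro add_mono mult_left_mono mult_mono sum_wt_le mult_right_mono) auto
  also have "\<dots> = growth_const B"
    using n by (simp add: growth_const_def power_add field_simps power2_eq_square power3_eq_cube)
  finally show ?thesis .
qed

lemma growth_const_nonneg: "0 \<le> B \<Longrightarrow> 0 \<le> growth_const B"
  by (simp add: growth_const_def wtsum_nonneg)

lemma residual_const_nonneg: "0 \<le> B \<Longrightarrow> 0 \<le> B1 \<Longrightarrow> 0 \<le> B3 \<Longrightarrow> 0 \<le> residual_const r B B1 B3"
  by (simp add: residual_const_def wtsum_nonneg)

text \<open>From left to right: the Gronwall factor, the corrector at the initial time, the
  residuals accumulated up to time \<open>T\<close>, and the corrector once more when passing back
  from the corrected truncation.\<close>

definition error_const :: "nat \<Rightarrow> real \<Rightarrow> real \<Rightarrow> real \<Rightarrow> real \<Rightarrow> real"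
  where "error_const r B B1 B3 T = exp (growth_const B * T)
      * (3 * B\<^sup>2 * wtsum + 2 * T * (residual_const r B B1 B3 * sqrt wtsum)) + 3 * B\<^sup>2 * wtsum"

lemma error_const_nonneg:
  "0 \<le> B \<Longrightarrow> 0 \<le> B1 \<Longrightarrow> 0 \<le> B3 \<Longrightarrow> 0 \<le> T \<Longrightarrow> 0 \<le> error_const r B B1 B3 T"
  by (simp add: error_const_def wtsum_nonneg residual_const_nonneg)

text \<open>The scheme is compared with the corrected truncation; the corrector is returned to the
  error only at the end, at the cost of a term of order N^(-r).\<close>

theorem scheme_error:
  fixes a c :: "nat \<Rightarrow> int \<Rightarrow> complex" and dt :: real
  assumes N: "0 < N" and dt: "0 \<le> dt" and r: "4 \<le> r" and B: "0 \<le> B1" "0 \<le> B3"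
    and a: "\<And>m. m \<le> M \<Longrightarrow> decays r B (a m)" "\<And>m k. m \<le> M \<Longrightarrow> a m (- k) = cnj (a m k)"
    and da: "\<And>m. m < M \<Longrightarrow> decays 11 (B1 * dt) (\<lambda>k. a (Suc m) k - a m k)"
    and e: "\<And>m. m < M \<Longrightarrow> decays 1 (B3 * dt ^ 3) (trapezoid_defect dt (a m) (a (Suc m)))"
    and c: "\<And>m k. m \<le> M \<Longrightarrow> k \<notin> band N \<Longrightarrow> c m k = 0" "\<And>m k. m \<le> M \<Longrightarrow> c m (- k) = cnj (c m k)"
    and init: "\<And>k. c 0 k = low N (a 0) k"
    and scheme: "\<And>m k. m < M \<Longrightarrow> k \<in> band N \<Longrightarrow> c (Suc m) k - c m k
        = of_real dt * (\<i> * of_real (omega k) * ((c m k + c (Suc m) k) / 2) + nonlin (\<lambda>k. (c m k + c (Suc m) k) / 2) k)"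
    and small: "dt * growth_const B \<le> 2"
    and m: "m \<le> M"
  shows "band_norm N (\<lambda>k. a m k - c m k) \<le> error_const r B B1 B3 (real M * dt) * (1 / real N ^ r + dt\<^sup>2)"
proof -
  let ?E = "1 / real N ^ r + dt\<^sup>2" and ?D = "growth_const B" and ?RC = "residual_const r B B1 B3"
  let ?T = "real M * dt"
  define \<theta> where "\<theta> m k = c m k - corrected N (a m) k" for m k
  have B0: "0 \<le> B" by (rule decays_nonneg[OF a(1)[of 0]]) simp
  have D0: "0 \<le> ?D" by (rule growth_const_nonneg[OF B0])
  have RC0: "0 \<le> ?RC" by (rule residual_const_nonneg[OF B0 B])
  have E0: "0 \<le> ?E" by simp
  have corr: "band_norm N (corr N (a m) (a m)) \<le> 3 * B\<^sup>2 * wtsum * ?E" if "m \<le> M" for m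
  proof -
    have "band_norm N (corr N (a m) (a m)) \<le> 3 * B\<^sup>2 * wtsum / real N ^ r"
      by (rule band_norm_corr_le[OF N a(1)[OF that]]) (use r in simp)
    also have "\<dots> = 3 * B\<^sup>2 * wtsum * (1 / real N ^ r)" by simp
    also have "\<dots> \<le> 3 * B\<^sup>2 * wtsum * ?E"
      using wtsum_nonneg by (intro mult_left_mono) auto
    finally show ?thesis .
  qed
  have step: "band_norm N (\<theta> (Suc m)) - band_norm N (\<theta> m)
      \<le> dt * ?D / 4 * (band_norm N (\<theta> m) + band_norm N (\<theta> (Suc m))) + ?RC * (dt * ?E) * sqrt wtsum"
    if m: "m < M" for m
  proof -
    define y where "y = (\<lambda>k. (corrected N (a m) k + corrected N (a (Suc m)) k) / 2)"
    define t where "t = (\<lambda>k. (\<theta> m k + \<theta> (Suc m) k) / 2)"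
    define R where "R k = corrected N (a (Suc m)) k - corrected N (a m) k
      - of_real dt * (\<i> * of_real (omega k) * y k - \<i> * of_int k / 2 * conv y y k)" for k
    have y0: "y k = 0" if "k \<notin> band N" for k
      using corrected_out[OF that] by (simp add: y_def)
    have \<theta>0: "\<theta> j k = 0" if "j \<le> M" "k \<notin> band N" for j k
      using corrected_out[OF that(2)] c(1)[OF that] by (simp add: \<theta>_def)
    have t0: "t k = 0" if "k \<notin> band N" for k
      using \<theta>0[OF _ that, of m] \<theta>0[OF _ that, of "Suc m"] m by (simp add: t_def)
    have sy: "abs_summable y" by (rule finite_support_abs_summable[of N]) (rule y0)
    have st: "abs_summable t" by (rule finite_support_abs_summable[of N]) (rule t0)
    have eq: "\<theta> (Suc m) k - \<theta> m k = of_real dt * (\<i> * of_real (omega k) * t k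
        - \<i> * of_int k / 2 * (2 * conv y t k + conv t t k)) - R k" if k: "k \<in> band N" for k
    proof -
      have v: "(\<lambda>k. (c m k + c (Suc m) k) / 2) = (\<lambda>k. y k + 1 * t k)"
        by (auto simp: y_def t_def \<theta>_def field_simps)
      then have vk: "(c m k + c (Suc m) k) / 2 = y k + t k" by (simp add: fun_eq_iff)
      have cv: "conv (\<lambda>k. y k + 1 * t k) (\<lambda>k. y k + 1 * t k) k = conv y y k + 2 * conv y t k + conv t t k"
        unfolding conv_bilinear[OF sy st sy st] conv_commute[of t y] by simp
      have "\<theta> (Suc m) k - \<theta> m k = (c (Suc m) k - c m k) - (corrected N (a (Suc m)) k - corrected N (a m) k)"
        by (simp add: \<theta>_def)
      also have "\<dots> = of_real dt * (\<i> * of_real (omega k) * (y k + t k) - \<i> * of_int k / 2 * (conv y y k + 2 * conv y t k + conv t t k))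
         - (R k + of_real dt * (\<i> * of_real (omega k) * y k - \<i> * of_int k / 2 * conv y y k))"
        unfolding scheme[OF m k] v vk nonlin_def cv by (simp add: R_def)
      finally show ?thesis by (simp add: algebra_simps)
    qed
    have "band_norm N (\<theta> (Suc m)) - band_norm N (\<theta> m)
      \<le> dt * ?D / 4 * (band_norm N (\<theta> m) + band_norm N (\<theta> (Suc m))) + band_norm N R"
    proof (rule energy_step[OF dt _ _ _ _ _ _ t_def])
      show "y k = 0" if "k \<notin> band N" for k by (rule y0[OF that])
      show "\<theta> m k = 0" if "k \<notin> band N" for k by (rule \<theta>0[OF _ that]) (use m in simp)
      show "\<theta> (Suc m) k = 0" if "k \<notin> band N" for k by (rule \<theta>0[OF _ that]) (use m in simp)
      show "\<theta> m (- k) = cnj (\<theta> m k)" "\<theta> (Suc m) (- k) = cnj (\<theta> (Suc m) k)" for k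
        using m by (simp_all add: \<theta>_def c(2) corrected_cnj a(2))
      have "(\<Sum>l\<in>band N. \<bar>of_int l\<bar> * norm (y l))
          \<le> (\<Sum>l\<in>band N. (\<bar>of_int l\<bar> * norm (corrected N (a m) l) + \<bar>of_int l\<bar> * norm (corrected N (a (Suc m)) l)) / 2)"
      proof (rule sum_mono)
        fix l
        have "norm (y l) \<le> (norm (corrected N (a m) l) + norm (corrected N (a (Suc m)) l)) / 2"
          unfolding y_def by (simp add: norm_divide norm_triangle_ineq)
        from mult_left_mono[OF this, of "\<bar>of_int l\<bar>"]
        show "\<bar>of_int l\<bar> * norm (y l) \<le> (\<bar>of_int l\<bar> * norm (corrected N (a m) l) + \<bar>of_int l\<bar> * norm (corrected N (a (Suc m)) l)) / 2"
          by (simp add: distrib_left)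
      qed
      also have "\<dots> = ((\<Sum>l\<in>band N. \<bar>of_int l\<bar> * norm (corrected N (a m) l)) + (\<Sum>l\<in>band N. \<bar>of_int l\<bar> * norm (corrected N (a (Suc m)) l))) / 2"
        by (simp add: sum.distrib flip: sum_divide_distrib)
      also have "\<dots> \<le> (?D + ?D) / 2"
        using m r by (intro divide_right_mono add_mono weighted_sum_corrected_le[OF N a(1)]) auto
      finally show "(\<Sum>l\<in>band N. \<bar>of_int l\<bar> * norm (y l)) \<le> ?D" by simp
      show "\<theta> (Suc m) k - \<theta> m k = of_real dt * (\<i> * of_real (omega k) * t k
        - \<i> * of_int k / 2 * (2 * conv y t k + conv t t k)) - R k" if "k \<in> band N" for k
        by (rule eq[OF that])
    qed
    also have "band_norm N R \<le> ?RC * (dt * ?E) * sqrt wtsum"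
    proof (rule band_norm_le_of_decay)
      show "0 \<le> ?RC * (dt * ?E)" using RC0 dt E0 by simp
      show "norm (R k) \<le> ?RC * (dt * ?E) / wt k" if "k \<in> band N" for k
        unfolding R_def by (rule residual_bound[OF N dt r _ _ _ _ B y_def that]) (use m a da e in auto)
    qed
    finally show ?thesis by simp
  qed
  \<comment> \<open>The assumption \<open>small\<close> is exactly the Gronwall condition that a
    quarter of \<open>dt * growth_const B\<close> is at most 1/2.\<close>
  have X: "band_norm N (\<theta> m) \<le> exp (4 * (dt * ?D / 4) * real m) * (band_norm N (\<theta> 0) + 2 * real m * (?RC * (dt * ?E) * sqrt wtsum))"
    by (rule discrete_gronwall[where M=M and X="\<lambda>m. band_norm N (\<theta> m)" and c="dt * ?D / 4"
          and e="?RC * (dt * ?E) * sqrt wtsum", OF step]) (use small dt D0 RC0 E0 wtsum_nonneg m in auto)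
  also have "\<dots> \<le> exp (?D * ?T) * (3 * B\<^sup>2 * wtsum * ?E + 2 * ?T * (?RC * sqrt wtsum) * ?E)"
  proof (rule mult_mono[OF _ add_mono])
    have mT: "real m * dt \<le> ?T" using m dt by (simp add: mult_right_mono)
    show "exp (4 * (dt * ?D / 4) * real m) \<le> exp (?D * ?T)"
      using mult_left_mono[OF mT D0] by (simp add: mult_ac)
    \<comment> \<open>The scheme starts from the plain truncation, so the initial error is minus the
      corrector.\<close>
    have "band_norm N (\<theta> 0) = band_norm N (corr N (a 0) (a 0))"
      by (simp add: \<theta>_def init corrected_def band_norm_def)
    then show "band_norm N (\<theta> 0) \<le> 3 * B\<^sup>2 * wtsum * ?E" using corr[of 0] by simp
    have "2 * real m * (?RC * (dt * ?E) * sqrt wtsum) = (real m * dt) * (2 * (?RC * sqrt wtsum) * ?E)"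
      by (simp only: mult_ac)
    also have "\<dots> \<le> ?T * (2 * (?RC * sqrt wtsum) * ?E)"
      using RC0 wtsum_nonneg by (intro mult_right_mono mT) auto
    finally show "2 * real m * (?RC * (dt * ?E) * sqrt wtsum) \<le> 2 * ?T * (?RC * sqrt wtsum) * ?E"
      by (simp only: mult_ac)
    show "0 \<le> band_norm N (\<theta> 0) + 2 * real m * (?RC * (dt * ?E) * sqrt wtsum)"
      using RC0 dt E0 wtsum_nonneg by (intro add_nonneg_nonneg mult_nonneg_nonneg) auto
  qed simp
  finally have Xm: "band_norm N (\<theta> m) \<le> exp (?D * ?T) * (3 * B\<^sup>2 * wtsum + 2 * ?T * (?RC * sqrt wtsum)) * ?E"
    by (simp only: distrib_right mult.assoc)
  have "band_norm N (\<lambda>k. a m k - c m k) = band_norm N (\<lambda>k. (- 1) * \<theta> m k + (- 1) * corr N (a m) (a m) k)"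
    unfolding band_norm_def by (rule L2_set_cong) (auto simp: \<theta>_def corrected_def low_def)
  also have "\<dots> \<le> band_norm N (\<theta> m) + band_norm N (corr N (a m) (a m))"
    by (rule order_trans[OF band_norm_triangle]) (simp only: band_norm_cmult, simp)
  also have "\<dots> \<le> exp (?D * ?T) * (3 * B\<^sup>2 * wtsum + 2 * ?T * (?RC * sqrt wtsum)) * ?E + 3 * B\<^sup>2 * wtsum * ?E"
    by (intro add_mono Xm corr m)
  also have "\<dots> = error_const r B B1 B3 ?T * ?E"
    by (simp only: error_const_def distrib_right)
  finally show ?thesis .
qed

text \<open>Every time derivative costs five powers of \<open>wt\<close>, so that \<open>r \<ge> 16 = 1 + 3 * 5\<close> leaves one
  power for the third derivative, which is square summable.\<close>

lemma fourier_ode_bounds: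
  fixes a :: "real \<Rightarrow> int \<Rightarrow> complex"
  assumes r: "16 \<le> r" and S: "convex S"
    and a: "\<And>t. t \<in> S \<Longrightarrow> decays r B (a t)"
    and ode: "\<And>t k. t \<in> S \<Longrightarrow> ((\<lambda>s. a s k) has_vector_derivative
                (\<i> * of_real (omega k) * a t k + nonlin (a t) k)) (at t within S)"
  obtains B1 B3 where "0 \<le> B1" "0 \<le> B3"
    and "\<And>t h. 0 \<le> h \<Longrightarrow> {t..t + h} \<subseteq> S \<Longrightarrow> decays 11 (B1 * h) (\<lambda>k. a (t + h) k - a t k)"
    and "\<And>t h. 0 \<le> h \<Longrightarrow> {t..t + h} \<subseteq> S \<Longrightarrow> decays 1 (B3 * h ^ 3) (trapezoid_defect h (a t) (a (t + h)))"
proof -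
  define m :: "int \<Rightarrow> complex" where "m k = \<i> * of_real (omega k)" for k
  define n :: "int \<Rightarrow> complex" where "n k = - (\<i> * of_int k / 2)" for k
  have m: "norm (m k) \<le> 2 * wt k ^ 5" for k
    using norm_omega_le[of k] by (simp add: m_def norm_mult)
  have n: "norm (n k) \<le> 1 * wt k ^ 1" for k
    by (simp add: n_def norm_mult norm_divide wt_def)
  define v where "v t k = m k * a t k + n k * conv (a t) (a t) k" for t k
  define cv where "cv t k = conv (v t) (a t) k + conv (a t) (v t) k" for t k
  define v' where "v' t k = m k * v t k + n k * cv t k" for t k
  define cv' where "cv' t k = (conv (v' t) (a t) k + conv (v t) (v t) k) + (conv (v t) (v t) k + conv (a t) (v' t) k)" for t k
  define v'' where "v'' t k = m k * v' t k + n k * cv' t k" for t k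
  have a16: "decays 16 B (a t)" if "t \<in> S" for t
    by (rule decays_mono[OF a[OF that] r order_refl])
  have lift: "decays s C f \<Longrightarrow> s' \<le> s \<Longrightarrow> decays s' C f" for s s' C f
    by (rule decays_mono) auto
  obtain V where V: "\<And>t. t \<in> S \<Longrightarrow> decays 11 V (v t)"
  proof
    fix t assume "t \<in> S"
    note at = a16[OF this]
    \<comment> \<open>Order 11 = 16 - 5 for the dispersive term, whose symbol is at most 2 wt^5. The
      quadratic term is convolved at order 12, since the derivative in front takes one order
      back.\<close>
    show "decays 11 (2 * B + 1 * (2 ^ (12 + 1) * wtsum * B * B)) (v t)"
      unfolding v_def
      by (intro decays_add decays_multiplier[OF _ m] decays_multiplier[OF _ n])
         (use lift[OF at] decays_conv[OF lift[OF at, of 12] lift[OF at, of 12]] in simp_all)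
  qed
  obtain V' where V': "\<And>t. t \<in> S \<Longrightarrow> decays 6 V' (v' t)"
  proof
    fix t assume t: "t \<in> S"
    note at = a16[OF t] and vt = V[OF t]
    \<comment> \<open>Here 7 = 6 + 1: the convolution keeps one extra order for the derivative in
      front of it.\<close>
    have "decays 7 (2 ^ (7 + 1) * wtsum * V * B + 2 ^ (7 + 1) * wtsum * B * V) (cv t)"
      unfolding cv_def by (intro decays_add decays_conv lift[OF at] lift[OF vt]) simp_all
    then show "decays 6 (2 * V + 1 * (2 ^ (7 + 1) * wtsum * V * B + 2 ^ (7 + 1) * wtsum * B * V)) (v' t)"
      unfolding v'_def
      by (intro decays_add decays_multiplier[OF _ m] decays_multiplier[OF _ n]) (use vt in simp_all)
  qed
  obtain V'' where V'': "\<And>t. t \<in> S \<Longrightarrow> decays 1 V'' (v'' t)"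
  proof
    fix t assume t: "t \<in> S"
    note at = a16[OF t] and vt = V[OF t] and vt' = V'[OF t]
    \<comment> \<open>Order 2 is the least that \<open>decays_conv\<close> accepts; the derivative
      then leaves order 1, the same as 6 - 5 from the dispersive term.\<close>
    have "decays 2 ((2 ^ (2 + 1) * wtsum * V' * B + 2 ^ (2 + 1) * wtsum * V * V) + (2 ^ (2 + 1) * wtsum * V * V + 2 ^ (2 + 1) * wtsum * B * V')) (cv' t)"
      unfolding cv'_def by (intro decays_add decays_conv lift[OF at] lift[OF vt] lift[OF vt']) simp_all
    then show "decays 1 (2 * V' + 1 * ((2 ^ (2 + 1) * wtsum * V' * B + 2 ^ (2 + 1) * wtsum * V * V) + (2 ^ (2 + 1) * wtsum * V * V + 2 ^ (2 + 1) * wtsum * B * V'))) (v'' t)"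
      unfolding v''_def
      by (intro decays_add decays_multiplier[OF _ m] decays_multiplier[OF _ n]) (use vt' in \<open>simp_all add: numeral_eq_Suc\<close>)
  qed
  have d1: "((\<lambda>s. a s k) has_vector_derivative v t k) (at t within S)" if "t \<in> S" for t k
    using ode[OF that, of k] by (simp add: v_def m_def n_def nonlin_def)
  have d2: "((\<lambda>s. v s k) has_vector_derivative v' t k) (at t within S)" if t: "t \<in> S" for t k
  proof -
    have "((\<lambda>s. conv (a s) (a s) k) has_vector_derivative cv t k) (at t within S)"
      unfolding cv_def
      by (rule conv_has_vector_derivative[OF S t d1 d1, where A=B and A'=V and B=B and B'=V])
         (auto intro: lift[OF a16] lift[OF V])
    then show ?thesis unfolding v_def v'_def
      by (intro has_vector_derivative_add has_vector_derivative_mult_right d1[OF t, unfolded v_def])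
  qed
  have d3: "((\<lambda>s. v' s k) has_vector_derivative v'' t k) (at t within S)" if t: "t \<in> S" for t k
  proof -
    have "((\<lambda>s. conv (v s) (a s) k) has_vector_derivative conv (v' t) (a t) k + conv (v t) (v t) k) (at t within S)"
      by (rule conv_has_vector_derivative[OF S t d2 d1, where A=V and A'=V' and B=B and B'=V])
         (auto intro: lift[OF a16] lift[OF V] lift[OF V'])
    moreover have "((\<lambda>s. conv (a s) (v s) k) has_vector_derivative conv (v t) (v t) k + conv (a t) (v' t) k) (at t within S)"
      by (rule conv_has_vector_derivative[OF S t d1 d2, where A=B and A'=V and B=V and B'=V'])
         (auto intro: lift[OF a16] lift[OF V] lift[OF V'])
    ultimately show ?thesis unfolding v'_def v''_def cv_def cv'_def
      by (intro has_vector_derivative_add has_vector_derivative_mult_right d2[OF t, unfolded v'_def cv_def])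
  qed
  show thesis
  \<comment> \<open>The absolute values keep the constants nonnegative even for empty
    \<open>S\<close>, where nothing is known about \<open>V\<close> and \<open>V''\<close>.\<close>
  proof (rule that[of "\<bar>V\<bar>" "\<bar>V''\<bar>"])
    fix t h :: real
    assume h: "0 \<le> h" "{t..t + h} \<subseteq> S"
    then have tS: "t \<in> S" "t + h \<in> S" by auto
    show "decays 11 (\<bar>V\<bar> * h) (\<lambda>k. a (t + h) k - a t k)"
      unfolding decays_def
    proof
      fix k
      have "norm (a (t + h) k - a t k) \<le> (V / wt k ^ 11) * \<bar>t + h - t\<bar>"
        by (rule norm_increment_le[OF S d1 _ tS(2,1)]) (auto intro: decaysD[OF V])
      also have "\<dots> \<le> \<bar>V\<bar> * h / wt k ^ 11"
        using h decays_nonneg[OF V[OF tS(1)]] by simp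
      finally show "norm (a (t + h) k - a t k) \<le> \<bar>V\<bar> * h / wt k ^ 11" .
    qed
    show "decays 1 (\<bar>V''\<bar> * h ^ 3) (trapezoid_defect h (a t) (a (t + h)))"
      unfolding decays_def
    proof
      fix k
      have "norm (a (t + h) k - a t k - of_real h * ((v t k + v (t + h) k) / 2)) \<le> V'' / wt k ^ 1 * h ^ 3"
        by (rule trapezoid_error[OF h d1 d2 d3 decaysD[OF V'']])
      also have "\<dots> \<le> \<bar>V''\<bar> * h ^ 3 / wt k ^ 1"
        using h decays_nonneg[OF V''[OF tS(1)]] by simp
      also have "a (t + h) k - a t k - of_real h * ((v t k + v (t + h) k) / 2) = trapezoid_defect h (a t) (a (t + h)) k"
        by (simp add: trapezoid_defect_def v_def m_def n_def nonlin_def field_simps)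
      finally show "norm (trapezoid_defect h (a t) (a (t + h)) k) \<le> \<bar>V''\<bar> * h ^ 3 / wt k ^ 1" .
    qed
  qed auto
qed

subsection \<open>Fourier series of integrable functions\<close>

text \<open>Serves the exact solution and the scheme alike: for coefficients supported in the band
  it is a trigonometric polynomial.\<close>

definition trig_series :: "(int \<Rightarrow> complex) \<Rightarrow> real \<Rightarrow> complex"
  where "trig_series b x = (\<Sum>\<^sub>\<infinity>l. b l * cis (of_int l * x))"

lemma finite_measure_per: "finite_measure per_measure"
  by (simp add: finite_measure_lebesgue_on)

lemma measurable_per_continuous:
  fixes f :: "real \<Rightarrow> complex"
  assumes "continuous_on {-pi..pi} f"
  shows "f \<in> borel_measurable per_measure"
  using assms by (intro continuous_imp_measurable_on_sets_lebesgue) auto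

lemma integrable_per_bounded:
  fixes f :: "real \<Rightarrow> complex"
  assumes "f \<in> borel_measurable per_measure" "\<And>x. norm (f x) \<le> B"
  shows "integrable per_measure f"
  using finite_measure.integrable_const_bound[OF finite_measure_per] assms by blast

lemma integrable_per_mult_bounded:
  fixes f h :: "real \<Rightarrow> complex"
  assumes f: "f \<in> borel_measurable per_measure" "\<And>x. norm (f x) \<le> B"
    and h: "integrable per_measure h"
  shows "integrable per_measure (\<lambda>x. f x * h x)"
proof (rule Bochner_Integration.integrable_bound)
  show "integrable per_measure (\<lambda>x. B * norm (h x))"
    using h by simp
  show "(\<lambda>x. f x * h x) \<in> borel_measurable per_measure"
    using f h by (intro borel_measurable_times) auto
  show "AE x in per_measure. norm (f x * h x) \<le> norm (B * norm (h x))"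
    using f(2) by (intro AE_I2) (auto simp: norm_mult abs_mult intro!: mult_right_mono order_trans[OF f(2) abs_ge_self])
qed

lemma continuous_cis_int [continuous_intros]:
  "continuous_on S (\<lambda>x. cis (of_int k * x))"
  by (intro continuous_intros)

lemma integrable_cis_mult:
  assumes "integrable per_measure h"
  shows "integrable per_measure (\<lambda>x. cis (of_int k * x) * h x)"
  by (rule integrable_per_mult_bounded[where B=1])
     (use assms in \<open>auto intro!: measurable_per_continuous continuous_intros\<close>)

lemma norm_trig_series_minus_partial:
  assumes "abs_summable b" "finite F"
  shows "norm (trig_series b x - (\<Sum>l\<in>F. b l * cis (of_int l * x)))
     \<le> (\<Sum>\<^sub>\<infinity>l. norm (b l)) - (\<Sum>l\<in>F. norm (b l))"
proof -
  let ?f = "\<lambda>l. b l * cis (of_int l * x)"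
  have s: "?f summable_on UNIV" 
    by (rule abs_summable_summable) (use assms in \<open>simp add: norm_mult\<close>)
  have s2: "?f summable_on (- F)" "?f summable_on F" "(\<lambda>l. norm (b l)) summable_on (-F)" "(\<lambda>l. norm (b l)) summable_on F"
    using s assms summable_on_subset_banach by blast+
  have "infsum ?f (F \<union> -F) = infsum ?f F + infsum ?f (- F)"
    by (rule infsum_Un_disjoint) (use s2 in auto)
  then have 1: "trig_series b x - (\<Sum>l\<in>F. ?f l) = infsum ?f (- F)"
    using assms(2) by (simp add: trig_series_def)
  have "infsum (\<lambda>l. norm (b l)) (F \<union> -F) = infsum (\<lambda>l. norm (b l)) F + infsum (\<lambda>l. norm (b l)) (- F)"
    by (rule infsum_Un_disjoint) (use s2 in auto)
  then have 2: "(\<Sum>\<^sub>\<infinity>l. norm (b l)) - (\<Sum>l\<in>F. norm (b l)) = (\<Sum>\<^sub>\<infinity>l\<in>-F. norm (?f l))"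
    using assms(2) by (simp add: norm_mult)
  show ?thesis unfolding 1 2
    by (rule norm_infsum_bound) (use s2 in \<open>simp add: norm_mult\<close>)
qed

lemma sum_norm_remainder_tendsto:
  fixes b :: "int \<Rightarrow> complex"
  assumes "abs_summable b"
  shows "((\<lambda>F. (\<Sum>\<^sub>\<infinity>l. norm (b l)) - (\<Sum>l\<in>F. norm (b l))) \<longlongrightarrow> 0) (finite_subsets_at_top UNIV)"
  using tendsto_diff[OF tendsto_const[of "\<Sum>\<^sub>\<infinity>l. norm (b l)"] infsum_tendsto[OF assms]] by simp

lemma continuous_trig_series:
  assumes "abs_summable b"
  shows "continuous_on S (trig_series b)"
proof -
  have "uniform_limit S (\<lambda>F x. \<Sum>l\<in>F. b l * cis (of_int l * x))
      (\<lambda>x. \<Sum>\<^sub>\<infinity>l. b l * cis (of_int l * x)) (finite_subsets_at_top UNIV)"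
    by (rule Weierstrass_m_test_general[where M="\<lambda>l. norm (b l)"]) (use assms in \<open>auto simp: norm_mult\<close>)
  then have "continuous_on S (\<lambda>x. \<Sum>\<^sub>\<infinity>l. b l * cis (of_int l * x))"
    by (rule uniform_limit_theorem[rotated]) 
       (auto intro!: continuous_intros always_eventually)
  then show ?thesis by (simp add: trig_series_def[abs_def])
qed

lemma norm_trig_series_le:
  assumes "abs_summable b"
  shows "norm (trig_series b x) \<le> (\<Sum>\<^sub>\<infinity>l. norm (b l))"
  using norm_trig_series_minus_partial[OF assms, of "{}"] by simp

text \<open>The remainder of the series is bounded by a tail of the norms uniformly in
  \<open>x\<close>, so it may be integrated against any integrable \<open>h\<close>. This is what
  later admits weak derivatives as factors.\<close>

lemma integral_trig_series_mult:
  assumes b: "abs_summable b" and h: "integrable per_measure h"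
  shows "((\<lambda>l. b l * (LINT x|per_measure. cis (of_int l * x) * h x)) has_sum
           (LINT x|per_measure. trig_series b x * h x)) UNIV"
proof -
  let ?I = "\<lambda>l. LINT x|per_measure. cis (of_int l * x) * h x"
  let ?r = "\<lambda>F. (\<Sum>\<^sub>\<infinity>l. norm (b l)) - (\<Sum>l\<in>F. norm (b l))"
  let ?H = "LINT x|per_measure. norm (h x)"
  have int1: "integrable per_measure (\<lambda>x. trig_series b x * h x)"
    by (rule integrable_per_mult_bounded[OF _ _ h])
       (use norm_trig_series_le[OF b] continuous_trig_series[OF b] in \<open>auto intro!: measurable_per_continuous\<close>)
  have bd: "norm ((\<Sum>l\<in>F. b l * ?I l) - (LINT x|per_measure. trig_series b x * h x)) \<le> ?r F * ?H"
    if F: "finite F" for F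
  proof -
    have int2: "integrable per_measure (\<lambda>x. (\<Sum>l\<in>F. b l * cis (of_int l * x)) * h x)"
    proof -
      have "integrable per_measure (\<lambda>x. \<Sum>l\<in>F. b l * (cis (of_int l * x) * h x))"
        by (intro Bochner_Integration.integrable_sum integrable_mult_right integrable_cis_mult h)
      then show ?thesis by (simp add: sum_distrib_right mult.assoc)
    qed
    have "(\<Sum>l\<in>F. b l * ?I l) = (LINT x|per_measure. (\<Sum>l\<in>F. b l * (cis (of_int l * x) * h x)))"
      by (subst Bochner_Integration.integral_sum) (auto intro!: integrable_cis_mult h)
    also have "\<dots> = (LINT x|per_measure. (\<Sum>l\<in>F. b l * cis (of_int l * x)) * h x)"
      by (simp add: sum_distrib_right mult.assoc)
    finally have "(\<Sum>l\<in>F. b l * ?I l) - (LINT x|per_measure. trig_series b x * h x)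
       = (LINT x|per_measure. ((\<Sum>l\<in>F. b l * cis (of_int l * x)) - trig_series b x) * h x)"
      by (simp add: Bochner_Integration.integral_diff[OF int2 int1, symmetric] left_diff_distrib)
    also have "norm \<dots> \<le> (LINT x|per_measure. norm (((\<Sum>l\<in>F. b l * cis (of_int l * x)) - trig_series b x) * h x))"
      by (rule integral_norm_bound)
    also have "\<dots> \<le> (LINT x|per_measure. ?r F * norm (h x))"
    proof (rule Bochner_Integration.integral_mono)
      show "integrable per_measure (\<lambda>x. norm (((\<Sum>l\<in>F. b l * cis (of_int l * x)) - trig_series b x) * h x))"
        using Bochner_Integration.integrable_diff[OF int2 int1] by (simp add: left_diff_distrib)
      show "integrable per_measure (\<lambda>x. ?r F * norm (h x))" using h by simp
      show "norm (((\<Sum>l\<in>F. b l * cis (of_int l * x)) - trig_series b x) * h x) \<le> ?r F * norm (h x)" for x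
        using norm_trig_series_minus_partial[OF b F, of x]
        by (simp add: norm_mult norm_minus_commute mult_right_mono)
    qed
    finally show ?thesis by simp
  qed
  have "((\<lambda>F. (\<Sum>l\<in>F. b l * ?I l) - (LINT x|per_measure. trig_series b x * h x)) \<longlongrightarrow> 0) (finite_subsets_at_top UNIV)"
  proof (rule Lim_null_comparison)
    show "\<forall>\<^sub>F F in finite_subsets_at_top UNIV. norm ((\<Sum>l\<in>F. b l * ?I l) - (LINT x|per_measure. trig_series b x * h x)) \<le> ?r F * ?H"
      using bd by (auto simp: eventually_finite_subsets_at_top)
    show "((\<lambda>F. ?r F * ?H) \<longlongrightarrow> 0) (finite_subsets_at_top UNIV)"
      using tendsto_mult_right[OF sum_norm_remainder_tendsto[OF b], of ?H] by simp
  qed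
  then show ?thesis
    unfolding has_sum_def by (simp add: LIM_zero_iff)
qed

lemma has_vector_derivative_cis_int:
  "((\<lambda>x. cis (of_int k * x)) has_vector_derivative (\<i> * of_int k * cis (of_int k * x))) (at x within S)"
  unfolding has_vector_derivative_def
  by (auto intro!: derivative_eq_intros simp: scaleR_conv_of_real)

lemma integral_cis:
  "(LINT x|per_measure. cis (of_int k * x)) = (if k = 0 then 2 * of_real pi else 0)"
proof (cases "k = 0")
  case True
  then show ?thesis
    by (simp add: measure_restrict_space scaleR_conv_of_real)
next
  case False
  let ?F = "\<lambda>x::real. cis (of_int k * x) / (\<i> * of_int k)"
  have d: "(?F has_vector_derivative cis (of_int k * x)) (at x within {-pi..pi})" for x
  proof -
    have "((\<lambda>x. cis (of_int k * x) * (1 / (\<i> * of_int k))) has_vector_derivative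
        (\<i> * of_int k * cis (of_int k * x)) * (1 / (\<i> * of_int k))) (at x within {-pi..pi})"
      by (intro has_vector_derivative_mult_left has_vector_derivative_cis_int)
    then show ?thesis using False by simp
  qed
  have "((\<lambda>x. cis (of_int k * x)) has_integral (?F pi - ?F (-pi))) {-pi..pi}"
    by (rule fundamental_theorem_of_calculus) (use d in auto)
  moreover have "cis (of_int k * pi) = cis (of_int k * (-pi))"
  proof -
    have "cis (of_int k * pi) = cis (of_int k * (-pi)) * cis (2 * pi * of_int k)"
      by (simp add: cis_mult algebra_simps)
    then show ?thesis by simp
  qed
  ultimately have "((\<lambda>x. cis (of_int k * x)) has_integral 0) {-pi..pi}" by simp
  moreover have "integrable per_measure (\<lambda>x. cis (of_int k * x))"
    by (rule integrable_per_bounded[where B=1]) (auto intro!: measurable_per_continuous continuous_intros)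
  ultimately show ?thesis using False
    by (simp add: lebesgue_integral_eq_integral integral_unique)
qed


section \<open>Integrable functions whose Fourier coefficients all vanish\<close>

definition coeff_free :: "(real \<Rightarrow> complex) \<Rightarrow> bool"
  where "coeff_free f \<longleftrightarrow> integrable per_measure f \<and>
           (\<forall>k::int. (LINT x|per_measure. cis (of_int k * x) * f x) = 0)"

lemma coeff_free_add:
  assumes "coeff_free f" "coeff_free g"
  shows "coeff_free (\<lambda>x. f x + g x)"
  using assms by (auto simp: coeff_free_def distrib_left integrable_cis_mult)

lemma coeff_free_mult_const:
  assumes "coeff_free f"
  shows "coeff_free (\<lambda>x. c * f x)"
proof -
  have "(LINT x|per_measure. cis (of_int k * x) * (c * f x)) = c * (LINT x|per_measure. cis (of_int k * x) * f x)" for k :: int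
    by (subst integral_mult_right_zero[symmetric]) (simp add: mult.left_commute)
  then show ?thesis
    using assms by (auto simp: coeff_free_def)
qed

lemma coeff_free_mult_cis:
  assumes "coeff_free f"
  shows "coeff_free (\<lambda>x. cis (of_int k * x) * f x)"
proof -
  have "cis (of_int j * x) * (cis (of_int k * x) * f x) = cis (of_int (j + k) * x) * f x" for j x
    by (simp add: mult.assoc[symmetric] cis_mult distrib_right)
  then have "(LINT x|per_measure. cis (of_int j * x) * (cis (of_int k * x) * f x)) = 0" for j
    using assms unfolding coeff_free_def by presburger
  then show ?thesis
    using assms by (simp add: coeff_free_def integrable_cis_mult)
qed

text \<open>On the circle a real-linear function is a combination of cis x and cis (-x), and these
  only shift Fourier indices. The induction keeps \<open>f\<close> arbitrary because a product
  multiplies by one factor after the other.\<close>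

lemma coeff_free_mult_polynomial:
  assumes "real_polynomial_function g" "coeff_free f"
  shows "coeff_free (\<lambda>x. of_real (g (cis x)) * f x)"
  using assms
proof (induction g arbitrary: f rule: real_polynomial_function.induct)
  case (linear h)
  have "h (cis x) = cos x * h 1 + sin x * h \<i>" for x
  proof -
    interpret h: bounded_linear h by fact
    have "cis x = cos x *\<^sub>R 1 + sin x *\<^sub>R \<i>"
      by (simp add: complex_eq_iff)
    then show ?thesis
      by (simp only: h.add h.scaleR) simp
  qed
  then have "of_real (h (cis x)) = of_real (cos x) * of_real (h 1) + complex_of_real (sin x) * of_real (h \<i>)" for x
    by simp
  moreover have "of_real (cos x) = (cis x + cis (- x)) / 2" "of_real (sin x) = (cis x - cis (- x)) / (2 * \<i>)" for x
    by (auto simp: complex_eq_iff)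
  ultimately have *: "complex_of_real (h (cis x)) = (cis x + cis (- x)) / 2 * of_real (h 1) + (cis x - cis (- x)) / (2 * \<i>) * of_real (h \<i>)" for x
    by presburger
  have eq: "of_real (h (cis x)) * f x =
      (h 1 / 2 + h \<i> / (2 * \<i>)) * (cis (of_int 1 * x) * f x) + (h 1 / 2 - h \<i> / (2 * \<i>)) * (cis (of_int (-1) * x) * f x)" for x
    by (subst *) (simp add: algebra_simps add_divide_distrib diff_divide_distrib)
  show ?case unfolding eq
    by (intro coeff_free_add coeff_free_mult_const coeff_free_mult_cis linear)
next
  case (const c)
  then show ?case by (intro coeff_free_mult_const)
next
  case (add g h)
  then show ?case by (simp add: distrib_right coeff_free_add)
next
  case (mult g h)
  then show ?case by (simp add: mult.assoc)
qed

lemma coeff_free_integral_circle: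
  fixes F :: "complex \<Rightarrow> real"
  assumes f: "coeff_free f" and F: "continuous_on (sphere 0 1) F"
  shows "(LINT x|per_measure. of_real (F (cis x)) * f x) = 0"
proof -
  let ?H = "LINT x|per_measure. norm (f x)"
  have fi: "integrable per_measure f" using f by (simp add: coeff_free_def)
  have c1: "continuous_on {-pi..pi} (\<lambda>x. complex_of_real (F (cis x)))"
    by (intro continuous_intros continuous_on_compose2[OF F]) auto
  obtain B where "\<forall>w\<in>F ` sphere 0 1. norm w \<le> B"
    using compact_imp_bounded[OF compact_continuous_image[OF F]] unfolding bounded_iff by auto
  then have B: "\<bar>F z\<bar> \<le> B" if "z \<in> sphere 0 1" for z
    using that by auto
  have i1: "integrable per_measure (\<lambda>x. of_real (F (cis x)) * f x)"
    by (rule integrable_per_mult_bounded[OF measurable_per_continuous[OF c1] _ fi, of B]) (auto intro!: B)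
  have "norm (LINT x|per_measure. of_real (F (cis x)) * f x) \<le> e * ?H" if "e > 0" for e
  proof -
    obtain g where g: "real_polynomial_function g" "\<And>z. z \<in> sphere 0 1 \<Longrightarrow> \<bar>F z - g z\<bar> < e"
      using Stone_Weierstrass_real_polynomial_function[OF compact_sphere F \<open>e > 0\<close>] by metis
    have cf: "coeff_free (\<lambda>x. of_real (g (cis x)) * f x)"
      by (rule coeff_free_mult_polynomial[OF g(1) f])
    then have i2: "integrable per_measure (\<lambda>x. of_real (g (cis x)) * f x)"
      and z': "(LINT x|per_measure. cis (of_int 0 * x) * (of_real (g (cis x)) * f x)) = 0"
      unfolding coeff_free_def by blast+
    from z' have z: "(LINT x|per_measure. of_real (g (cis x)) * f x) = 0" by simp
    have "(LINT x|per_measure. of_real (F (cis x)) * f x) = (LINT x|per_measure. of_real (F (cis x) - g (cis x)) * f x)"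
      using Bochner_Integration.integral_diff[OF i1 i2] z by (simp add: left_diff_distrib)
    also have "norm \<dots> \<le> (LINT x|per_measure. norm (of_real (F (cis x) - g (cis x)) * f x))"
      by (rule integral_norm_bound)
    also have "\<dots> \<le> (LINT x|per_measure. e * norm (f x))"
    proof (rule Bochner_Integration.integral_mono)
      show "integrable per_measure (\<lambda>x. norm (of_real (F (cis x) - g (cis x)) * f x))"
        using Bochner_Integration.integrable_diff[OF i1 i2] by (simp add: left_diff_distrib)
      show "integrable per_measure (\<lambda>x. e * norm (f x))" using fi by simp
      show "norm (of_real (F (cis x) - g (cis x)) * f x) \<le> e * norm (f x)" for x
        using g(2)[of "cis x"] by (simp add: norm_mult mult_right_mono del: of_real_diff)
    qed
    finally show ?thesis by simp
  qed
  moreover have H0: "?H \<ge> 0" by simp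
  ultimately have "norm (LINT x|per_measure. of_real (F (cis x)) * f x) \<le> 0 + e" if "e > 0" for e
  proof -
    \<comment> \<open>Adding 1 avoids a division by zero when \<open>f\<close> vanishes almost
      everywhere.\<close>
    have "e / (?H + 1) > 0" by (rule divide_pos_pos[OF that add_nonneg_pos[OF H0 zero_less_one]])
    then have "norm (LINT x|per_measure. of_real (F (cis x)) * f x) \<le> e / (?H + 1) * ?H"
      using \<open>\<And>e. e > 0 \<Longrightarrow> norm (LINT x|per_measure. of_real (F (cis x)) * f x) \<le> e * ?H\<close> by blast
    also have "\<dots> \<le> e"
    proof -
      have "e * ?H \<le> e * (?H + 1)" using that by (intro mult_left_mono) auto
      then show ?thesis using H0 by (subst times_divide_eq_left, subst pos_divide_le_eq) linarith+
    qed
    finally show ?thesis by simp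
  qed
  then have "norm (LINT x|per_measure. of_real (F (cis x)) * f x) \<le> 0"
    by (rule field_le_epsilon)
  then show ?thesis by simp
qed

text \<open>\<open>Arg\<close> transports \<open>h\<close> to the circle. Its values lie in (-pi,
  pi], so at x = -pi the transported function takes the value of \<open>h\<close> at pi; equality of
  the endpoint values repairs this.\<close>

lemma coeff_free_integral_real:
  fixes h :: "real \<Rightarrow> real"
  assumes f: "coeff_free f" and h: "continuous_on {-pi..pi} h" "h (-pi) = h pi"
  shows "(LINT x|per_measure. of_real (h x) * f x) = 0"
proof -
  define F where "F = (\<lambda>z. h (Arg z))"
  have Fc: "F (cis x) = h x" if "x \<in> {-pi..pi}" for x
  proof (cases "x = -pi")
    case True
    have "cis (- pi) = cis pi" by (simp add: cis.ctr)
    then have "Arg (cis x) = pi" unfolding True using Arg_cis[of pi] by simp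
    then show ?thesis using True h by (simp add: F_def)
  next
    case False
    then show ?thesis using that by (simp add: F_def Arg_cis)
  qed
  have img: "cis ` {-pi..pi} = sphere 0 1"
  proof
    show "sphere 0 1 \<subseteq> cis ` {-pi..pi}"
    proof
      fix z :: complex assume "z \<in> sphere 0 1"
      then have "z = cis (Arg z)" by (subst cis_Arg) (auto simp: sgn_div_norm)
      then show "z \<in> cis ` {-pi..pi}" using Arg_bounded[of z] by (metis atLeastAtMost_iff imageI less_imp_le)
    qed
  qed auto
  \<comment> \<open>\<open>Arg\<close> jumps at -1, so composition does not give continuity.
    Instead, preimages of closed sets under \<open>F\<close> are images of compact sets under
    \<open>cis\<close>.\<close>
  have "continuous_on (sphere 0 1) F"
    unfolding continuous_on_closed_vimage[OF closed_sphere]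
  proof (intro allI impI)
    fix C :: "real set" assume C: "closed C"
    have "F -` C \<inter> sphere 0 1 = cis ` (h -` C \<inter> {-pi..pi})"
      unfolding img[symmetric] using Fc by (auto simp: image_iff)
    moreover have "compact (h -` C \<inter> {-pi..pi})"
      using continuous_closed_preimage[OF h(1) _ C] 
      by (simp add: C compact_eq_bounded_closed Int_commute bounded_Int)
    then have "compact (cis ` (h -` C \<inter> {-pi..pi}))"
      by (intro compact_continuous_image continuous_intros)
    ultimately show "closed (F -` C \<inter> sphere 0 1)"
      by (simp add: compact_imp_closed)
  qed
  from coeff_free_integral_circle[OF f this]
  have "(LINT x|per_measure. of_real (F (cis x)) * f x) = 0" .
  moreover have "(LINT x|per_measure. of_real (F (cis x)) * f x) = (LINT x|per_measure. of_real (h x) * f x)"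
    by (rule Bochner_Integration.integral_cong) (auto simp: Fc)
  ultimately show ?thesis by simp
qed

lemma coeff_free_integral_complex:
  fixes h :: "real \<Rightarrow> complex"
  assumes f: "coeff_free f" and h: "continuous_on {-pi..pi} h" "h (-pi) = h pi"
  shows "(LINT x|per_measure. h x * f x) = 0"
proof -
  have fi: "integrable per_measure f" using f by (simp add: coeff_free_def)
  have int: "integrable per_measure (\<lambda>x. of_real (g x) * f x)" 
    if g: "continuous_on {-pi..pi} g" for g :: "real \<Rightarrow> real"
  proof -
    obtain B where "\<forall>w\<in>g ` {-pi..pi}. norm w \<le> B"
      using compact_imp_bounded[OF compact_continuous_image[OF g]] unfolding bounded_iff by auto
    then have B: "norm (g x) \<le> B" if "x \<in> {-pi..pi}" for x
      using that by auto
    \<comment> \<open>\<open>integrable_per_mult_bounded\<close> asks for a bound on the whole line,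
      so \<open>g\<close> is cut off outside the interval.\<close>
    have "integrable per_measure (\<lambda>x. of_real (if x \<in> {-pi..pi} then g x else 0) * f x)"
    proof (rule integrable_per_mult_bounded[OF _ _ fi])
      show "norm (complex_of_real (if x \<in> {-pi..pi} then g x else 0)) \<le> \<bar>B\<bar>" for x
        using B by force
      have "continuous_on {-pi..pi} (\<lambda>x. complex_of_real (if x \<in> {-pi..pi} then g x else 0))"
        by (rule continuous_on_eq[OF continuous_on_of_real[OF g]]) auto
      then show "(\<lambda>x. complex_of_real (if x \<in> {-pi..pi} then g x else 0)) \<in> borel_measurable per_measure"
        by (rule measurable_per_continuous)
    qed
    then show ?thesis
      by (rule Bochner_Integration.integrable_cong[THEN iffD1, rotated 2]) auto
  qed
  have "h x * f x = of_real (Re (h x)) * f x + \<i> * (of_real (Im (h x)) * f x)" for x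
    by (metis complex_eq distrib_right mult.assoc)
  then have "(LINT x|per_measure. h x * f x) = (LINT x|per_measure. of_real (Re (h x)) * f x + \<i> * (of_real (Im (h x)) * f x))"
    by simp
  also have "\<dots> = (LINT x|per_measure. of_real (Re (h x)) * f x) + \<i> * (LINT x|per_measure. of_real (Im (h x)) * f x)"
    by (subst Bochner_Integration.integral_add) (auto intro!: int continuous_intros h)
  also have "\<dots> = 0"
    by (subst (1 2) coeff_free_integral_real[OF f]) (use h in \<open>auto intro!: continuous_intros\<close>)
  finally show ?thesis .
qed

theorem coeff_free_imp_AE_zero:
  assumes f: "coeff_free f"
  shows "AE x in per_measure. f x = 0"
proof -
  have fi: "integrable per_measure f" using f by (simp add: coeff_free_def)
  have fm: "f \<in> borel_measurable per_measure" using fi by auto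
  have "f measurable_on {-pi..pi}"
    using fm by (subst measurable_on_iff_borel_measurable) auto
  then obtain E g where E: "negligible E" and gc: "\<And>n. continuous_on UNIV (g n)"
    and gl: "\<And>x. x \<notin> E \<Longrightarrow> (\<lambda>n. g n x) \<longlonglongrightarrow> (if x \<in> {-pi..pi} then f x else 0)"
    unfolding measurable_on_def by blast
  let ?E = "E \<union> {-pi, pi}"
  have E': "negligible ?E" using E by (simp add: negligible_Un)
  have AE_E: "AE x in per_measure. x \<notin> ?E"
  proof -
    have "AE x in lebesgue. x \<notin> ?E"
      by (rule AE_not_in) (use E' negligible_iff_null_sets in blast)
    then have "AE x in lebesgue. x \<in> {-pi..pi} \<longrightarrow> x \<notin> ?E"
      by (rule eventually_mono) blast
    then show ?thesis by (subst AE_restrict_space_iff) auto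
  qed
  \<comment> \<open>A cutoff vanishing at both endpoints, which gives \<open>h\<close> equal
    endpoint values; at interior points it is eventually 1.\<close>
  define \<psi> where "\<psi> n x = min 1 (real n * (pi - \<bar>x\<bar>))" for n x
  \<comment> \<open>Dividing by the maximum of 1 and |g| rather than by |g| keeps the quotient
    continuous at zeros of \<open>g\<close> and still bounded by 1.\<close>
  define h where "h n x = of_real (\<psi> n x) * (cnj (g n x) / of_real (max 1 (norm (g n x))))" for n x
  let ?G = "\<lambda>x. cnj (f x) / of_real (max 1 (norm (f x))) * f x"
  have hc: "continuous_on {-pi..pi} (h n)" for n
    unfolding h_def \<psi>_def 
    by (intro continuous_intros continuous_on_subset[OF gc]) (auto simp: max_def)
  have hb: "norm (h n x) \<le> 1" if "x \<in> {-pi..pi}" for n x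
  proof -
    have "real n * (pi - \<bar>x\<bar>) \<ge> 0" using that by (intro mult_nonneg_nonneg) auto
    then have 1: "\<bar>\<psi> n x\<bar> \<le> 1" unfolding \<psi>_def by linarith
    have 2: "norm (cnj (g n x) / of_real (max 1 (norm (g n x)))) \<le> 1"
      by (simp add: norm_divide)
    show ?thesis unfolding h_def norm_mult using mult_mono[OF 1 2] by simp
  qed
  have "(LINT x|per_measure. h n x * f x) = 0" for n
    by (rule coeff_free_integral_complex[OF f hc]) (simp add: h_def \<psi>_def)
  moreover have "(\<lambda>n. LINT x|per_measure. h n x * f x) \<longlonglongrightarrow> (LINT x|per_measure. ?G x)"
  proof (rule integral_dominated_convergence[where w="\<lambda>x. norm (f x)"])
    show "?G \<in> borel_measurable per_measure"
    proof (rule measurable_compose[OF fm])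
      show "(\<lambda>z. cnj z / complex_of_real (max 1 (norm z)) * z) \<in> borel_measurable borel"
        by (intro borel_measurable_continuous_onI continuous_intros) (auto simp: max_def)
    qed
    show "(\<lambda>x. h n x * f x) \<in> borel_measurable per_measure" for n
      by (intro borel_measurable_times fm measurable_per_continuous hc)
    show "integrable per_measure (\<lambda>x. norm (f x))" using fi by simp
    show "AE x in per_measure. norm (h n x * f x) \<le> norm (f x)" for n
      by (intro AE_I2) (auto simp: norm_mult intro!: mult_left_le_one_le hb)
    show "AE x in per_measure. (\<lambda>n. h n x * f x) \<longlonglongrightarrow> ?G x"
      using AE_E AE_space
    proof eventually_elim
      case (elim x)
      then have x: "x \<in> {-pi..pi}" "x \<noteq> pi" "x \<noteq> -pi" "x \<notin> E" by auto
      have "(\<lambda>n. g n x) \<longlonglongrightarrow> f x" using gl[of x] x by simp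
      moreover have "(\<lambda>n. \<psi> n x) \<longlonglongrightarrow> 1"
      proof (rule tendsto_eventually)
        have "pi - \<bar>x\<bar> > 0" using x by (auto simp: abs_if)
        then obtain n0 :: nat where n0: "1 < real n0 * (pi - \<bar>x\<bar>)" using reals_Archimedean3 by blast
        show "\<forall>\<^sub>F n in sequentially. \<psi> n x = 1"
          using eventually_ge_at_top[of n0]
        proof eventually_elim
          case (elim n)
          then have "real n0 * (pi - \<bar>x\<bar>) \<le> real n * (pi - \<bar>x\<bar>)"
            using \<open>pi - \<bar>x\<bar> > 0\<close> by (intro mult_right_mono) auto
          then show ?case using n0 by (simp add: \<psi>_def)
        qed
      qed
      ultimately have "(\<lambda>n. h n x * f x) \<longlonglongrightarrow> of_real 1 * (cnj (f x) / of_real (max 1 (norm (f x)))) * f x"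
        unfolding h_def by (intro tendsto_intros) (auto simp: max_def)
      then show ?case by simp
    qed
  qed
  ultimately have G0: "(LINT x|per_measure. ?G x) = 0"
    using LIMSEQ_unique[OF tendsto_const] by fastforce
  \<comment> \<open>The limit integrand is real, nonnegative, dominated by |f|, and zero only where
    \<open>f\<close> is.\<close>
  let ?K = "\<lambda>x. (norm (f x))\<^sup>2 / max 1 (norm (f x))"
  have GK: "?G x = of_real (?K x)" for x
    by (simp add: complex_norm_square[symmetric] mult.commute flip: of_real_power)
  have Ki: "integrable per_measure ?K"
  proof (rule Bochner_Integration.integrable_bound[of _ "\<lambda>x. norm (f x)"])
    show "?K \<in> borel_measurable per_measure" using fm by measurable
    show "AE x in per_measure. norm (?K x) \<le> norm (norm (f x))"
    proof (intro AE_I2)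
      fix x
      have "(norm (f x))\<^sup>2 \<le> norm (f x) * max 1 (norm (f x))"
        by (simp add: power2_eq_square mult_left_mono)
      then show "norm (?K x) \<le> norm (norm (f x))"
        by (simp add: divide_le_eq)
    qed
  qed (use fi in simp)
  have "(LINT x|per_measure. complex_of_real (?K x)) = 0"
    using G0 unfolding GK .
  then have "(LINT x|per_measure. ?K x) = 0"
    by (simp only: integral_complex_of_real of_real_eq_0_iff)
  then have "AE x in per_measure. ?K x = 0"
    using integral_nonneg_eq_0_iff_AE[OF Ki] by auto
  then show ?thesis by eventually_elim (auto simp: max_def split: if_splits)
qed

subsection \<open>Square integrable functions\<close>

lemma L2_perD:
  assumes "f \<in> L2_per"
  shows "periodic f" "f \<in> borel_measurable per_measure" "integrable per_measure (\<lambda>x. (cmod (f x))\<^sup>2)"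
  using assms by (auto simp: L2_per_def)

lemma L2_mult_integrable:
  assumes "f \<in> L2_per" "g \<in> L2_per"
  shows "integrable per_measure (\<lambda>x. f x * g x)"
proof (rule Bochner_Integration.integrable_bound)
  show "integrable per_measure (\<lambda>x. (cmod (f x))\<^sup>2 + (cmod (g x))\<^sup>2)"
    using assms by (intro Bochner_Integration.integrable_add L2_perD)
  show "(\<lambda>x. f x * g x) \<in> borel_measurable per_measure"
    using assms by (intro borel_measurable_times L2_perD)
  show "AE x in per_measure. norm (f x * g x) \<le> norm ((cmod (f x))\<^sup>2 + (cmod (g x))\<^sup>2)"
  proof (intro AE_I2)
    fix x
    have "2 * (cmod (f x) * cmod (g x)) \<le> (cmod (f x))\<^sup>2 + (cmod (g x))\<^sup>2"
      using sum_squares_bound[of "cmod (f x)" "cmod (g x)"] by simp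
    moreover have "0 \<le> cmod (f x) * cmod (g x)" by simp
    ultimately have "cmod (f x) * cmod (g x) \<le> (cmod (f x))\<^sup>2 + (cmod (g x))\<^sup>2" by linarith
    then show "norm (f x * g x) \<le> norm ((cmod (f x))\<^sup>2 + (cmod (g x))\<^sup>2)"
      by (simp add: norm_mult)
  qed
qed

lemma L2_of_bounded:
  assumes "periodic f" "f \<in> borel_measurable per_measure" "\<And>x. norm (f x) \<le> B"
  shows "f \<in> L2_per"
proof -
  have "integrable per_measure (\<lambda>x. (cmod (f x))\<^sup>2)"
  proof (rule finite_measure.integrable_const_bound[OF finite_measure_per])
    show "AE x in per_measure. norm ((cmod (f x))\<^sup>2) \<le> B\<^sup>2"
      using assms(3) by (auto intro!: AE_I2 power_mono)
    show "(\<lambda>x. (cmod (f x))\<^sup>2) \<in> borel_measurable per_measure"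
      using assms(2) by measurable
  qed
  with assms show ?thesis by (simp add: L2_per_def)
qed

lemma L2_integrable:
  assumes "f \<in> L2_per"
  shows "integrable per_measure f"
proof -
  have "(\<lambda>x. 1) \<in> L2_per"
    by (rule L2_of_bounded[where B=1]) (auto simp: periodic_def)
  from L2_mult_integrable[OF this assms] show ?thesis by simp
qed

lemma L2_diff:
  assumes "f \<in> L2_per" "g \<in> L2_per"
  shows "(\<lambda>x. f x - g x) \<in> L2_per"
proof -
  have "integrable per_measure (\<lambda>x. (cmod (f x - g x))\<^sup>2)"
  proof (rule Bochner_Integration.integrable_bound)
    show "integrable per_measure (\<lambda>x. 2 * (cmod (f x))\<^sup>2 + 2 * (cmod (g x))\<^sup>2)"
      using assms by (intro Bochner_Integration.integrable_add integrable_mult_right L2_perD)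
    show "(\<lambda>x. (cmod (f x - g x))\<^sup>2) \<in> borel_measurable per_measure"
      using L2_perD(2)[OF assms(1)] L2_perD(2)[OF assms(2)] by measurable
    show "AE x in per_measure. norm ((cmod (f x - g x))\<^sup>2) \<le> norm (2 * (cmod (f x))\<^sup>2 + 2 * (cmod (g x))\<^sup>2)"
    proof (intro AE_I2)
      fix x
      have "(cmod (f x - g x))\<^sup>2 \<le> (cmod (f x) + cmod (g x))\<^sup>2"
        by (intro power_mono norm_triangle_ineq4) simp
      also have "\<dots> \<le> 2 * (cmod (f x))\<^sup>2 + 2 * (cmod (g x))\<^sup>2"
        using sum_squares_bound[of "cmod (f x)" "cmod (g x)"] by (simp add: power2_sum)
      finally show "norm ((cmod (f x - g x))\<^sup>2) \<le> norm (2 * (cmod (f x))\<^sup>2 + 2 * (cmod (g x))\<^sup>2)"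
        by simp
    qed
  qed
  with assms show ?thesis
    by (auto simp: L2_per_def periodic_def intro: borel_measurable_diff)
qed

lemma L2_divide:
  assumes "f \<in> L2_per"
  shows "(\<lambda>x. f x / c) \<in> L2_per"
proof -
  have "integrable per_measure (\<lambda>x. (cmod (f x))\<^sup>2 / (cmod c)\<^sup>2)"
    by (rule integrable_divide_zero) (use L2_perD(3)[OF assms] in simp)
  then have "integrable per_measure (\<lambda>x. (cmod (f x / c))\<^sup>2)"
    by (simp only: norm_divide power_divide)
  moreover have "(\<lambda>x. f x / c) \<in> borel_measurable per_measure"
    unfolding divide_inverse using L2_perD(2)[OF assms] by (intro borel_measurable_times) auto
  ultimately show ?thesis using L2_perD(1)[OF assms]
    by (simp add: L2_per_def periodic_def)
qed

lemma integral_cis_mult: "(LINT x|per_measure. cis (of_int k * x) * f x) = 2 * of_real pi * fourier_coeff f (- k)"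
  by (simp add: fourier_coeff_def)

lemma fourier_coeff_alt: "fourier_coeff f k = (LINT x|per_measure. cis (of_int (- k) * x) * f x) / (2 * of_real pi)"
  by (simp add: fourier_coeff_def)

lemma fourier_coeff_add:
  assumes "integrable per_measure f" "integrable per_measure g"
  shows "fourier_coeff (\<lambda>x. f x + g x) k = fourier_coeff f k + fourier_coeff g k"
  unfolding fourier_coeff_alt distrib_left
    Bochner_Integration.integral_add[OF integrable_cis_mult[OF assms(1)] integrable_cis_mult[OF assms(2)]]
  by (rule add_divide_distrib)

lemma fourier_coeff_diff:
  assumes "integrable per_measure f" "integrable per_measure g"
  shows "fourier_coeff (\<lambda>x. f x - g x) k = fourier_coeff f k - fourier_coeff g k"
  unfolding fourier_coeff_alt right_diff_distrib
    Bochner_Integration.integral_diff[OF integrable_cis_mult[OF assms(1)] integrable_cis_mult[OF assms(2)]]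
  by (rule diff_divide_distrib)

lemma fourier_coeff_divide: "fourier_coeff (\<lambda>x. f x / c) k = fourier_coeff f k / c"
  unfolding fourier_coeff_alt times_divide_eq_right integral_divide_zero by simp

lemma fourier_coeff_cong_AE:
  assumes "AE x in per_measure. f x = g x" "f \<in> borel_measurable per_measure" "g \<in> borel_measurable per_measure"
  shows "fourier_coeff f k = fourier_coeff g k"
proof -
  have m: "(\<lambda>x. cis (of_int (- k) * x)) \<in> borel_measurable per_measure"
    by (intro measurable_per_continuous continuous_intros)
  show ?thesis unfolding fourier_coeff_alt
    by (rule arg_cong2[where f="(/)"], rule integral_cong_AE)
       (use assms m in \<open>auto intro!: borel_measurable_times elim: eventually_mono\<close>)
qed

lemma fourier_coeff_cnj:
  assumes "real_valued f"
  shows "fourier_coeff f (- k) = cnj (fourier_coeff f k)"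
proof -
  have "cis (of_int k * x) * f x = cnj (cis (of_int (- k) * x) * f x)" for x
    using assms by (simp add: real_valued_def cis_cnj Reals_cnj_iff)
  then show ?thesis unfolding fourier_coeff_alt by (simp only: minus_minus Bochner_Integration.integral_cnj complex_cnj_divide) simp
qed

text \<open>The product rule for coefficients with one absolutely convergent factor; the other may
  be any integrable function, such as the weak derivative in u u_x.\<close>

lemma fourier_coeff_trig_series_mult:
  assumes b: "abs_summable b" and h: "integrable per_measure h"
  shows "fourier_coeff (\<lambda>x. trig_series b x * h x) k = conv b (fourier_coeff h) k"
proof -
  have "integrable per_measure (\<lambda>x. cis (of_int (- k) * x) * h x)" by (rule integrable_cis_mult[OF h])
  from integral_trig_series_mult[OF b this]
  have "((\<lambda>l. b l * (2 * of_real pi * fourier_coeff h (k - l))) has_sum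
      (LINT x|per_measure. trig_series b x * (cis (of_int (- k) * x) * h x))) UNIV"
    by (simp add: mult.assoc[symmetric] cis_mult distrib_right[symmetric] flip: integral_cis_mult)
       (simp add: fourier_coeff_def algebra_simps)
  then have "((\<lambda>l. b l * fourier_coeff h (k - l)) has_sum fourier_coeff (\<lambda>x. trig_series b x * h x) k) UNIV"
    using has_sum_divide_const[of _ UNIV _ "2 * complex_of_real pi"] unfolding fourier_coeff_alt
    by (fastforce simp: mult.left_commute mult.assoc)
  then show ?thesis unfolding conv_def by (simp add: infsumI)
qed

lemma integrable_trig_series:
  assumes "abs_summable b"
  shows "integrable per_measure (trig_series b)"
  by (rule integrable_per_bounded[OF measurable_per_continuous[OF continuous_trig_series[OF assms]] norm_trig_series_le[OF assms]])

lemma cis_add_period: "cis (of_int l * (x + 2 * pi)) = cis (of_int l * x)"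
  by (simp add: distrib_left mult.commute[of "of_int l" "2 * pi"] flip: cis_mult)

lemma trig_series_L2:
  assumes "abs_summable b"
  shows "trig_series b \<in> L2_per"
proof (rule L2_of_bounded)
  show "periodic (trig_series b)" by (simp add: periodic_def trig_series_def cis_add_period)
qed (use assms in \<open>auto intro: measurable_per_continuous continuous_trig_series norm_trig_series_le\<close>)

lemma fourier_coeff_trig_series:
  assumes b: "abs_summable b"
  shows "fourier_coeff (trig_series b) k = b k"
proof -
  have one: "fourier_coeff (\<lambda>x. 1) j = (if j = 0 then 1 else 0)" for j
    unfolding fourier_coeff_alt using integral_cis[of "- j"] by simp
  have "integrable per_measure (\<lambda>x. 1 :: complex)"
    by (rule integrable_per_bounded[where B=1]) auto
  from fourier_coeff_trig_series_mult[OF b this, of k]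
  have "fourier_coeff (trig_series b) k = conv b (\<lambda>j. if j = 0 then 1 else 0) k" by (simp add: one[abs_def])
  also have "\<dots> = (\<Sum>l\<in>{k}. b l * (if k - l = 0 then 1 else 0))"
    unfolding conv_def by (rule infsum_finite_support) auto
  finally show ?thesis by simp
qed

text \<open>The uniqueness theorem enters the development here. It lets a Sobolev function be
  replaced by a uniformly convergent series, both for Parseval and for the product u u_x.\<close>

lemma AE_eq_trig_series:
  assumes f: "f \<in> L2_per" and s: "abs_summable (fourier_coeff f)"
  shows "AE x in per_measure. f x = trig_series (fourier_coeff f) x"
proof -
  let ?g = "\<lambda>x. f x - trig_series (fourier_coeff f) x"
  note i = L2_integrable[OF f] integrable_trig_series[OF s]
  have "coeff_free ?g"
    unfolding coeff_free_def integral_cis_mult fourier_coeff_diff[OF i] fourier_coeff_trig_series[OF s]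
    using i by simp
  then show ?thesis using coeff_free_imp_AE_zero by fastforce
qed

text \<open>Parseval, by inserting the uniformly convergent series for one factor and integrating
  term by term against the conjugate of the other.\<close>

lemma l2_norm_eq_fourier:
  assumes f: "f \<in> L2_per" and s: "abs_summable (fourier_coeff f)"
  shows "l2_norm f = sqrt (2 * pi * (\<Sum>\<^sub>\<infinity>k. (norm (fourier_coeff f k))\<^sup>2))"
proof -
  let ?b = "fourier_coeff f"
  have fi: "integrable per_measure f" by (rule L2_integrable[OF f])
  have ci: "integrable per_measure (\<lambda>x. cnj (f x))" using fi by simp
  have "l2_inner f f = (LINT x|per_measure. trig_series ?b x * cnj (f x))"
    unfolding l2_inner_def
  proof (rule integral_cong_AE)
    show "AE x in per_measure. f x * cnj (f x) = trig_series ?b x * cnj (f x)"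
      using AE_eq_trig_series[OF f s] by (auto elim: eventually_mono)
  qed (intro borel_measurable_times borel_measurable_integrable fi ci integrable_trig_series s)+
  also have "\<dots> = (\<Sum>\<^sub>\<infinity>k. ?b k * (LINT x|per_measure. cis (of_int k * x) * cnj (f x)))"
    using integral_trig_series_mult[OF s ci] by (simp add: infsumI)
  also have "\<dots> = (\<Sum>\<^sub>\<infinity>k. complex_of_real (2 * pi * (norm (?b k))\<^sup>2))"
  proof (rule infsum_cong)
    fix k
    have "(LINT x|per_measure. cis (of_int k * x) * cnj (f x)) = (LINT x|per_measure. cnj (cis (of_int (- k) * x) * f x))"
      by (simp add: cis_cnj)
    also have "\<dots> = cnj (2 * of_real pi * ?b k)" by (simp only: Bochner_Integration.integral_cnj integral_cis_mult minus_minus)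
    finally show "?b k * (LINT x|per_measure. cis (of_int k * x) * cnj (f x)) = complex_of_real (2 * pi * (norm (?b k))\<^sup>2)"
      by (simp only: of_real_mult complex_norm_square) simp
  qed
  also have "\<dots> = complex_of_real (\<Sum>\<^sub>\<infinity>k. 2 * pi * (norm (?b k))\<^sup>2)"
  proof -
    have "abs_summable (\<lambda>k. ?b k * ?b k)"
      by (rule abs_summable_mult_bounded[OF s abs_summable_bounded[OF s]])
    then have "(\<lambda>k. 2 * pi * (norm (?b k))\<^sup>2) summable_on UNIV"
      by (intro summable_on_cmult_right) (simp add: norm_mult power2_eq_square)
    then show ?thesis by (intro infsumI has_sum_of_real has_sum_infsum)
  qed
  also have "(\<Sum>\<^sub>\<infinity>k. 2 * pi * (norm (?b k))\<^sup>2) = 2 * pi * (\<Sum>\<^sub>\<infinity>k. (norm (?b k))\<^sup>2)"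
    by (rule infsum_cmult_right')
  finally show ?thesis by (simp add: l2_norm_def)
qed

lemma l2_inner_cis: "l2_inner f (\<lambda>x. cis (of_int k * x)) = 2 * of_real pi * fourier_coeff f k"
  unfolding l2_inner_def fourier_coeff_def by (simp add: cis_cnj mult.commute)

subsection \<open>Weak derivatives\<close>

lemma Dx_eqI: "(\<And>x. (f has_vector_derivative f' x) (at x)) \<Longrightarrow> Dx f = f'"
  by (auto simp: Dx_def vector_derivative_at)

lemma Dx_funpow_cis: "(Dx ^^ n) (\<lambda>x. c * cis (of_int k * x)) = (\<lambda>x. (\<i> * of_int k) ^ n * c * cis (of_int k * x))"
proof (induction n)
  case (Suc n)
  have "Dx (\<lambda>x. (\<i> * of_int k) ^ n * c * cis (of_int k * x)) = (\<lambda>x. ((\<i> * of_int k) ^ n * c) * (\<i> * of_int k * cis (of_int k * x)))"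
    by (intro Dx_eqI has_vector_derivative_mult_right has_vector_derivative_cis_int)
  with Suc show ?case by (simp add: mult_ac)
qed simp

lemma test_function_cis: "test_function (\<lambda>x. cis (of_int k * x))"
proof -
  have "(Dx ^^ n) (\<lambda>x. 1 * cis (of_int k * x)) differentiable at x" for n x
  proof -
    have "((\<lambda>x. ((\<i> * of_int k) ^ n * 1) * cis (of_int k * x)) has_vector_derivative ((\<i> * of_int k) ^ n * 1) * (\<i> * of_int k * cis (of_int k * x))) (at x)"
      by (intro has_vector_derivative_mult_right has_vector_derivative_cis_int)
    then show ?thesis unfolding Dx_funpow_cis
      by (intro differentiableI_vector)
  qed
  then show ?thesis by (simp add: test_function_def periodic_def cis_add_period)
qed

text \<open>The test function is the mode -k. The sign (-1)^j of the weak derivative cancels the one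
  from differentiating cis (-k x).\<close>

lemma weak_deriv_fourier_coeff:
  assumes "weak_deriv j f g"
  shows "fourier_coeff g k = (\<i> * of_int k) ^ j * fourier_coeff f k"
proof -
  have "(LINT x|per_measure. f x * (Dx ^^ j) (\<lambda>x. cis (of_int (- k) * x)) x)
     = (-1) ^ j * (LINT x|per_measure. g x * cis (of_int (- k) * x))"
    using assms test_function_cis[of "- k"] unfolding weak_deriv_def by blast
  moreover have "(Dx ^^ j) (\<lambda>x. cis (of_int (- k) * x)) = (\<lambda>x. (-1) ^ j * (\<i> * of_int k) ^ j * cis (of_int (- k) * x))"
    using Dx_funpow_cis[of j 1 "- k"] by (simp add: power_minus[of "\<i> * of_int k"])
  moreover have "(LINT x|per_measure. f x * ((-1) ^ j * (\<i> * of_int k) ^ j * cis (of_int (- k) * x)))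
      = (-1) ^ j * (\<i> * of_int k) ^ j * (LINT x|per_measure. cis (of_int (- k) * x) * f x)"
    by (subst integral_mult_right_zero[symmetric]) (simp add: mult_ac)
  ultimately have "(-1) ^ j * ((\<i> * of_int k) ^ j * (LINT x|per_measure. cis (of_int (- k) * x) * f x))
     = (-1) ^ j * (LINT x|per_measure. cis (of_int (- k) * x) * g x)"
    by (simp add: mult_ac)
  then have "(\<i> * of_int k) ^ j * (LINT x|per_measure. cis (of_int (- k) * x) * f x) = (LINT x|per_measure. cis (of_int (- k) * x) * g x)"
    by (simp only: mult_cancel_left) simp
  then show ?thesis unfolding fourier_coeff_alt times_divide_eq_right by (rule arg_cong[OF sym])
qed

text \<open>Symmetrising, the derivative contributes \<open>l\<close> on one factor and
  \<open>k - l\<close> on the other, and these add up to \<open>k\<close>. This is u u_x = (u^2)_x /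
  2.\<close>

lemma conv_deriv:
  assumes "abs_summable a" "abs_summable (\<lambda>k. \<i> * of_int k * a k)"
  shows "conv a (\<lambda>k. \<i> * of_int k * a k) k = - nonlin a k"
proof -
  let ?d = "\<lambda>k. \<i> * of_int k * a k"
  have "conv a ?d k + conv ?d a k = (\<Sum>\<^sub>\<infinity>l. \<i> * of_int k * (a l * a (k - l)))"
    unfolding conv_def infsum_add[OF conv_summable[OF assms] conv_summable[OF assms(2,1)], symmetric]
    by (rule infsum_cong) (simp add: algebra_simps)
  also have "\<dots> = \<i> * of_int k * conv a a k"
    unfolding conv_def by (rule infsum_cmult_right')
  finally have "2 * conv a ?d k = \<i> * of_int k * conv a a k"
    by (simp add: conv_commute[of ?d a])
  then show ?thesis by (simp add: nonlin_def eq_divide_eq mult.commute)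
qed

subsection \<open>Sobolev spaces\<close>

lemma sobolev_spaceD:
  assumes "f \<in> sobolev_space r"
  shows "f \<in> L2_per" "(\<lambda>k. (1 + (of_int k)\<^sup>2) ^ r * (cmod (fourier_coeff f k))\<^sup>2) summable_on UNIV"
  using assms by (auto simp: sobolev_space_def)

lemma sobolev_norm_nonneg: "0 \<le> sobolev_norm r f"
  by (simp add: sobolev_norm_def infsum_nonneg)

lemma sobolev_norm_power2: "(sobolev_norm r f)\<^sup>2 = (\<Sum>\<^sub>\<infinity>k. (1 + (of_int k)\<^sup>2) ^ r * (cmod (fourier_coeff f k))\<^sup>2)"
  by (simp add: sobolev_norm_def infsum_nonneg)

lemma sobolev_weight_le:
  assumes "f \<in> sobolev_space r"
  shows "(1 + (of_int k)\<^sup>2) ^ r * (cmod (fourier_coeff f k))\<^sup>2 \<le> (sobolev_norm r f)\<^sup>2"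
  using finite_sum_le_infsum[OF sobolev_spaceD(2)[OF assms], of "{k}"] by (simp add: sobolev_norm_power2)

lemma fourier_coeff_le_sobolev_norm:
  assumes "f \<in> sobolev_space r"
  shows "cmod (fourier_coeff f k) \<le> sobolev_norm r f"
proof (rule power2_le_imp_le[OF _ sobolev_norm_nonneg])
  have "1 * (cmod (fourier_coeff f k))\<^sup>2 \<le> (1 + (of_int k)\<^sup>2) ^ r * (cmod (fourier_coeff f k))\<^sup>2"
    by (intro mult_right_mono) (auto intro: one_le_power)
  then show "(cmod (fourier_coeff f k))\<^sup>2 \<le> (sobolev_norm r f)\<^sup>2"
    using sobolev_weight_le[OF assms, of k] by simp
qed

text \<open>From (1 + |k|)^2 <= 2 (1 + k^2). The natural factor 2^(r/2) is enlarged to 2^r to avoid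
  a root.\<close>

lemma decays_fourier_coeff:
  assumes f: "f \<in> sobolev_space r"
  shows "decays r (2 ^ r * sobolev_norm r f) (fourier_coeff f)"
  unfolding decays_def
proof
  fix k
  have "(wt k)\<^sup>2 \<le> 2 * (1 + (of_int k)\<^sup>2)"
    using sum_squares_bound[of 1 "\<bar>real_of_int k\<bar>"] by (simp add: wt_def power2_sum)
  then have "((wt k)\<^sup>2) ^ r \<le> (2 * (1 + (of_int k)\<^sup>2)) ^ r" by (intro power_mono) auto
  then have "((wt k)\<^sup>2) ^ r * (cmod (fourier_coeff f k))\<^sup>2 \<le> 2 ^ r * ((1 + (of_int k)\<^sup>2) ^ r * (cmod (fourier_coeff f k))\<^sup>2)"
    unfolding power_mult_distrib mult.assoc[symmetric] by (intro mult_right_mono) auto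
  also have "\<dots> \<le> 2 ^ r * (sobolev_norm r f)\<^sup>2"
    by (intro mult_left_mono sobolev_weight_le f) auto
  also have "\<dots> \<le> (2 ^ r)\<^sup>2 * (sobolev_norm r f)\<^sup>2"
    by (intro mult_right_mono) (simp_all add: power2_eq_square)
  finally have "(wt k ^ r * cmod (fourier_coeff f k))\<^sup>2 \<le> (2 ^ r * sobolev_norm r f)\<^sup>2"
    by (simp add: power_mult_distrib power_mult[symmetric] mult.commute)
  then have "wt k ^ r * cmod (fourier_coeff f k) \<le> 2 ^ r * sobolev_norm r f"
    by (rule power2_le_imp_le) (simp add: sobolev_norm_nonneg)
  then show "cmod (fourier_coeff f k) \<le> 2 ^ r * sobolev_norm r f / wt k ^ r"
    by (simp add: le_divide_eq mult.commute)
qed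

text \<open>Summing against the Sobolev weight keeps the full N^(-r); the pointwise bound of
  \<open>decays_fourier_coeff\<close> would lose half a power of \<open>N\<close> here.\<close>

lemma sobolev_tail_le:
  assumes f: "f \<in> sobolev_space r" and N: "0 < N"
  shows "(\<Sum>\<^sub>\<infinity>k\<in>- band N. (cmod (fourier_coeff f k))\<^sup>2) \<le> (sobolev_norm r f / real N ^ r)\<^sup>2"
proof -
  let ?w = "\<lambda>k. (1 + (of_int k)\<^sup>2) ^ r * (cmod (fourier_coeff f k))\<^sup>2"
  have le: "c * (cmod (fourier_coeff f k))\<^sup>2 \<le> ?w k" if "c \<le> (1 + (real_of_int k)\<^sup>2) ^ r" for c k
    using that by (intro mult_right_mono) auto
  have su: "(\<lambda>k. (cmod (fourier_coeff f k))\<^sup>2) summable_on UNIV"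
    by (rule summable_on_comparison_test[OF sobolev_spaceD(2)[OF f]])
       (use le[of 1] in \<open>auto simp: one_le_power\<close>)
  have N0: "0 < (real N ^ r)\<^sup>2" using N by simp
  have "(real N ^ r)\<^sup>2 * (\<Sum>\<^sub>\<infinity>k\<in>- band N. (cmod (fourier_coeff f k))\<^sup>2) = (\<Sum>\<^sub>\<infinity>k\<in>- band N. (real N ^ r)\<^sup>2 * (cmod (fourier_coeff f k))\<^sup>2)"
    by (rule infsum_cmult_right'[symmetric])
  also have "\<dots> \<le> (\<Sum>\<^sub>\<infinity>k. ?w k)"
  proof (rule infsum_mono_neutral)
    show "(\<lambda>k. (real N ^ r)\<^sup>2 * (cmod (fourier_coeff f k))\<^sup>2) summable_on - band N"
      by (intro summable_on_cmult_right summable_on_subset_banach[OF su]) auto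
    show "(real N ^ r)\<^sup>2 * (cmod (fourier_coeff f k))\<^sup>2 \<le> ?w k" if "k \<in> - band N \<inter> UNIV" for k
    proof (rule le)
      have "real N \<le> \<bar>real_of_int k\<bar>" using that by auto
      then have "(real N)\<^sup>2 \<le> \<bar>real_of_int k\<bar>\<^sup>2" by (intro power_mono) auto
      then have "(real N)\<^sup>2 \<le> 1 + (real_of_int k)\<^sup>2" by simp
      then have "((real N)\<^sup>2) ^ r \<le> (1 + (real_of_int k)\<^sup>2) ^ r" by (intro power_mono) auto
      then show "(real N ^ r)\<^sup>2 \<le> (1 + (real_of_int k)\<^sup>2) ^ r" by (simp add: power_mult[symmetric] mult.commute)
    qed
  qed (use sobolev_spaceD(2)[OF f] in auto)
  finally show "(\<Sum>\<^sub>\<infinity>k\<in>- band N. (cmod (fourier_coeff f k))\<^sup>2) \<le> (sobolev_norm r f / real N ^ r)\<^sup>2"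
    using N0 unfolding sobolev_norm_power2[symmetric] power_divide by (simp add: le_divide_eq mult.commute)
qed

text \<open>The second part stands in for the triangle inequality: it is proved mode by mode, and
  the factor 2 is harmless for boundedness.\<close>

lemma sobolev_combination:
  assumes f: "f \<in> sobolev_space r" and g: "g \<in> sobolev_space r"
  shows "(\<lambda>x. f x - g x) \<in> sobolev_space r"
    and "(sobolev_norm r f)\<^sup>2 \<le> 2 * (sobolev_norm r (\<lambda>x. f x - g x))\<^sup>2 + 2 * (sobolev_norm r g)\<^sup>2"
proof -
  let ?w = "\<lambda>f k. (1 + (of_int k)\<^sup>2) ^ r * (cmod (fourier_coeff f k))\<^sup>2"
  note sf = sobolev_spaceD[OF f] and sg = sobolev_spaceD[OF g]
  have sq: "(x - y)\<^sup>2 \<le> 2 * x\<^sup>2 + 2 * y\<^sup>2" "(x + y)\<^sup>2 \<le> 2 * x\<^sup>2 + 2 * y\<^sup>2" for x y :: real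
    using sum_squares_bound[of x y] sum_squares_bound[of x "- y"] by (auto simp: power2_sum power2_diff)
  have d: "fourier_coeff (\<lambda>x. f x - g x) k = fourier_coeff f k - fourier_coeff g k" for k
    by (intro fourier_coeff_diff L2_integrable sf sg)
  have le1: "?w (\<lambda>x. f x - g x) k \<le> 2 * ?w f k + 2 * ?w g k" for k
  proof -
    have "(cmod (fourier_coeff f k - fourier_coeff g k))\<^sup>2 \<le> (cmod (fourier_coeff f k) + cmod (fourier_coeff g k))\<^sup>2"
      by (intro power_mono norm_triangle_ineq4) simp
    also have "\<dots> \<le> 2 * (cmod (fourier_coeff f k))\<^sup>2 + 2 * (cmod (fourier_coeff g k))\<^sup>2" by (rule sq)
    finally have "?w (\<lambda>x. f x - g x) k \<le> (1 + (of_int k)\<^sup>2) ^ r * (2 * (cmod (fourier_coeff f k))\<^sup>2 + 2 * (cmod (fourier_coeff g k))\<^sup>2)"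
      unfolding d by (intro mult_left_mono) auto
    then show ?thesis by (simp add: algebra_simps)
  qed
  have s2: "(\<lambda>k. 2 * ?w f k + 2 * ?w g k) summable_on UNIV"
    by (intro summable_on_add summable_on_cmult_right sf sg)
  have sd: "?w (\<lambda>x. f x - g x) summable_on UNIV"
    by (rule summable_on_comparison_test[OF s2]) (use le1 in auto)
  then show "(\<lambda>x. f x - g x) \<in> sobolev_space r"
    using L2_diff[OF sf(1) sg(1)] by (simp add: sobolev_space_def)
  have le2: "?w f k \<le> 2 * ?w (\<lambda>x. f x - g x) k + 2 * ?w g k" for k
  proof -
    have "(cmod (fourier_coeff f k))\<^sup>2 \<le> (cmod (fourier_coeff f k - fourier_coeff g k) + cmod (fourier_coeff g k))\<^sup>2"
      by (intro power_mono) (use norm_triangle_ineq[of "fourier_coeff f k - fourier_coeff g k" "fourier_coeff g k"] in auto)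
    also have "\<dots> \<le> 2 * (cmod (fourier_coeff f k - fourier_coeff g k))\<^sup>2 + 2 * (cmod (fourier_coeff g k))\<^sup>2" by (rule sq)
    finally have "?w f k \<le> (1 + (of_int k)\<^sup>2) ^ r * (2 * (cmod (fourier_coeff f k - fourier_coeff g k))\<^sup>2 + 2 * (cmod (fourier_coeff g k))\<^sup>2)"
      by (intro mult_left_mono) auto
    then show ?thesis unfolding d by (simp add: algebra_simps)
  qed
  have "(\<Sum>\<^sub>\<infinity>k. ?w f k) \<le> (\<Sum>\<^sub>\<infinity>k. 2 * ?w (\<lambda>x. f x - g x) k + 2 * ?w g k)"
    by (intro infsum_mono sf(2) summable_on_add summable_on_cmult_right sd sg(2) le2)
  also have "\<dots> = 2 * (\<Sum>\<^sub>\<infinity>k. ?w (\<lambda>x. f x - g x) k) + 2 * (\<Sum>\<^sub>\<infinity>k. ?w g k)"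
    by (subst infsum_add) (auto intro!: summable_on_cmult_right sd sg(2) simp: infsum_cmult_right')
  finally show "(sobolev_norm r f)\<^sup>2 \<le> 2 * (sobolev_norm r (\<lambda>x. f x - g x))\<^sup>2 + 2 * (sobolev_norm r g)\<^sup>2"
    unfolding sobolev_norm_power2 .
qed

lemma sobolev_divide:
  assumes "f \<in> sobolev_space r"
  shows "(\<lambda>x. f x / c) \<in> sobolev_space r"
proof -
  have "(\<lambda>k. (1 / (cmod c)\<^sup>2) * ((1 + (of_int k)\<^sup>2) ^ r * (cmod (fourier_coeff f k))\<^sup>2)) summable_on UNIV"
    by (intro summable_on_cmult_right sobolev_spaceD assms)
  then show ?thesis using L2_divide[OF sobolev_spaceD(1)[OF assms]]
    by (simp add: sobolev_space_def fourier_coeff_divide norm_divide power_divide)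
qed

text \<open>\<open>C0_sobolev\<close> speaks of norms of differences, not of a map into a
  topological space, so boundedness on [0, T] comes from bisection rather than from compactness of
  an image.\<close>

lemma C0_sobolev_bounded:
  assumes u: "C0_sobolev r u" and T: "0 \<le> T"
  obtains B where "0 \<le> B" "\<And>t. t \<in> {0..T} \<Longrightarrow> sobolev_norm r (u t) \<le> B"
proof -
  have us: "u t \<in> sobolev_space r" if "0 \<le> t" for t using u that by (simp add: C0_sobolev_def)
  \<comment> \<open>Intervals around a point near 0 may reach to its left, where nothing is known
    about \<open>u\<close>; hence the clause 0 <= s.\<close>
  define P where "P a b \<longleftrightarrow> (\<exists>B. \<forall>s. a \<le> s \<and> s \<le> b \<and> 0 \<le> s \<longrightarrow> (sobolev_norm r (u s))\<^sup>2 \<le> B)" for a b :: real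
  have "P 0 T" using T
  proof (induction rule: Bolzano)
    case (trans a b c)
    then obtain B1 B2 where B: "\<And>s. a \<le> s \<and> s \<le> b \<and> 0 \<le> s \<Longrightarrow> (sobolev_norm r (u s))\<^sup>2 \<le> B1"
       "\<And>s. b \<le> s \<and> s \<le> c \<and> 0 \<le> s \<Longrightarrow> (sobolev_norm r (u s))\<^sup>2 \<le> B2" unfolding P_def by blast
    have "(sobolev_norm r (u s))\<^sup>2 \<le> max B1 B2" if "a \<le> s \<and> s \<le> c \<and> 0 \<le> s" for s
      using B[of s] that by (cases "s \<le> b") (auto simp: le_max_iff_disj)
    then show ?case unfolding P_def by blast
  next
    case (local t)
    have "((\<lambda>s. sobolev_norm r (\<lambda>x. u s x - u t x)) \<longlongrightarrow> 0) (at t within {0..})"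
      using u local by (simp add: C0_sobolev_def)
    then have "\<forall>\<^sub>F s in at t within {0..}. sobolev_norm r (\<lambda>x. u s x - u t x) < 1"
      by (rule order_tendstoD) simp
    then obtain d where d: "d > 0" "\<And>s. s \<in> {0..} \<Longrightarrow> s \<noteq> t \<Longrightarrow> dist s t < d \<Longrightarrow> sobolev_norm r (\<lambda>x. u s x - u t x) < 1"
      unfolding eventually_at by auto
    have bd: "(sobolev_norm r (u s))\<^sup>2 \<le> 2 + 2 * (sobolev_norm r (u t))\<^sup>2" if s: "0 \<le> s" "dist s t < d" for s
    proof (cases "s = t")
      case True
      have "0 \<le> (sobolev_norm r (u t))\<^sup>2" by simp
      then show ?thesis unfolding True by linarith
    next
      case False
      then have "(sobolev_norm r (\<lambda>x. u s x - u t x))\<^sup>2 \<le> 1\<^sup>2"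
        using d(2)[of s] s by (intro power_mono) (auto simp: sobolev_norm_nonneg)
      then show ?thesis using sobolev_combination(2)[OF us[OF s(1)] us[of t]] local by simp
    qed
    have "P a b" if "a \<le> t \<and> t \<le> b \<and> b - a < d" for a b
      unfolding P_def
    proof (intro exI allI impI)
      fix s assume "a \<le> s \<and> s \<le> b \<and> 0 \<le> s"
      then show "(sobolev_norm r (u s))\<^sup>2 \<le> 2 + 2 * (sobolev_norm r (u t))\<^sup>2"
        using that by (intro bd) (auto simp: dist_real_def)
    qed
    then show ?case using d(1) by blast
  qed
  then obtain B where B: "\<And>s. s \<in> {0..T} \<Longrightarrow> (sobolev_norm r (u s))\<^sup>2 \<le> B" unfolding P_def by auto
  show thesis
  proof (rule that[of "sqrt \<bar>B\<bar>"])
    show "sobolev_norm r (u t) \<le> sqrt \<bar>B\<bar>" if "t \<in> {0..T}" for t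
      using B[OF that] by (intro real_le_rsqrt) auto
  qed simp
qed

text \<open>A single coefficient is bounded by the Sobolev norm, so convergence of the difference
  quotients in that norm passes to every mode.\<close>

lemma fourier_coeff_time_derivative:
  assumes uv: "C1_sobolev_deriv r u v" and t: "0 \<le> t"
  shows "((\<lambda>s. fourier_coeff (u s) k) has_vector_derivative fourier_coeff (v t) k) (at t within {0..})"
  unfolding has_vector_derivative_quotient
proof -
  have us: "u s \<in> sobolev_space r" if "0 \<le> s" for s using uv that by (simp add: C1_sobolev_deriv_def C0_sobolev_def)
  have vt: "v t \<in> sobolev_space r" using uv t by (simp add: C1_sobolev_deriv_def C0_sobolev_def)
  let ?q = "\<lambda>s x. (u s x - u t x) / of_real (s - t) - v t x"
  have lim: "((\<lambda>s. sobolev_norm r (?q s)) \<longlongrightarrow> 0) (at t within {0..})"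
    using uv t by (simp add: C1_sobolev_deriv_def)
  have bd: "cmod ((fourier_coeff (u s) k - fourier_coeff (u t) k) / of_real (s - t) - fourier_coeff (v t) k) \<le> sobolev_norm r (?q s)"
    if s: "0 \<le> s" for s
  proof -
    note d = sobolev_combination(1)[OF us[OF s] us[OF t]]
    note dd = sobolev_divide[OF d, of "of_real (s - t)"]
    have "fourier_coeff (?q s) k = fourier_coeff (\<lambda>x. (u s x - u t x) / of_real (s - t)) k - fourier_coeff (v t) k"
      by (intro fourier_coeff_diff L2_integrable sobolev_spaceD(1)[OF dd] sobolev_spaceD(1)[OF vt])
    also have "fourier_coeff (\<lambda>x. (u s x - u t x) / of_real (s - t)) k = (fourier_coeff (u s) k - fourier_coeff (u t) k) / of_real (s - t)"
      unfolding fourier_coeff_divide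
      by (subst fourier_coeff_diff) (auto intro!: L2_integrable sobolev_spaceD(1)[OF us] s t)
    finally show ?thesis
      using fourier_coeff_le_sobolev_norm[OF sobolev_combination(1)[OF dd vt], of k] by simp
  qed
  have "((\<lambda>s. (fourier_coeff (u s) k - fourier_coeff (u t) k) / of_real (s - t) - fourier_coeff (v t) k) \<longlongrightarrow> 0) (at t within {0..})"
    by (rule Lim_null_comparison[OF _ lim]) (use bd in \<open>auto simp: eventually_at_filter\<close>)
  then show "((\<lambda>s. (fourier_coeff (u s) k - fourier_coeff (u t) k) / of_real (s - t)) \<longlongrightarrow> fourier_coeff (v t) k) (at t within {0..})"
    by (rule LIM_zero_cancel)
qed

subsection \<open>Trigonometric polynomials\<close>

lemma trig_series_finite:
  assumes "\<And>k. k \<notin> band N \<Longrightarrow> b k = 0"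
  shows "trig_series b x = (\<Sum>k\<in>band N. b k * cis (of_int k * x))"
  unfolding trig_series_def by (rule infsum_finite_support) (use assms in auto)

lemma trig_space_iff:
  "f \<in> trig_space N \<longleftrightarrow> (\<exists>b. (\<forall>k. k \<notin> band N \<longrightarrow> b k = 0) \<and> f = trig_series b)"
proof
  assume "f \<in> trig_space N"
  then obtain c where c: "f = (\<lambda>x. \<Sum>k\<in>band N. c k * cis (of_int k * x))" by (auto simp: trig_space_def)
  have l: "low N c k = 0" if "k \<notin> band N" for k by (rule low_out[OF that])
  have "f = trig_series (low N c)"
    unfolding c by (rule ext, subst trig_series_finite[OF l], assumption, rule sum.cong) (auto simp: low_def)
  with l show "\<exists>b. (\<forall>k. k \<notin> band N \<longrightarrow> b k = 0) \<and> f = trig_series b" by blast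
next
  assume "\<exists>b. (\<forall>k. k \<notin> band N \<longrightarrow> b k = 0) \<and> f = trig_series b"
  then obtain b where b: "\<And>k. k \<notin> band N \<Longrightarrow> b k = 0" "f = trig_series b" by blast
  have "f = (\<lambda>x. \<Sum>k\<in>band N. b k * cis (of_int k * x))"
    unfolding b(2) by (rule ext, rule trig_series_finite) (rule b(1))
  then show "f \<in> trig_space N" unfolding trig_space_def by blast
qed

lemma trig_spaceD:
  assumes "f \<in> trig_space N"
  shows "k \<notin> band N \<Longrightarrow> fourier_coeff f k = 0" "abs_summable (fourier_coeff f)"
    "f = trig_series (fourier_coeff f)" "f \<in> L2_per"
proof -
  obtain b where b: "\<And>k. k \<notin> band N \<Longrightarrow> b k = 0" "f = trig_series b"
    using assms unfolding trig_space_iff by blast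
  have s: "abs_summable b" by (rule finite_support_abs_summable[of N]) (rule b(1))
  have e: "fourier_coeff f = b" unfolding b(2) using fourier_coeff_trig_series[OF s] by blast
  show "k \<notin> band N \<Longrightarrow> fourier_coeff f k = 0" unfolding e by (rule b(1))
  show "abs_summable (fourier_coeff f)" unfolding e by (rule s)
  show "f = trig_series (fourier_coeff f)" unfolding e by (rule b(2))
  show "f \<in> L2_per" unfolding b(2) by (rule trig_series_L2[OF s])
qed

lemma cis_in_trig_space:
  assumes "k \<in> band N"
  shows "(\<lambda>x. cis (of_int k * x)) \<in> trig_space N"
proof -
  have "trig_series (\<lambda>j. if j = k then 1 else 0) = (\<lambda>x. cis (of_int k * x))"
  proof
    fix x
    have "trig_series (\<lambda>j. if j = k then 1 else 0) x = (\<Sum>l\<in>{k}. (if l = k then 1 else 0) * cis (of_int l * x))"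
      unfolding trig_series_def by (rule infsum_finite_support) auto
    then show "trig_series (\<lambda>j. if j = k then 1 else 0) x = cis (of_int k * x)" by simp
  qed
  then show ?thesis unfolding trig_space_iff using assms
    by (intro exI[of _ "\<lambda>j. if j = k then 1 else 0"]) auto
qed

lemma l2_inner_trig_space_zero:
  assumes f: "integrable per_measure f" and z: "\<And>k. k \<in> band N \<Longrightarrow> fourier_coeff f k = 0"
    and \<phi>: "\<phi> \<in> trig_space N"
  shows "l2_inner f \<phi> = 0"
proof -
  obtain c where c: "\<phi> = (\<lambda>x. \<Sum>k\<in>band N. c k * cis (of_int k * x))"
    using \<phi> by (auto simp: trig_space_def)
  have "l2_inner f \<phi> = (LINT x|per_measure. (\<Sum>k\<in>band N. cnj (c k) * (cis (of_int (- k) * x) * f x)))"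
    unfolding l2_inner_def c by (simp add: cis_cnj sum_distrib_left mult_ac)
  also have "\<dots> = (\<Sum>k\<in>band N. LINT x|per_measure. cnj (c k) * (cis (of_int (- k) * x) * f x))"
    by (rule Bochner_Integration.integral_sum) (intro integrable_mult_right integrable_cis_mult f)
  also have "\<dots> = (\<Sum>k\<in>band N. cnj (c k) * (2 * of_real pi * fourier_coeff f k))"
    by (simp only: integral_mult_right_zero integral_cis_mult minus_minus)
  also have "\<dots> = 0" by (rule sum.neutral) (use z in simp)
  finally show ?thesis .
qed

text \<open>The definite description is resolved by testing with single modes, which fixes the
  coefficients of any admissible \<open>p\<close> on the band.\<close>

lemma l2_proj_eq:
  assumes f: "f \<in> L2_per"
  shows "l2_proj N f = trig_series (low N (fourier_coeff f))"
  unfolding l2_proj_def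
proof (rule the_equality)
  let ?p = "trig_series (low N (fourier_coeff f))"
  have pi: "integrable per_measure ?p" by (rule integrable_trig_series[OF low_abs_summable])
  have "?p \<in> trig_space N" unfolding trig_space_iff using low_out by blast
  moreover have "l2_inner (\<lambda>x. f x - ?p x) \<phi> = 0" if "\<phi> \<in> trig_space N" for \<phi>
  proof (rule l2_inner_trig_space_zero[OF _ _ that])
    show "integrable per_measure (\<lambda>x. f x - ?p x)"
      by (rule Bochner_Integration.integrable_diff[OF L2_integrable[OF f] pi])
    show "fourier_coeff (\<lambda>x. f x - ?p x) k = 0" if "k \<in> band N" for k
      using that by (simp only: fourier_coeff_diff[OF L2_integrable[OF f] pi] fourier_coeff_trig_series[OF low_abs_summable]) (simp add: low_def)
  qed
  ultimately show "?p \<in> trig_space N \<and> (\<forall>\<phi>\<in>trig_space N. l2_inner (\<lambda>x. f x - ?p x) \<phi> = 0)" by blast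
next
  fix p assume p: "p \<in> trig_space N \<and> (\<forall>\<phi>\<in>trig_space N. l2_inner (\<lambda>x. f x - p x) \<phi> = 0)"
  then have pt: "p \<in> trig_space N" by blast
  note b = trig_spaceD[OF pt]
    have "fourier_coeff p k = low N (fourier_coeff f) k" for k
    proof (cases "k \<in> band N")
      case True
      then have "l2_inner (\<lambda>x. f x - p x) (\<lambda>x. cis (of_int k * x)) = 0"
        using p cis_in_trig_space by blast
      then show ?thesis using True
        by (simp add: l2_inner_cis fourier_coeff_diff[OF L2_integrable[OF f] L2_integrable[OF b(4)]] low_def)
    next
      case False
      then show ?thesis using b(1)[OF False] low_out[OF False] by simp
    qed
    then have "fourier_coeff p = low N (fourier_coeff f)" by blast
    with b(3) show "p = trig_series (low N (fourier_coeff f))" by simp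
qed

lemma Dx_trig_series:
  assumes "\<And>k. k \<notin> band N \<Longrightarrow> b k = 0"
  shows "Dx (trig_series b) = trig_series (\<lambda>k. \<i> * of_int k * b k)"
proof -
  have 1: "trig_series b = (\<lambda>x. \<Sum>k\<in>band N. b k * cis (of_int k * x))"
    by (rule ext, rule trig_series_finite) (rule assms)
  have 2: "trig_series (\<lambda>k. \<i> * of_int k * b k) = (\<lambda>x. \<Sum>k\<in>band N. b k * (\<i> * of_int k * cis (of_int k * x)))"
  proof
    fix x
    have "trig_series (\<lambda>k. \<i> * of_int k * b k) x = (\<Sum>k\<in>band N. \<i> * of_int k * b k * cis (of_int k * x))"
      by (rule trig_series_finite) (use assms in simp)
    then show "trig_series (\<lambda>k. \<i> * of_int k * b k) x = (\<Sum>k\<in>band N. b k * (\<i> * of_int k * cis (of_int k * x)))"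
      by (simp add: mult_ac)
  qed
  show ?thesis unfolding 1 2
    by (intro Dx_eqI has_vector_derivative_sum has_vector_derivative_mult_right has_vector_derivative_cis_int)
qed

lemma Dx_funpow_trig_series:
  assumes "\<And>k. k \<notin> band N \<Longrightarrow> b k = 0"
  shows "(Dx ^^ n) (trig_series b) = trig_series (\<lambda>k. (\<i> * of_int k) ^ n * b k)"
proof (induction n)
  case (Suc n)
  have "Dx (trig_series (\<lambda>k. (\<i> * of_int k) ^ n * b k)) = trig_series (\<lambda>k. \<i> * of_int k * ((\<i> * of_int k) ^ n * b k))"
    by (rule Dx_trig_series[of N]) (use assms in simp)
  with Suc show ?case by (simp add: mult.assoc)
qed simp

text \<open>The third and fifth derivatives have opposite signs in the equation, and so do i^3 and
  i^5. The two dispersive terms therefore reinforce each other and give a monotone phase, on which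
  the gap rests.\<close>

lemma dispersion_symbol: "(\<i> * of_int k) ^ 3 - (\<i> * of_int k) ^ 5 = - (\<i> * of_real (omega k))"
proof -
  have "\<i> ^ 3 = - \<i>" "\<i> ^ 5 = \<i>" by (simp_all add: numeral_eq_Suc)
  then show ?thesis by (simp only: power_mult_distrib) (simp add: omega_def algebra_simps)
qed

lemma fourier_coeff_galerkin:
  assumes b: "\<And>k. k \<notin> band N \<Longrightarrow> b k = 0"
  shows "fourier_coeff (\<lambda>x. trig_series b x * Dx (trig_series b) x + (Dx ^^ 3) (trig_series b) x - (Dx ^^ 5) (trig_series b) x) k
    = - (\<i> * of_real (omega k) * b k + nonlin b k)"
proof -
  let ?d = "\<lambda>n k. (\<i> * of_int k) ^ n * b k"
  have s: "abs_summable (?d n)" for n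
    by (rule finite_support_abs_summable[of N]) (use b in simp)
  have sb: "abs_summable b" using s[of 0] by simp
  have s1: "abs_summable (\<lambda>k. \<i> * of_int k * b k)" using s[of 1] by simp
  have D: "(Dx ^^ n) (trig_series b) = trig_series (?d n)" for n by (rule Dx_funpow_trig_series[OF b])
  have D1: "Dx (trig_series b) = trig_series (\<lambda>k. \<i> * of_int k * b k)" by (rule Dx_trig_series[OF b])
  have i1: "integrable per_measure (\<lambda>x. trig_series b x * trig_series (\<lambda>k. \<i> * of_int k * b k) x)"
    by (intro L2_mult_integrable trig_series_L2 sb s1)
  have i: "integrable per_measure (trig_series (?d n))" for n by (rule integrable_trig_series[OF s])
  have "fourier_coeff (\<lambda>x. trig_series b x * Dx (trig_series b) x + (Dx ^^ 3) (trig_series b) x - (Dx ^^ 5) (trig_series b) x) k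
    = conv b (fourier_coeff (trig_series (\<lambda>k. \<i> * of_int k * b k))) k + ?d 3 k - ?d 5 k"
    unfolding D D1
    by (simp only: fourier_coeff_diff[OF Bochner_Integration.integrable_add[OF i1 i] i] fourier_coeff_add[OF i1 i]
        fourier_coeff_trig_series_mult[OF sb integrable_trig_series[OF s1]] fourier_coeff_trig_series[OF s])
  also have "fourier_coeff (trig_series (\<lambda>k. \<i> * of_int k * b k)) = (\<lambda>k. \<i> * of_int k * b k)"
    using fourier_coeff_trig_series[OF s1] by blast
  also have "conv b (\<lambda>k. \<i> * of_int k * b k) k = - nonlin b k" by (rule conv_deriv[OF sb s1])
  also have "- nonlin b k + ?d 3 k - ?d 5 k = - nonlin b k + ((\<i> * of_int k) ^ 3 - (\<i> * of_int k) ^ 5) * b k"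
    by (simp add: algebra_simps)
  finally show "fourier_coeff (\<lambda>x. trig_series b x * Dx (trig_series b) x + (Dx ^^ 3) (trig_series b) x - (Dx ^^ 5) (trig_series b) x) k
    = - (\<i> * of_real (omega k) * b k + nonlin b k)"
    unfolding dispersion_symbol by simp
qed

text \<open>Testing with one mode of the band extracts one coefficient of the scheme; the factor 2
  pi is common to both terms and cancels.\<close>

lemma galerkin_scheme_fourier:
  assumes U: "galerkin_cn_solution N M dt u0 U" and m: "m < M" and k: "k \<in> band N"
  defines "c \<equiv> \<lambda>m. fourier_coeff (U m)"
  shows "c (Suc m) k - c m k
        = of_real dt * (\<i> * of_real (omega k) * ((c m k + c (Suc m) k) / 2) + nonlin (\<lambda>k. (c m k + c (Suc m) k) / 2) k)"
proof -
  let ?V = "\<lambda>x. (U m x + U (Suc m) x) / 2"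
  have cU: "fourier_coeff (U j) = c j" for j by (simp add: c_def)
  have "U m \<in> trig_space N" "U (Suc m) \<in> trig_space N"
    using U m by (auto simp: galerkin_cn_solution_def)
  note c0 = trig_spaceD[OF this(1), unfolded cU] and c1 = trig_spaceD[OF this(2), unfolded cU]
  let ?b = "\<lambda>k. (c m k + c (Suc m) k) / 2"
  have b0: "?b k = 0" if "k \<notin> band N" for k using c0(1)[OF that] c1(1)[OF that] by simp
  have V: "?V = trig_series ?b"
  proof
    fix x
    have "trig_series (c m) x = (\<Sum>k\<in>band N. c m k * cis (of_int k * x))"
      by (rule trig_series_finite) (rule c0(1))
    moreover have "trig_series (c (Suc m)) x = (\<Sum>k\<in>band N. c (Suc m) k * cis (of_int k * x))"
      by (rule trig_series_finite) (rule c1(1))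
    moreover have "trig_series ?b x = (\<Sum>k\<in>band N. ?b k * cis (of_int k * x))"
      by (rule trig_series_finite) (rule b0)
    ultimately show "?V x = trig_series ?b x"
      by (subst c0(3), subst c1(3)) (simp add: sum.distrib[symmetric] sum_divide_distrib distrib_right)
  qed
  let ?F = "\<lambda>x. ?V x * Dx ?V x + (Dx ^^ 3) ?V x - (Dx ^^ 5) ?V x"
  have "l2_inner (\<lambda>x. U (Suc m) x - U m x) (\<lambda>x. cis (of_int k * x)) + of_real dt * l2_inner ?F (\<lambda>x. cis (of_int k * x)) = 0"
    using U m cis_in_trig_space[OF k] by (simp add: galerkin_cn_solution_def Let_def)
  then have "2 * of_real pi * (fourier_coeff (\<lambda>x. U (Suc m) x - U m x) k + of_real dt * fourier_coeff ?F k) = 0"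
    unfolding l2_inner_cis by (simp add: algebra_simps)
  then have "fourier_coeff (\<lambda>x. U (Suc m) x - U m x) k + of_real dt * fourier_coeff ?F k = 0"
    by simp
  moreover have "fourier_coeff (\<lambda>x. U (Suc m) x - U m x) k = c (Suc m) k - c m k"
    unfolding c_def by (intro fourier_coeff_diff L2_integrable c0 c1)
  moreover have "fourier_coeff ?F k = - (\<i> * of_real (omega k) * ?b k + nonlin ?b k)"
  proof -
    have "?F = (\<lambda>x. trig_series ?b x * Dx (trig_series ?b) x + (Dx ^^ 3) (trig_series ?b) x - (Dx ^^ 5) (trig_series ?b) x)"
      unfolding V fun_cong[OF V] ..
    then show ?thesis using fourier_coeff_galerkin[of N ?b k] b0 by simp
  qed
  ultimately have "c (Suc m) k - c m k + of_real dt * - (\<i> * of_real (omega k) * ?b k + nonlin ?b k) = 0"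
    by (simp only:)
  then show ?thesis
    unfolding mult_minus_right add_uminus_conv_diff by (rule eq_iff_diff_eq_0[THEN iffD2])
qed

subsection \<open>The Kawahara equation on the Fourier side\<close>

lemma kawahara_fourier:
  assumes u: "kawahara_solution r u0 u" and r: "16 \<le> r" and t: "0 \<le> t"
  shows "((\<lambda>s. fourier_coeff (u s) k) has_vector_derivative
      (\<i> * of_real (omega k) * fourier_coeff (u t) k + nonlin (fourier_coeff (u t)) k)) (at t within {0..})"
proof -
  let ?a = "fourier_coeff (u t)"
  obtain ut where ut: "C1_sobolev_deriv (r - 5) u ut"
    and eq: "\<forall>t\<ge>0. \<exists>ux uxxx uxxxxx. weak_deriv 1 (u t) ux \<and> weak_deriv 3 (u t) uxxx \<and> weak_deriv 5 (u t) uxxxxx \<and>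
                 (AE x in per_measure. ut t x + u t x * ux x + uxxx x - uxxxxx x = 0)"
    using u by (auto simp: kawahara_solution_def)
  then obtain ux uxxx uxxxxx where w: "weak_deriv 1 (u t) ux" "weak_deriv 3 (u t) uxxx" "weak_deriv 5 (u t) uxxxxx"
    and ae: "AE x in per_measure. ut t x + u t x * ux x + uxxx x - uxxxxx x = 0"
    using t by blast
  have L: "ux \<in> L2_per" "uxxx \<in> L2_per" "uxxxxx \<in> L2_per" using w by (auto simp: weak_deriv_def)
  have us: "u t \<in> sobolev_space r" using u t by (simp add: kawahara_solution_def C0_sobolev_def)
  have uL: "u t \<in> L2_per" by (rule sobolev_spaceD(1)[OF us])
  have utL: "ut t \<in> L2_per" using ut t by (auto simp: C1_sobolev_deriv_def C0_sobolev_def dest: sobolev_spaceD)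
  have dec: "decays r (2 ^ r * sobolev_norm r (u t)) ?a" by (rule decays_fourier_coeff[OF us])
  have sa: "abs_summable ?a" by (rule decays_abs_summable[OF dec]) (use r in simp)
  have sda: "abs_summable (\<lambda>k. \<i> * of_int k * ?a k)"
  proof (rule decays_abs_summable)
    have "decays (2 + 1) (2 ^ r * sobolev_norm r (u t)) ?a"
      by (rule decays_mono[OF dec]) (use r in auto)
    moreover have "norm (\<i> * of_int k) \<le> 1 * wt k ^ 1" for k by (simp add: norm_mult wt_def)
    ultimately show "decays 2 (1 * (2 ^ r * sobolev_norm r (u t))) (\<lambda>k. \<i> * of_int k * ?a k)"
      by (rule decays_multiplier)
  qed simp
  have uux: "integrable per_measure (\<lambda>x. u t x * ux x)" by (rule L2_mult_integrable[OF uL L(1)])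
  have tux: "integrable per_measure (\<lambda>x. trig_series ?a x * ux x)" by (rule L2_mult_integrable[OF trig_series_L2[OF sa] L(1)])
  note i = L2_integrable[OF L(2)] L2_integrable[OF L(3)]
  \<comment> \<open>\<open>u t\<close> is replaced by its series, to which it is equal almost
    everywhere, so that the product rule applies with \<open>ux\<close>, of which only square
    integrability is known.\<close>
  have "fourier_coeff (ut t) k = fourier_coeff (\<lambda>x. uxxxxx x - uxxx x - trig_series ?a x * ux x) k"
  proof (rule fourier_coeff_cong_AE)
    show "AE x in per_measure. ut t x = uxxxxx x - uxxx x - trig_series ?a x * ux x"
      using ae AE_eq_trig_series[OF uL sa]
    proof eventually_elim
      case (elim x)
      have "ut t x = uxxxxx x - uxxx x - u t x * ux x"
        using elim(1) by (simp add: algebra_simps eq_neg_iff_add_eq_0)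
      then show ?case using elim(2) by simp
    qed
    show "ut t \<in> borel_measurable per_measure" by (rule L2_perD(2)[OF utL])
    show "(\<lambda>x. uxxxxx x - uxxx x - trig_series ?a x * ux x) \<in> borel_measurable per_measure"
      by (intro borel_measurable_integrable Bochner_Integration.integrable_diff i tux)
  qed
  also have "\<dots> = (\<i> * of_int k) ^ 5 * ?a k - (\<i> * of_int k) ^ 3 * ?a k - conv ?a (fourier_coeff ux) k"
    by (simp only: fourier_coeff_diff[OF Bochner_Integration.integrable_diff[OF i(2,1)] tux] fourier_coeff_diff[OF i(2,1)]
        weak_deriv_fourier_coeff[OF w(2)] weak_deriv_fourier_coeff[OF w(3)] fourier_coeff_trig_series_mult[OF sa L2_integrable[OF L(1)]])
  also have "fourier_coeff ux = (\<lambda>k. \<i> * of_int k * ?a k)"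
    using weak_deriv_fourier_coeff[OF w(1)] by auto
  also have "conv ?a (\<lambda>k. \<i> * of_int k * ?a k) k = - nonlin ?a k" by (rule conv_deriv[OF sa sda])
  also have "(\<i> * of_int k) ^ 5 * ?a k - (\<i> * of_int k) ^ 3 * ?a k - - nonlin ?a k
     = - ((\<i> * of_int k) ^ 3 - (\<i> * of_int k) ^ 5) * ?a k + nonlin ?a k"
    by (simp add: algebra_simps)
  finally have "fourier_coeff (ut t) k = \<i> * of_real (omega k) * ?a k + nonlin ?a k"
    unfolding dispersion_symbol by simp
  then show ?thesis using fourier_coeff_time_derivative[OF ut t, of k] by simp
qed

section \<open>Return from coefficients to functions\<close>

theorem mainTheorem5:
  fixes T :: real and r :: nat
    and u0 :: "real \<Rightarrow> complex" and u :: "real \<Rightarrow> real \<Rightarrow> complex"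
  assumes "0 < T" and "16 \<le> r"
    and "u0 \<in> sobolev_space r" and "real_valued u0"
    and "kawahara_solution r u0 u"
  shows "\<exists>C\<^sub>1>0. \<exists>C>0. \<forall>(N::nat) (M::nat) (dt::real) (U :: nat \<Rightarrow> real \<Rightarrow> complex).
           0 < N \<longrightarrow> 0 < M \<longrightarrow> dt = T / real M \<longrightarrow> real N * dt \<le> C\<^sub>1 \<longrightarrow>
           galerkin_cn_solution N M dt u0 U \<longrightarrow>
           (MAX m\<in>{0..M}. l2_norm (\<lambda>x. u (real m * dt) x - U m x))
             \<le> C * (1 / real N ^ r + dt\<^sup>2)"
proof -
  note T = assms(1) and r = assms(2) and u0 = assms(3) and sol = assms(5)
  define S where "S = {0..T}"
  define a where "a t = fourier_coeff (u t)" for t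
  have C0: "C0_sobolev r u" using sol by (simp add: kawahara_solution_def)
  have us: "u t \<in> sobolev_space r" if "0 \<le> t" for t using C0 that by (simp add: C0_sobolev_def)
  obtain G where G: "0 \<le> G" "\<And>t. t \<in> {0..T} \<Longrightarrow> sobolev_norm r (u t) \<le> G"
    using C0_sobolev_bounded[OF C0] T by (metis less_imp_le)
  define B where "B = 2 ^ r * G"
  have B0: "0 \<le> B" using G by (simp add: B_def)
  have adec: "decays r B (a t)" if "t \<in> S" for t
    unfolding a_def B_def
    by (rule decays_mono[OF decays_fourier_coeff[OF us]]) (use that G in \<open>auto simp: S_def\<close>)
  have ode: "((\<lambda>s. a s k) has_vector_derivative (\<i> * of_real (omega k) * a t k + nonlin (a t) k)) (at t within S)"
    if "t \<in> S" for t k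
    unfolding a_def
    by (rule has_vector_derivative_within_subset[OF kawahara_fourier[OF sol r]]) (use that in \<open>auto simp: S_def\<close>)
  have S: "convex S" by (simp add: S_def)
  obtain B1 B3 where B13: "0 \<le> B1" "0 \<le> B3"
    and da: "\<And>t h. 0 \<le> h \<Longrightarrow> {t..t + h} \<subseteq> S \<Longrightarrow> decays 11 (B1 * h) (\<lambda>k. a (t + h) k - a t k)"
    and tr: "\<And>t h. 0 \<le> h \<Longrightarrow> {t..t + h} \<subseteq> S \<Longrightarrow> decays 1 (B3 * h ^ 3) (trapezoid_defect h (a t) (a (t + h)))"
  proof (rule fourier_ode_bounds[where a=a and B=B, OF r S])
    show "decays r B (a t)" if "t \<in> S" for t by (rule adec[OF that])
    show "((\<lambda>s. a s k) has_vector_derivative (\<i> * of_real (omega k) * a t k + nonlin (a t) k)) (at t within S)"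
      if "t \<in> S" for t k by (rule ode[OF that])
  qed (rule that)
  define D where "D = growth_const B"
  define K where "K = error_const r B B1 B3 T"
  have D0: "0 \<le> D" unfolding D_def by (rule growth_const_nonneg[OF B0])
  have K0: "0 \<le> K" unfolding K_def by (rule error_const_nonneg) (use B0 B13 T in auto)
  \<comment> \<open>The root of 2 pi is the Parseval factor for this normalisation of coefficients,
    \<open>K\<close> bounds the error inside the band and \<open>G\<close> the tail outside; adding
    1 makes \<open>C\<close> positive.\<close>
  define C where "C = sqrt (2 * pi) * (K + G) + 1"
  have C0': "0 \<le> sqrt (2 * pi) * (K + G)" using K0 G by simp
  have main: "l2_norm (\<lambda>x. u (real m * dt) x - U m x) \<le> C * (1 / real N ^ r + dt\<^sup>2)"
    if N: "0 < N" and M: "0 < M" and dt: "dt = T / real M" and small: "real N * dt \<le> 2 / (D + 1)"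
      and U: "galerkin_cn_solution N M dt u0 U" and m: "m \<le> M"
    for N M m :: nat and dt :: real and U :: "nat \<Rightarrow> real \<Rightarrow> complex"
  proof -
    let ?E = "1 / real N ^ r + dt\<^sup>2"
    define c where "c m = fourier_coeff (U m)" for m
    have dt0: "0 \<le> dt" using T by (simp add: dt)
    have MT: "real M * dt = T" using M by (simp add: dt)
    have tS: "real m * dt \<in> S" if "m \<le> M" for m
      using that dt0 MT mult_right_mono[of "real m" "real M" dt] by (simp add: S_def)
    have Suc_t: "real (Suc m) * dt = real m * dt + dt" for m by (simp add: algebra_simps)
    have sub: "{real m * dt..real m * dt + dt} \<subseteq> S" if "m < M" for m
      using tS[of m] tS[of "Suc m"] that unfolding Suc_t by (auto simp: S_def)
    have UT: "U m \<in> trig_space N" "real_valued (U m)" if "m \<le> M" for m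
      using U that by (auto simp: galerkin_cn_solution_def)
    have dtD: "dt * growth_const B \<le> 2"
    proof -
      \<comment> \<open>Since N >= 1, the restriction on the product bounds \<open>dt\<close>
        itself. The 1 in D + 1 excludes a zero denominator.\<close>
      have "dt \<le> real N * dt" using N dt0 by (simp add: mult_le_cancel_right1)
      then have "dt * (D + 1) \<le> 2" using small D0 by (simp add: le_divide_eq) (meson add_nonneg_pos mult_right_mono order_trans less_imp_le zero_less_one)
      then show ?thesis using dt0 by (simp add: D_def algebra_simps)
    qed
    have err: "band_norm N (\<lambda>k. a (real m * dt) k - c m k) \<le> error_const r B B1 B3 (real M * dt) * ?E"
    proof (rule scheme_error[OF N dt0 _ B13, where a="\<lambda>m. a (real m * dt)" and c=c])
      show "decays r B (a (real m * dt))" if "m \<le> M" for m by (rule adec[OF tS[OF that]])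
      show "a (real m * dt) (- k) = cnj (a (real m * dt) k)" if "m \<le> M" for m k
        unfolding a_def by (rule fourier_coeff_cnj) (use sol dt0 in \<open>auto simp: kawahara_solution_def\<close>)
      show "decays 11 (B1 * dt) (\<lambda>k. a (real (Suc m) * dt) k - a (real m * dt) k)" if "m < M" for m
        unfolding Suc_t by (rule da[OF dt0 sub[OF that]])
      show "decays 1 (B3 * dt ^ 3) (trapezoid_defect dt (a (real m * dt)) (a (real (Suc m) * dt)))" if "m < M" for m
        unfolding Suc_t by (rule tr[OF dt0 sub[OF that]])
      show "c m k = 0" if "m \<le> M" "k \<notin> band N" for m k
        unfolding c_def by (rule trig_spaceD(1)[OF UT(1)[OF that(1)] that(2)])
      show "c m (- k) = cnj (c m k)" if "m \<le> M" for m k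
        unfolding c_def by (rule fourier_coeff_cnj[OF UT(2)[OF that]])
      show "c 0 k = low N (a (real 0 * dt)) k" for k
      proof -
        have "U 0 = trig_series (low N (fourier_coeff u0))"
          using U l2_proj_eq[OF sobolev_spaceD(1)[OF u0]] by (simp add: galerkin_cn_solution_def)
        then have "c 0 k = low N (fourier_coeff u0) k"
          by (simp add: c_def fourier_coeff_trig_series[OF low_abs_summable])
        moreover have "fourier_coeff u0 k = a 0 k" for k
          unfolding a_def
        proof (rule fourier_coeff_cong_AE)
          have "AE x in per_measure. u 0 x = u0 x" using sol by (simp add: kawahara_solution_def)
          then show "AE x in per_measure. u0 x = u 0 x" by (rule eventually_mono) simp
          show "u0 \<in> borel_measurable per_measure" "u 0 \<in> borel_measurable per_measure"
            by (rule L2_perD(2)[OF sobolev_spaceD(1)[OF u0]], rule L2_perD(2)[OF sobolev_spaceD(1)[OF us[OF order_refl]]])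
        qed
        ultimately show ?thesis by (simp add: low_def)
      qed
      show "c (Suc m) k - c m k
        = of_real dt * (\<i> * of_real (omega k) * ((c m k + c (Suc m) k) / 2) + nonlin (\<lambda>k. (c m k + c (Suc m) k) / 2) k)"
        if "m < M" "k \<in> band N" for m k
        unfolding c_def by (rule galerkin_scheme_fourier[OF U that])
    qed (use r dtD m in auto)
    then have err: "band_norm N (\<lambda>k. a (real m * dt) k - c m k) \<le> K * ?E"
      unfolding MT K_def .
    have t0: "0 \<le> real m * dt" using dt0 by simp
    note ut = us[OF t0]
    have cz: "c m k = 0" if "k \<notin> band N" for k
      unfolding c_def by (rule trig_spaceD(1)[OF UT(1)[OF m] that])
    have UL: "U m \<in> L2_per" by (rule trig_spaceD(4)[OF UT(1)[OF m]])
    have uL: "u (real m * dt) \<in> L2_per" by (rule sobolev_spaceD(1)[OF ut])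
    let ?d = "\<lambda>x. u (real m * dt) x - U m x"
    have dk: "fourier_coeff ?d k = a (real m * dt) k - c m k" for k
      unfolding a_def c_def by (rule fourier_coeff_diff[OF L2_integrable[OF uL] L2_integrable[OF UL]])
    have sa: "abs_summable (a (real m * dt))"
      by (rule decays_abs_summable[OF adec[OF tS[OF m]]]) (use r in simp)
    have sc: "abs_summable (c m)" by (rule finite_support_abs_summable[of N]) (rule cz)
    have sd: "abs_summable (fourier_coeff ?d)"
      unfolding dk by (rule abs_summable_diff[OF sa sc])
    \<comment> \<open>Outside the band \<open>U m\<close> has no coefficients, so the tail is that
      of the exact solution.\<close>
    have tail: "(\<Sum>\<^sub>\<infinity>k\<in>- band N. (norm (fourier_coeff ?d k))\<^sup>2) \<le> (G * ?E)\<^sup>2"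
    proof -
      have "(\<Sum>\<^sub>\<infinity>k\<in>- band N. (norm (fourier_coeff ?d k))\<^sup>2) = (\<Sum>\<^sub>\<infinity>k\<in>- band N. (norm (fourier_coeff (u (real m * dt)) k))\<^sup>2)"
        by (rule infsum_cong) (simp add: dk cz a_def del: atLeastAtMost_iff)
      also have "\<dots> \<le> (sobolev_norm r (u (real m * dt)) / real N ^ r)\<^sup>2"
        by (rule sobolev_tail_le[OF ut N])
      also have "\<dots> \<le> (G * ?E)\<^sup>2"
      proof (rule power_mono)
        have "sobolev_norm r (u (real m * dt)) / real N ^ r \<le> G / real N ^ r"
          using G(2)[of "real m * dt"] tS[OF m] by (intro divide_right_mono) (auto simp: S_def)
        also have "\<dots> = G * (1 / real N ^ r)" by simp
        also have "\<dots> \<le> G * ?E" using G(1) by (intro mult_left_mono) auto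
        finally show "sobolev_norm r (u (real m * dt)) / real N ^ r \<le> G * ?E" .
      qed (simp add: sobolev_norm_nonneg)
      finally show ?thesis .
    qed
    have "(\<Sum>\<^sub>\<infinity>k. (norm (fourier_coeff ?d k))\<^sup>2) \<le> (K * ?E)\<^sup>2 + (G * ?E)\<^sup>2"
    proof -
      have sq: "(\<lambda>k. (norm (fourier_coeff ?d k))\<^sup>2) summable_on A" for A
      proof (rule summable_on_subset_banach[of _ UNIV])
        have "abs_summable (\<lambda>k. fourier_coeff ?d k * fourier_coeff ?d k)"
          by (rule abs_summable_mult_bounded[OF sd abs_summable_bounded[OF sd]])
        then show "(\<lambda>k. (norm (fourier_coeff ?d k))\<^sup>2) summable_on UNIV"
          by (simp add: norm_mult power2_eq_square)
      qed simp
      have "(\<Sum>\<^sub>\<infinity>k\<in>band N \<union> - band N. (norm (fourier_coeff ?d k))\<^sup>2)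
        = (\<Sum>\<^sub>\<infinity>k\<in>band N. (norm (fourier_coeff ?d k))\<^sup>2) + (\<Sum>\<^sub>\<infinity>k\<in>- band N. (norm (fourier_coeff ?d k))\<^sup>2)"
        by (rule infsum_Un_disjoint[OF sq sq]) blast
      moreover have "(\<Sum>\<^sub>\<infinity>k\<in>band N. (norm (fourier_coeff ?d k))\<^sup>2) = (band_norm N (\<lambda>k. a (real m * dt) k - c m k))\<^sup>2"
        by (simp add: band_norm_power2 dk)
      moreover have "(band_norm N (\<lambda>k. a (real m * dt) k - c m k))\<^sup>2 \<le> (K * ?E)\<^sup>2"
        by (intro power_mono err) simp
      ultimately show ?thesis using tail by simp
    qed
    also have "\<dots> \<le> ((K + G) * ?E)\<^sup>2"
    proof -
      have "0 \<le> 2 * (K * ?E) * (G * ?E)" using K0 G(1) by simp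
      then show ?thesis unfolding distrib_right power2_sum by linarith
    qed
    finally have "2 * pi * (\<Sum>\<^sub>\<infinity>k. (norm (fourier_coeff ?d k))\<^sup>2) \<le> 2 * pi * ((K + G) * ?E)\<^sup>2"
      by (intro mult_left_mono) auto
    then have "l2_norm ?d \<le> sqrt (2 * pi * ((K + G) * ?E)\<^sup>2)"
      unfolding l2_norm_eq_fourier[OF L2_diff[OF uL UL] sd] by (rule real_sqrt_le_mono)
    also have "\<dots> = sqrt (2 * pi) * (K + G) * ?E"
      using K0 G(1) by (simp add: real_sqrt_mult)
    also have "\<dots> \<le> C * ?E"
      unfolding C_def by (intro mult_right_mono) auto
    finally show ?thesis .
  qed
  show ?thesis
  proof (rule exI[of _ "2 / (D + 1)"], rule conjI[OF _ exI[of _ C]], goal_cases)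
    case 1
    show ?case using D0 by (simp add: add_nonneg_pos)
  next
    case 2
    have "(MAX m\<in>{0..M}. l2_norm (\<lambda>x. u (real m * dt) x - U m x)) \<le> C * (1 / real N ^ r + dt\<^sup>2)"
      if "0 < N" "0 < M" "dt = T / real M" "real N * dt \<le> 2 / (D + 1)" "galerkin_cn_solution N M dt u0 U"
      for N M :: nat and dt :: real and U :: "nat \<Rightarrow> real \<Rightarrow> complex"
    proof (rule Max.boundedI)
      fix e assume "e \<in> (\<lambda>m. l2_norm (\<lambda>x. u (real m * dt) x - U m x)) ` {0..M}"
      then obtain m where "m \<le> M" "e = l2_norm (\<lambda>x. u (real m * dt) x - U m x)" by auto
      then show "e \<le> C * (1 / real N ^ r + dt\<^sup>2)" using main[OF that] by simp
    qed simp_all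
    moreover have "0 < C" using C0' by (simp add: C_def)
    ultimately show ?case by blast
  qed
qed

end
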